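(* Suppose that (A1) every element $E\in\mathcal{T}_h$ has at most one face on $\Gamma_N$, and (A2) $\mathcal{T}_h$ can be agglomerated into a conforming mesh of $k_1\times k_2\times k_3$ macroelements, $k_1,k_2,k_3\in\{2,3\}$. Then the MSMFE-1 method has a unique solution: for every $f\in L^2(\Omega,\mathbb{R}^3)$ there exists exactly one triple $(\sigma_h,u_h,\gamma_h)\in\mathbb{X}_h\times V_h\times\mathbb{W}_h^1$ such that $$(A\sigma_h,\tau)_Q+(u_h,\operatorname{div}\tau)+(\gamma_h,\tau)_Q=0\quad\forall\tau\in\mathbb{X}_h,$$ $$(\operatorname{div}\sigma_h,v)=(f,v)\quad\forall v\in V_h,$$ $$(\sigma_h,w)_Q=0\quad\forall w\in\mathbb{W}_h^1.$$
   Context: **Setting.** $\Omega\subset\mathbb{R}^3$ is a simply connected bounded domain, $\partial\Omega=\Gamma_D\cup\Gamma_N$ with $\Gamma_D\neq\emptyset$. $\mathbb{M}$ and $\mathbb{N}$ denote the real $3\times3$ matrices and the skew-symmetric $3\times 3$ matrices. $\operatorname{div}$ and $\operatorname{curl}$ act row-wise on matrix fields. $(\cdot,\cdot)$, $\|\cdot\|$ are the $L^2(\Omega)$ inner product and norm ($:$ is the Frobenius product). The compliance tensor $A=A(\mathbf{x})$ is a symmetric, bounded, uniformly positive definite linear operator $\mathbb{M}\to\mathbb{M}$, element-wise continuous on the mesh below. **Mesh.** $\mathcal{T}_h$ is a shape-regular, conforming (face-to-face) partition of $\Omega$ into cuboids (rectangular boxes); $\Gamma_D$ and $\Gamma_N$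 are unions of element faces. A $k_1\times k_2\times k_3$ macroelement is a cuboid that is the union of a $k_1\times k_2\times k_3$ array of elements of $\mathcal{T}_h$. $\hat E=[0,1]^3$ is the reference cube with vertices $\hat{\mathbf r}_1=(0,0,0)$, $\hat{\mathbf r}_2=(1,0,0)$, $\hat{\mathbf r}_3=(1,1,0)$, $\hat{\mathbf r}_4=(0,1,0)$, $\hat{\mathbf r}_5=(0,0,1)$, $\hat{\mathbf r}_6=(1,0,1)$, $\hat{\mathbf r}_7=(1,1,1)$, $\hat{\mathbf r}_8=(0,1,1)$. For an element $E$ with corresponding vertices $\mathbf r_1,\dots,\mathbf r_8$, $F_E:\hat E\to E$ is the affine bijection $F_E(\hat{\mathbf{x}})=\mathbf r_1+(\mathbf r_2-\mathbf r_1)\hat x+(\mathbf r_4-\mathbf r_1)\hat y+(\mathbf r_5-\mathbf r_1)\hat z$, with Jacobian matrix $DF_E$ and $J_E=|\det DF_E|$. **Enhanced Raviart-Thomas space.** $\mathcal{RT}_0(\hat E)=\{(\alpha_1+\beta_1\hat x,\alpha_2+\beta_2\hat y,\alpha_3+\beta_3\hat z)^T:\alpha_i,\beta_i\in\mathbb{R}\}$. $\mathcal B(\hat E)$ is the span of the vectors $(b,0,0)^T$ with $b\in\{\hat y,\hat z,\hat x\hat y,\hat x\hat z,\hat y\hat z,\hat x\hat y\hat z\}$, $(0,b,0)^T$ with $b\in\{\hat x,\hat z,\hat x\hat y,\hat x\hat z,\hat y\hat z,\hat x\hat y\hat z\}$, and $(0,0,b)^T$ with $b\in\{\hat x,\hat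 y,\hat x\hat y,\hat x\hat z,\hat y\hat z,\hat x\hat y\hat z\}$. Then $\mathcal{ERT}_0(\hat E)=\mathcal{RT}_0(\hat E)+\operatorname{curl}(\hat{\mathbf x}\times\mathcal B(\hat E))$, where $\hat{\mathbf x}=(\hat x,\hat y,\hat z)^T$ and $\times$ is the cross product. **Discrete spaces.** $\mathbb{X}_h$ is the set of $\tau\in L^2(\Omega,\mathbb{M})$ with $\operatorname{div}\tau\in L^2(\Omega,\mathbb{R}^3)$, $\tau n=0$ on $\Gamma_N$, such that on each $E$, $\tau^T=\frac1{J_E}DF_E\,\hat\tau^T\circ F_E^{-1}$ for some $\hat\tau$ whose three rows belong to $\mathcal{ERT}_0(\hat E)$ (row-wise Piola transform). $V_h$ is the space of $\mathbb{R}^3$-valued functions constant on each element. $\mathbb{W}_h^1$ is the space of continuous $\mathbb{N}$-valued functions $w$ on $\Omega$ such that, for each $E$, every entry of $w\circ F_E$ is a polynomial of degree at most 1 in each variable (continuous piecewise trilinear). **Vertex quadrature.** $(A\tau,\chi)_Q=\sum_{E}\frac{|E|}{8}\sum_{i=1}^8 A(\mathbf r_i)\tau(\mathbf r_i):\chi(\mathbf r_i)$ and $(\tau,w)_Q=(w,\tau)_Q=\sum_{E}\frac{|E|}{8}\sum_{i=1}^8\tau(\mathbf r_i):w(\mathbf r_i)$, where for each $E\in\mathcal{T}_h$ the $\mathbf r_i$ are its vertices and all values are taken from within $E$. *)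

theory Defs
  imports "HOL-Analysis.Analysis"
begin

section \<open>Function spaces and differential operators\<close>

text \<open>Matrix fields have type \<open>real^3 \<Rightarrow> real^3^3\<close>; the inner product of the library on
  \<open>real^3^3\<close> is the Frobenius product.\<close>

definition L2_on :: "(real^3) set \<Rightarrow> (real^3 \<Rightarrow> 'a::euclidean_space) \<Rightarrow> bool" where
  "L2_on \<Omega> f \<longleftrightarrow> f \<in> borel_measurable (lebesgue_on \<Omega>) \<and>
     integrable (lebesgue_on \<Omega>) (\<lambda>x. (norm (f x))\<^sup>2)"

definition L2_inner :: "(real^3) set \<Rightarrow> (real^3 \<Rightarrow> 'a::euclidean_space) \<Rightarrow> (real^3 \<Rightarrow> 'a) \<Rightarrow> real" where
  "L2_inner \<Omega> f g = (LINT x|lebesgue_on \<Omega>. f x \<bullet> g x)"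

definition partial_deriv :: "3 \<Rightarrow> (real^3 \<Rightarrow> real) \<Rightarrow> real^3 \<Rightarrow> real" where
  "partial_deriv i \<phi> x = frechet_derivative \<phi> (at x) (axis i 1)"

definition grad :: "(real^3 \<Rightarrow> real) \<Rightarrow> real^3 \<Rightarrow> real^3" where
  "grad \<phi> x = (\<chi> i. partial_deriv i \<phi> x)"

definition curl :: "(real^3 \<Rightarrow> real^3) \<Rightarrow> real^3 \<Rightarrow> real^3" where
  "curl v x = vector
     [partial_deriv 2 (\<lambda>y. v y $ 3) x - partial_deriv 3 (\<lambda>y. v y $ 2) x,
      partial_deriv 3 (\<lambda>y. v y $ 1) x - partial_deriv 1 (\<lambda>y. v y $ 3) x,
      partial_deriv 1 (\<lambda>y. v y $ 2) x - partial_deriv 2 (\<lambda>y. v y $ 1) x]"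

text \<open>\<open>C\<^sup>\<infinity>\<close> functions with compact support in \<open>\<Omega>\<close>: if every iterated partial derivative is
  (totally) differentiable, then all of them are continuous.\<close>

definition test_function :: "(real^3) set \<Rightarrow> (real^3 \<Rightarrow> real) \<Rightarrow> bool" where
  "test_function \<Omega> \<phi> \<longleftrightarrow>
     (\<forall>is. foldr partial_deriv is \<phi> differentiable_on UNIV) \<and>
     compact (closure {x. \<phi> x \<noteq> 0}) \<and> closure {x. \<phi> x \<noteq> 0} \<subseteq> \<Omega>"

text \<open>\<open>d \<in> L\<^sup>2\<close> is the row-wise distributional divergence of \<open>\<tau>\<close> on \<open>\<Omega>\<close>; component \<open>i\<close> of
  \<open>\<tau> x *v grad \<phi> x\<close> is the product of row \<open>i\<close> of \<open>\<tau> x\<close> with the gradient.\<close>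

definition has_L2_div :: "(real^3) set \<Rightarrow> (real^3 \<Rightarrow> real^3^3) \<Rightarrow> (real^3 \<Rightarrow> real^3) \<Rightarrow> bool" where
  "has_L2_div \<Omega> \<tau> d \<longleftrightarrow> L2_on \<Omega> d \<and>
     (\<forall>\<phi>. test_function \<Omega> \<phi> \<longrightarrow>
        (LINT x|lebesgue_on \<Omega>. \<tau> x *v grad \<phi> x) = - (LINT x|lebesgue_on \<Omega>. \<phi> x *\<^sub>R d x))"

text \<open>As an element of \<open>L\<^sup>2\<close> the divergence is unique; \<open>weak_div\<close> selects a representative.\<close>

definition weak_div :: "(real^3) set \<Rightarrow> (real^3 \<Rightarrow> real^3^3) \<Rightarrow> real^3 \<Rightarrow> real^3" where
  "weak_div \<Omega> \<tau> = (SOME d. has_L2_div \<Omega> \<tau> d)"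


section \<open>Cuboids and meshes\<close>

text \<open>A cuboid is given together with its reference map \<open>F\<^sub>E x = r\<^sub>1 + DF\<^sub>E x\<close>: \<open>corner\<close> is \<open>r\<^sub>1\<close>, and
  the columns of \<open>jac\<close> are the edge vectors \<open>r\<^sub>2 - r\<^sub>1\<close>, \<open>r\<^sub>4 - r\<^sub>1\<close>, \<open>r\<^sub>5 - r\<^sub>1\<close>. They have
  to be orthogonal, but neither parallel to the coordinate axes nor positively oriented.\<close>

datatype cuboid = Cuboid (corner: "real^3") (jac: "real^3^3")

definition is_cuboid :: "cuboid \<Rightarrow> bool" where
  "is_cuboid E \<longleftrightarrow> (\<forall>j. column j (jac E) \<noteq> 0) \<and>
     (\<forall>i j. i \<noteq> j \<longrightarrow> orthogonal (column i (jac E)) (column j (jac E)))"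

definition ref_map :: "cuboid \<Rightarrow> real^3 \<Rightarrow> real^3" where
  "ref_map E x = corner E + jac E *v x"

definition ref_cube :: "(real^3) set" where
  "ref_cube = {x. \<forall>i. 0 \<le> x $ i \<and> x $ i \<le> 1}"

definition cell :: "cuboid \<Rightarrow> (real^3) set" where
  "cell E = ref_map E ` ref_cube"

definition vertices :: "cuboid \<Rightarrow> (real^3) set" where
  "vertices E = ref_map E ` {x. \<forall>i. x $ i = 0 \<or> x $ i = 1}"

definition face :: "cuboid \<Rightarrow> 3 \<Rightarrow> real \<Rightarrow> (real^3) set" where
  "face E j s = ref_map E ` {x \<in> ref_cube. x $ j = s}"

definition faces :: "cuboid \<Rightarrow> (real^3) set set" where
  "faces E = {face E j s | j s. s \<in> {0, 1}}"

text \<open>Outward unit normal of \<open>E\<close> on \<open>face E j s\<close>, \<open>s \<in> {0, 1}\<close>.\<close>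

definition normal :: "cuboid \<Rightarrow> 3 \<Rightarrow> real \<Rightarrow> real^3" where
  "normal E j s = (if s = 1 then 1 else - 1) *\<^sub>R sgn (column j (jac E))"

text \<open>Conforming partition of \<open>\<Omega>\<close>: any two cuboids meet in a common (possibly empty) face, edge
  or vertex.\<close>

definition cuboid_mesh :: "(real^3) set \<Rightarrow> cuboid set \<Rightarrow> bool" where
  "cuboid_mesh \<Omega> T \<longleftrightarrow> finite T \<and> (\<forall>E\<in>T. is_cuboid E) \<and>
     (\<Union>E\<in>T. cell E) = closure \<Omega> \<and> (\<forall>E\<in>T. interior (cell E) \<subseteq> \<Omega>) \<and>
     (\<forall>E\<in>T. \<forall>E'\<in>T. E \<noteq> E' \<longrightarrow>
        interior (cell E) \<inter> interior (cell E') = {} \<and>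
        (cell E \<inter> cell E') face_of cell E \<and> (cell E \<inter> cell E') face_of cell E')"

text \<open>The diameter is bounded by \<open>\<kappa>\<close> times the shortest edge, which is the diameter of the largest
  inscribed ball.\<close>

definition shape_regular :: "real \<Rightarrow> cuboid set \<Rightarrow> bool" where
  "shape_regular \<kappa> T \<longleftrightarrow>
     (\<forall>E\<in>T. \<forall>j. diameter (cell E) \<le> \<kappa> * norm (column j (jac E)))"

definition union_of_faces :: "cuboid set \<Rightarrow> (real^3) set \<Rightarrow> bool" where
  "union_of_faces T \<Gamma> \<longleftrightarrow> (\<exists>\<F>. \<F> \<subseteq> (\<Union>E\<in>T. faces E) \<and> \<Gamma> = \<Union>\<F>)"

text \<open>\<open>M\<close> is the union of a \<open>k 1 \<times> k 2 \<times> k 3\<close> array of elements of \<open>T\<close>, cut out by the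
  break points \<open>t i 0 = 0 < \<dots> < t i (k i) = 1\<close> in the reference coordinate \<open>i\<close> of \<open>M\<close>.\<close>

definition macroelement :: "cuboid set \<Rightarrow> (3 \<Rightarrow> nat) \<Rightarrow> cuboid \<Rightarrow> bool" where
  "macroelement T k M \<longleftrightarrow> is_cuboid M \<and>
     (\<exists>t :: 3 \<Rightarrow> nat \<Rightarrow> real.
        (\<forall>i. t i 0 = 0 \<and> t i (k i) = 1 \<and> (\<forall>m < k i. t i m < t i (Suc m))) \<and>
        (\<forall>m. (\<forall>i. m i < k i) \<longrightarrow>
           (\<exists>E\<in>T. cell E = ref_map M ` {x. \<forall>i. t i (m i) \<le> x $ i \<and> x $ i \<le> t i (Suc (m i))})))"

definition agglomerates :: "(real^3) set \<Rightarrow> cuboid set \<Rightarrow> bool" where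
  "agglomerates \<Omega> T \<longleftrightarrow>
     (\<exists>\<M>. cuboid_mesh \<Omega> \<M> \<and>
        (\<forall>M\<in>\<M>. \<exists>k. (\<forall>i. k i \<in> {2, 3}) \<and> macroelement T k M))"

text \<open>Value of a piecewise continuous function at a point of \<open>E\<close>, taken from within \<open>E\<close>.\<close>

definition trace_from :: "cuboid \<Rightarrow> (real^3 \<Rightarrow> 'a::t2_space) \<Rightarrow> real^3 \<Rightarrow> 'a" where
  "trace_from E g r = Lim (at r within interior (cell E)) g"


section \<open>Compliance tensor\<close>

definition compliance_tensor ::
  "(real^3) set \<Rightarrow> cuboid set \<Rightarrow> (real^3 \<Rightarrow> (real^3^3) \<Rightarrow>\<^sub>L (real^3^3)) \<Rightarrow> bool" where
  "compliance_tensor \<Omega> T A \<longleftrightarrow>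
     (\<forall>x\<in>\<Omega>. \<forall>\<sigma> \<tau>. blinfun_apply (A x) \<sigma> \<bullet> \<tau> = \<sigma> \<bullet> blinfun_apply (A x) \<tau>) \<and>
     (\<exists>C. \<forall>x\<in>\<Omega>. norm (A x) \<le> C) \<and>
     (\<exists>\<alpha>>0. \<forall>x\<in>\<Omega>. \<forall>\<tau>. \<alpha> * (\<tau> \<bullet> \<tau>) \<le> blinfun_apply (A x) \<tau> \<bullet> \<tau>) \<and>
     (\<forall>E\<in>T. \<exists>B. continuous_on (cell E) B \<and> (\<forall>x\<in>interior (cell E). B x = A x))"


section \<open>Finite element spaces\<close>

definition RT0 :: "(real^3 \<Rightarrow> real^3) set" where
  "RT0 = {\<lambda>x. \<chi> i. \<alpha> $ i + \<beta> $ i * x $ i | \<alpha> \<beta>. True}"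

text \<open>A set \<open>S\<close> of indices stands for the monomial \<open>\<Prod>j\<in>S. x $ j\<close>. Component \<open>i\<close> of an element of
  the bubble space uses all of them except \<open>1\<close> and \<open>x $ i\<close>.\<close>

definition Bubble :: "(real^3 \<Rightarrow> real^3) set" where
  "Bubble = {\<lambda>x. \<chi> i. \<Sum>S | S \<noteq> {} \<and> S \<noteq> {i}. c i S * (\<Prod>j\<in>S. x $ j) | c. True}"

definition ERT0 :: "(real^3 \<Rightarrow> real^3) set" where
  "ERT0 = {\<lambda>x. q x + curl (\<lambda>y. cross3 y (b y)) x | q b. q \<in> RT0 \<and> b \<in> Bubble}"

definition trilinear :: "(real^3 \<Rightarrow> real) set" where
  "trilinear = {\<lambda>x. \<Sum>S\<in>UNIV. c S * (\<Prod>j\<in>S. x $ j) | c. True}"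

text \<open>Elements of the discrete spaces are represented by functions that have the required form on
  the interior of every element. Except for \<open>W1_space\<close>, whose elements are continuous, the values
  on element boundaries are irrelevant.\<close>

definition X_space :: "(real^3) set \<Rightarrow> (real^3) set \<Rightarrow> cuboid set \<Rightarrow> (real^3 \<Rightarrow> real^3^3) set" where
  "X_space \<Omega> \<Gamma>N T = {\<tau>. L2_on \<Omega> \<tau> \<and> (\<exists>d. has_L2_div \<Omega> \<tau> d) \<and>
     (\<forall>E\<in>T. \<exists>\<tau>hat. (\<forall>i. (\<lambda>x. row i (\<tau>hat x)) \<in> ERT0) \<and>
        (\<forall>x\<in>interior ref_cube. transpose (\<tau> (ref_map E x)) =
           (1 / \<bar>det (jac E)\<bar>) *\<^sub>R (jac E ** transpose (\<tau>hat x)))) \<and>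
     (\<forall>E\<in>T. \<forall>j. \<forall>s\<in>{0, 1}. face E j s \<subseteq> \<Gamma>N \<longrightarrow>
        (\<forall>x\<in>face E j s. trace_from E \<tau> x *v normal E j s = 0))}"

definition V_space :: "cuboid set \<Rightarrow> (real^3 \<Rightarrow> real^3) set" where
  "V_space T = {v. \<forall>E\<in>T. \<exists>c. \<forall>x\<in>interior (cell E). v x = c}"

definition W1_space :: "(real^3) set \<Rightarrow> cuboid set \<Rightarrow> (real^3 \<Rightarrow> real^3^3) set" where
  "W1_space \<Omega> T = {w. continuous_on \<Omega> w \<and> (\<forall>x\<in>\<Omega>. transpose (w x) = - w x) \<and>
     (\<forall>E\<in>T. \<forall>i j. \<exists>p\<in>trilinear. \<forall>x\<in>interior ref_cube. w (ref_map E x) $ i $ j = p x)}"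


section \<open>The MSMFE-1 method\<close>

definition quad_A :: "cuboid set \<Rightarrow> (real^3 \<Rightarrow> (real^3^3) \<Rightarrow>\<^sub>L (real^3^3)) \<Rightarrow>
    (real^3 \<Rightarrow> real^3^3) \<Rightarrow> (real^3 \<Rightarrow> real^3^3) \<Rightarrow> real" where
  "quad_A T A \<tau> \<chi>' = (\<Sum>E\<in>T. measure lebesgue (cell E) / 8 *
     (\<Sum>r\<in>vertices E.
        blinfun_apply (trace_from E A r) (trace_from E \<tau> r) \<bullet> trace_from E \<chi>' r))"

definition quad :: "cuboid set \<Rightarrow> (real^3 \<Rightarrow> real^3^3) \<Rightarrow> (real^3 \<Rightarrow> real^3^3) \<Rightarrow> real" where
  "quad T \<tau> w = (\<Sum>E\<in>T. measure lebesgue (cell E) / 8 *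
     (\<Sum>r\<in>vertices E. trace_from E \<tau> r \<bullet> trace_from E w r))"

definition msmfe1_solution :: "(real^3) set \<Rightarrow> (real^3) set \<Rightarrow> cuboid set \<Rightarrow>
    (real^3 \<Rightarrow> (real^3^3) \<Rightarrow>\<^sub>L (real^3^3)) \<Rightarrow> (real^3 \<Rightarrow> real^3) \<Rightarrow>
    (real^3 \<Rightarrow> real^3^3) \<Rightarrow> (real^3 \<Rightarrow> real^3) \<Rightarrow> (real^3 \<Rightarrow> real^3^3) \<Rightarrow> bool" where
  "msmfe1_solution \<Omega> \<Gamma>N T A f \<sigma> u \<gamma> \<longleftrightarrow>
     \<sigma> \<in> X_space \<Omega> \<Gamma>N T \<and> u \<in> V_space T \<and> \<gamma> \<in> W1_space \<Omega> T \<and>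
     (\<forall>\<tau>\<in>X_space \<Omega> \<Gamma>N T.
        quad_A T A \<sigma> \<tau> + L2_inner \<Omega> u (weak_div \<Omega> \<tau>) + quad T \<gamma> \<tau> = 0) \<and>
     (\<forall>v\<in>V_space T. L2_inner \<Omega> (weak_div \<Omega> \<sigma>) v = L2_inner \<Omega> f v) \<and>
     (\<forall>w\<in>W1_space \<Omega> T. quad T \<sigma> w = 0)"

end

theory Submission
  imports Defs "HOL-Library.Function_Algebras"
begin

text \<open>The problem is a square finite-dimensional linear system in the vertex values of the three unknowns, so it
  suffices to treat \<open>f = 0\<close>. Testing with the solution itself gives \<open>\<sigma> = 0\<close>, since the vertex values determine
  an enhanced Raviart-Thomas field. What remains is the equation for \<open>u\<close> and \<open>\<gamma>\<close>, tested with fields whose only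
  nonzero vertex value is a normal component on one face. For an edge \<open>b\<close> of an element that leaves a vertex
  \<open>r\<close> orthogonally to a face, it yields \<open>u = \<gamma>(r) b / 2\<close> if the face lies on the Dirichlet boundary, and the
  jump of \<open>u\<close> is a multiple of \<open>\<gamma>(r) b\<close> if the face is shared. Hence \<open>\<gamma> b\<close> is constant on every face
  outside \<open>\<Gamma>N\<close>, and (A1) forces \<open>\<gamma>\<close> to be constant on each element, so also on each component of the mesh.
  Suppose \<open>\<gamma> = cross3 g\<close> on a component with \<open>g \<noteq> 0\<close>. An extreme point of the convex hull of the component that
  maximises the product with \<open>g\<close> is a vertex \<open>r\<close> of an element none of whose three faces at \<open>r\<close> is shared. Two of them lie
  on the Dirichlet boundary, so \<open>\<gamma> (b1 - b2) = 0\<close> and \<open>g\<close> is parallel to \<open>b1 - b2\<close>, which contradicts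
  \<open>g \<bullet> b1 \<le> 0\<close> and \<open>g \<bullet> b2 \<le> 0\<close> because \<open>b1\<close> and \<open>b2\<close> are orthogonal. So \<open>\<gamma> = 0\<close>, and then \<open>u = 0\<close> in the same way.\<close>

section \<open>Solvability of finite-dimensional variational problems\<close>

text \<open>The space is built so that vertex values are the right unknowns. Each component of an
  enhanced Raviart-Thomas field is quadratic only in its own variable, so its normal component is
  bilinear on a face and fixed by four vertex values. The 24 vertex values of a vector field can be
  prescribed freely, and the matching of normal components between elements, on which the weak
  divergence depends, can be imposed vertex by vertex. That is why a test field with one nonzero
  vertex value is admissible; the vertex rule pairs it with \<gamma> at that vertex only. The
  obstacles lie elsewhere. The divergence is distributional and known up to null sets, so it is
  reached through explicit test functions. Neighbouring cuboids carry unrelated parametrisations, so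
  shared faces have to be recognised as point sets and their local frames matched. Elements of
  \<open>W1_space\<close> are continuous only on the open set \<Omega>, so traces of \<gamma> at
  boundary vertices are compared along faces whose relative interior lies in \<Omega>.\<close>

lemma (in vector_space) bilinear_form_solvable:
  fixes B :: "'b \<Rightarrow> 'b \<Rightarrow> 'a"
  assumes Z: "subspace Z" and S: "finite S" "Z \<subseteq> span S"
    and B_add: "\<And>x y w. x \<in> Z \<Longrightarrow> y \<in> Z \<Longrightarrow> w \<in> Z \<Longrightarrow> B (x + y) w = B x w + B y w"
    and B_scale: "\<And>c x w. x \<in> Z \<Longrightarrow> w \<in> Z \<Longrightarrow> B (scale c x) w = c * B x w"
    and B_add2: "\<And>x y w. x \<in> Z \<Longrightarrow> y \<in> Z \<Longrightarrow> w \<in> Z \<Longrightarrow> B w (x + y) = B w x + B w y"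
    and B_scale2: "\<And>c x w. x \<in> Z \<Longrightarrow> w \<in> Z \<Longrightarrow> B w (scale c x) = c * B w x"
    and l_add: "\<And>x y. x \<in> Z \<Longrightarrow> y \<in> Z \<Longrightarrow> l (x + y) = l x + l y"
    and l_scale: "\<And>c x. x \<in> Z \<Longrightarrow> l (scale c x) = c * l x"
    and ker: "\<And>z. z \<in> Z \<Longrightarrow> (\<And>w. w \<in> Z \<Longrightarrow> B z w = 0) \<Longrightarrow> z = 0"
  shows "\<exists>z\<in>Z. \<forall>w\<in>Z. B z w = l w"
proof -
  obtain K where K: "K \<subseteq> Z" "independent K" "Z \<subseteq> span K"
    using maximal_independent_subset[of Z] by blast
  have "K \<subseteq> span S" using K(1) S(2) by blast
  then have finK: "finite K" and "card K \<le> card S"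
    using independent_span_bound[OF S(1) K(2)] by auto
  have spanK: "span K = Z" using K Z by (simp add: span_subspace)
  have KZ: "\<And>b. b \<in> K \<Longrightarrow> b \<in> Z" using K(1) by blast
  \<comment> \<open>\<open>f z\<close> stores the values of \<open>B z\<close> on the basis
    \<open>K\<close> as an element of \<open>Z\<close>. Independence of \<open>K\<close> and
    triviality of the kernel make \<open>f\<close> injective on \<open>Z\<close>, and an injective
    endomorphism of a finite-dimensional space is onto.\<close>
  define f where "f z = (\<Sum>b\<in>K. scale (B z b) b)" for z
  have fZ: "f z \<in> Z" for z unfolding f_def
    by (intro subspace_sum[OF Z] subspace_scale[OF Z] KZ)
  have f_add: "f (x + y) = f x + f y" if "x \<in> Z" "y \<in> Z" for x y
    unfolding f_def sum.distrib[symmetric]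
    by (intro sum.cong refl) (simp add: B_add that KZ scale_left_distrib)
  have f_scale: "f (scale c x) = scale c (f x)" if "x \<in> Z" for x c
    unfolding f_def scale_sum_right
    by (intro sum.cong refl) (simp add: B_scale that KZ)
  have ext: "\<forall>w\<in>Z. g w = h w"
    if "\<forall>b\<in>K. g b = h b"
      and "\<And>x y. x \<in> Z \<Longrightarrow> y \<in> Z \<Longrightarrow> g (x + y) = g x + g y" "\<And>c x. x \<in> Z \<Longrightarrow> g (scale c x) = c * g x"
      and "\<And>x y. x \<in> Z \<Longrightarrow> y \<in> Z \<Longrightarrow> h (x + y) = h x + h y" "\<And>c x. x \<in> Z \<Longrightarrow> h (scale c x) = c * h x"
    for g h :: "'b \<Rightarrow> 'a"
  proof
    fix w assume "w \<in> Z"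
    then have "w \<in> span K" using spanK by simp
    then have "w \<in> Z \<and> g w = h w"
    proof (induction rule: span_induct_alt)
      case base
      have "0 \<in> Z" using Z by (rule subspace_0)
      then show ?case using that(3)[of 0 0] that(5)[of 0 0] by simp
    next
      case (step c x y)
      then show ?case using that KZ Z by (auto simp: subspace_add subspace_scale)
    qed
    then show "g w = h w" by simp
  qed
  have f_inj: "z = 0" if "z \<in> Z" "f z = 0" for z
  proof -
    have "\<forall>b\<in>K. B z b = 0"
      using independentD[OF K(2) finK subset_refl, of "B z"] that(2) by (auto simp: f_def)
    then have "\<forall>w\<in>Z. B z w = 0"
      using ext[of "B z" "\<lambda>_. 0"] that by (simp add: B_add2 B_scale2)
    then show ?thesis using ker that by blast
  qed
  have f_neg: "f (- x) = - f x" if "x \<in> Z" for x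
    using f_scale[of x "-1"] that by simp
  have f_inj2: "x = y" if "x \<in> Z" "y \<in> Z" "f x = f y" for x y
  proof -
    have "x - y \<in> Z" using that Z by (simp add: subspace_diff)
    moreover have "f (x - y) = 0"
      using f_add[of x "-y"] f_neg[of y] that Z by (simp add: subspace_neg)
    ultimately show ?thesis using f_inj by fastforce
  qed
  have inj: "inj_on f K" using f_inj2 KZ by (auto intro: inj_onI)
  have indep: "independent (f ` K)"
  proof (rule independent_if_scalars_zero)
    show "finite (f ` K)" using finK by simp
    fix c x assume c: "(\<Sum>x\<in>f ` K. scale (c x) x) = 0" and x: "x \<in> f ` K"
    have fsum: "f (\<Sum>b\<in>L. scale (d b) b) = (\<Sum>b\<in>L. scale (d b) (f b)) \<and> (\<Sum>b\<in>L. scale (d b) b) \<in> Z"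
      if "finite L" "L \<subseteq> K" for L d using that
    proof (induction L)
      case empty
      have "f 0 = 0" using f_scale[of 0 0] subspace_0[OF Z] by simp
      then show ?case using Z by (simp add: subspace_0)
    next
      case (insert b L)
      then show ?case using KZ Z by (simp add: f_add f_scale subspace_add subspace_scale)
    qed
    have "(\<Sum>b\<in>K. scale (c (f b)) (f b)) = 0" using c by (simp add: sum.reindex[OF inj])
    then have "f (\<Sum>b\<in>K. scale (c (f b)) b) = 0" "(\<Sum>b\<in>K. scale (c (f b)) b) \<in> Z"
      using fsum[OF finK subset_refl, of "\<lambda>b. c (f b)"] by auto
    then have "(\<Sum>b\<in>K. scale (c (f b)) b) = 0" using f_inj by blast
    then have "\<forall>b\<in>K. c (f b) = 0"
      using independentD[OF K(2) finK subset_refl, of "\<lambda>b. c (f b)"] by blast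
    then show "c x = 0" using x by auto
  qed
  have sur: "Z \<subseteq> span (f ` K)"
  proof
    fix w assume w: "w \<in> Z"
    show "w \<in> span (f ` K)"
    proof (rule ccontr)
      \<comment> \<open>Adding \<open>w\<close> would give \<open>card K + 1\<close> independent
        vectors in the span of \<open>K\<close>.\<close>
      assume n: "w \<notin> span (f ` K)"
      then have ind: "independent (insert w (f ` K))" using indep by (rule independent_insertI)
      have "insert w (f ` K) \<subseteq> span K" using w fZ spanK by auto
      then have "card (insert w (f ` K)) \<le> card K" using independent_span_bound[OF finK ind] by simp
      moreover have "w \<notin> f ` K" using n span_base by blast
      ultimately show False using finK card_image[OF inj] by simp
    qed
  qed
  have surj: "\<exists>z\<in>Z. f z = w" if "w \<in> Z" for w
  proof -
    have "w \<in> span (f ` K)" using sur that by blast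
    then show ?thesis
    proof (induction rule: span_induct_alt)
      case base
      have "f 0 = 0" using f_scale[of 0 0] subspace_0[OF Z] by simp
      then show ?case using Z subspace_0 by blast
    next
      case (step c x y)
      then obtain b z where b: "b \<in> K" "x = f b" "z \<in> Z" "f z = y" by blast
      then have "f (scale c b + z) = scale c x + y" "scale c b + z \<in> Z"
        using KZ Z by (simp_all add: f_add f_scale subspace_add subspace_scale)
      then show ?case by blast
    qed
  qed
  have "(\<Sum>b\<in>K. scale (l b) b) \<in> Z" by (intro subspace_sum[OF Z] subspace_scale[OF Z] KZ)
  \<comment> \<open>The target has the coordinates \<open>l b\<close>, so \<open>B z b = l b\<close>
    on the basis, and both sides are linear on \<open>Z\<close>.\<close>
  then obtain z where z: "z \<in> Z" "f z = (\<Sum>b\<in>K. scale (l b) b)" using surj by blast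
  have "(\<Sum>b\<in>K. scale (B z b - l b) b) = 0"
    using z(2) by (simp add: f_def scale_left_diff_distrib sum_subtractf)
  then have "\<forall>b\<in>K. B z b - l b = 0"
    using independentD[OF K(2) finK subset_refl, of "\<lambda>b. B z b - l b"] by blast
  then have "\<forall>w\<in>Z. B z w = l w"
    using z(1) by (intro ext) (auto simp: B_add2 B_scale2 l_add l_scale)
  then show ?thesis using z(1) by blast
qed

section \<open>The enhanced Raviart-Thomas space\<close>

lemma partial_deriv_eq:
  "(f has_derivative D) (at x) \<Longrightarrow> partial_deriv i f x = D (axis i 1)"
  by (simp add: partial_deriv_def frechet_derivative_at[symmetric])

lemma has_derivative_partial:
  assumes "f differentiable (at x)"
  shows "(f has_derivative (\<lambda>h. \<Sum>i\<in>UNIV. h $ i * partial_deriv i f x)) (at x)"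
proof -
  let ?D = "frechet_derivative f (at x)"
  have D: "(f has_derivative ?D) (at x)" using assms frechet_derivative_works by blast
  then have lin: "linear ?D" by (rule has_derivative_linear)
  have "?D = (\<lambda>h. \<Sum>i\<in>UNIV. h $ i * partial_deriv i f x)"
  proof
    fix h :: "real^3"
    have "h = (\<Sum>i\<in>UNIV. h $ i *\<^sub>R axis i 1)"
      by (simp add: vec_eq_iff axis_def if_distrib sum.delta cong: if_cong)
    then have "?D h = (\<Sum>i\<in>UNIV. ?D (h $ i *\<^sub>R axis i 1))"
      using linear_sum[OF lin] by metis
    then show "?D h = (\<Sum>i\<in>UNIV. h $ i * partial_deriv i f x)"
      by (simp add: linear_cmul[OF lin] partial_deriv_def)
  qed
  then show ?thesis using D by simp
qed

lemma differentiable_nth [simp]: "(\<lambda>x::real^3. x $ i) differentiable (at x)"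
  using bounded_linear_vec_nth bounded_linear_imp_differentiable by blast

lemma partial_deriv_const [simp]: "partial_deriv i (\<lambda>_. c) x = 0"
  by (subst partial_deriv_eq[OF has_derivative_const]) simp

lemma partial_deriv_nth [simp]: "partial_deriv i (\<lambda>x. x $ j) x = (if i = j then 1 else 0)"
  by (subst partial_deriv_eq[OF bounded_linear_imp_has_derivative[OF bounded_linear_vec_nth]])
    (auto simp: axis_def)

lemma partial_deriv_add:
  assumes "f differentiable (at x)" "g differentiable (at x)"
  shows "partial_deriv i (\<lambda>x. f x + g x) x = partial_deriv i f x + partial_deriv i g x"
  using partial_deriv_eq[OF has_derivative_add[OF assms[unfolded frechet_derivative_works]], of i]
  by (simp add: partial_deriv_def)

lemma partial_deriv_diff:
  assumes "f differentiable (at x)" "g differentiable (at x)"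
  shows "partial_deriv i (\<lambda>x. f x - g x) x = partial_deriv i f x - partial_deriv i g x"
  using partial_deriv_eq[OF has_derivative_diff[OF assms[unfolded frechet_derivative_works]], of i]
  by (simp add: partial_deriv_def)

lemma partial_deriv_mult:
  assumes "f differentiable (at x)" "g differentiable (at x)"
  shows "partial_deriv i (\<lambda>x. f x * g x) x = f x * partial_deriv i g x + partial_deriv i f x * g x"
  using partial_deriv_eq[OF has_derivative_mult[OF assms[unfolded frechet_derivative_works]], of i]
  by (simp add: partial_deriv_def)

section \<open>Index sets and the explicit components of enhanced Raviart-Thomas fields\<close>

lemma UNIV_set_3: "(UNIV::3 set set) = {{},{1},{2},{3},{1,2},{1,3},{2,3},{1,2,3}}"
proof -
  have "S \<in> {{},{1},{2},{3},{1,2},{1,3},{2,3},{1,2,3}}" for S :: "3 set"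
  proof -
    have "S = (if 1 \<in> S then {1} else {}) \<union> (if 2 \<in> S then {2} else {}) \<union> (if 3 \<in> S then {3} else {})"
      (is "S = ?R")
    proof (rule set_eqI)
      fix x show "x \<in> S \<longleftrightarrow> x \<in> ?R" using exhaust_3[of x] by auto
    qed
    moreover have "?R \<in> {{},{1},{2},{3},{1,2},{1,3},{2,3},{1,2,3}}"
      by (simp add: insert_commute)
    ultimately show ?thesis by metis
  qed
  then show ?thesis by blast
qed

text \<open>Sets of indices label both the monomials and the vertices of the cube; these
  inequalities let the simplifier evaluate coefficient functions at the eight literal sets.\<close>

lemma distinct_index_sets_3:
  "{1::3,2} \<noteq> {1,3}" "{1::3,2} \<noteq> {2,3}" "{1::3,2} \<noteq> {1,2,3}" "{1::3,3} \<noteq> {2,3}"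
  "{1::3,3} \<noteq> {1,2,3}" "{2::3,3} \<noteq> {1,2,3}"
  "{1::3} \<noteq> {1,2}" "{1::3} \<noteq> {1,3}" "{1::3} \<noteq> {2,3}" "{1::3} \<noteq> {1,2,3}"
  "{2::3} \<noteq> {1,2}" "{2::3} \<noteq> {1,3}" "{2::3} \<noteq> {2,3}" "{2::3} \<noteq> {1,2,3}"
  "{3::3} \<noteq> {1,2}" "{3::3} \<noteq> {1,3}" "{3::3} \<noteq> {2,3}" "{3::3} \<noteq> {1,2,3}"
  unfolding set_eq_iff forall_3 by simp_all

text \<open>\<open>c i S\<close> is the coefficient of the monomial \<open>S\<close> in component
  \<open>i\<close> of the bubble. The 6 coefficients of the Raviart-Thomas part and 6 bubble
  coefficients in each component give 24 parameters, as many as three components have vertex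
  values.\<close>

definition ert :: "real^3 \<Rightarrow> real^3 \<Rightarrow> (3 \<Rightarrow> 3 set \<Rightarrow> real) \<Rightarrow> real^3 \<Rightarrow> real^3" where
  "ert \<alpha> \<beta> c x = (\<chi> i. \<alpha> $ i + \<beta> $ i * x $ i) + curl (\<lambda>y. cross3 y
     (\<chi> i. \<Sum>S | S \<noteq> {} \<and> S \<noteq> {i}. c i S * (\<Prod>j\<in>S. y $ j))) x"

lemma ERT0_eq: "ERT0 = {ert \<alpha> \<beta> c | \<alpha> \<beta> c. True}"
proof (intro set_eqI iffI)
  fix v assume "v \<in> ERT0"
  then show "v \<in> {ert \<alpha> \<beta> c | \<alpha> \<beta> c. True}"
    unfolding ERT0_def RT0_def Bubble_def ert_def[abs_def] mem_Collect_eq by force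
next
  fix v assume "v \<in> {ert \<alpha> \<beta> c | \<alpha> \<beta> c. True}"
  then obtain \<alpha> \<beta> c where v: "v = ert \<alpha> \<beta> c" by blast
  define q where "q = (\<lambda>x::real^3. \<chi> i. \<alpha> $ i + \<beta> $ i * x $ i)"
  define b where "b = (\<lambda>y::real^3. \<chi> i. \<Sum>S | S \<noteq> {} \<and> S \<noteq> {i}. c i S * (\<Prod>j\<in>S. y $ j))"
  have "q \<in> RT0" "b \<in> Bubble" unfolding q_def b_def RT0_def Bubble_def by blast+
  moreover have "v = (\<lambda>x. q x + curl (\<lambda>y. cross3 y (b y)) x)"
    by (simp add: v ert_def[abs_def] q_def b_def)
  ultimately show "v \<in> ERT0" unfolding ERT0_def by blast
qed

lemma partial_deriv_nth_mult:
  "f differentiable (at x) \<Longrightarrow> partial_deriv i (\<lambda>x. x $ j * f x) x =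
    x $ j * partial_deriv i f x + (if i = j then f x else 0)"
  by (subst partial_deriv_mult) auto

text \<open>The identity curl(x cross b) = x div b - (x . grad) b - 2 b. On a monomial of degree m
  the operator x . grad is multiplication by m.\<close>

lemma curl_cross3:
  assumes "\<And>i. (\<lambda>y. b y $ i) differentiable (at x)"
  defines "d \<equiv> \<lambda>i j. partial_deriv i (\<lambda>y. b y $ j) x"
  shows "curl (\<lambda>y. cross3 y (b y)) x $ i =
    x $ i * (\<Sum>j\<in>UNIV. d j j) - (\<Sum>j\<in>UNIV. x $ j * d j i) - 2 * b x $ i"
proof -
  have m: "(\<lambda>y. y $ j * b y $ i) differentiable (at x)" for i j
    using assms by (intro differentiable_mult) auto
  have d: "partial_deriv l (\<lambda>y. y $ j * b y $ i - y $ j' * b y $ i') x =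
    x $ j * d l i + (if l = j then b x $ i else 0) - (x $ j' * d l i' + (if l = j' then b x $ i' else 0))"
    for l j i j' i'
    unfolding d_def partial_deriv_diff[OF m m] partial_deriv_nth_mult[OF assms(1)] ..
  have "\<forall>i. curl (\<lambda>y. cross3 y (b y)) x $ i =
    x $ i * (\<Sum>j\<in>UNIV. d j j) - (\<Sum>j\<in>UNIV. x $ j * d j i) - 2 * b x $ i"
    unfolding forall_3 sum_3 curl_def cross3_def vector_3 d by (simp add: algebra_simps)
  then show ?thesis by blast
qed

definition trilin :: "(3 set \<Rightarrow> real) \<Rightarrow> real^3 \<Rightarrow> real" where
  "trilin c x = (\<Sum>S\<in>UNIV. c S * (\<Prod>j\<in>S. x $ j))"

lemma trilin_eq: "trilin c x = c {} + c {1} * x$1 + c {2} * x$2 + c {3} * x$3 + c {1,2} * (x$1 * x$2)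
  + c {1,3} * (x$1 * x$3) + c {2,3} * (x$2 * x$3) + c {1,2,3} * (x$1 * x$2 * x$3)"
  unfolding trilin_def UNIV_set_3 by (simp add: distinct_index_sets_3 algebra_simps)

lemma trilin_has_derivative:
  "(trilin c has_derivative (\<lambda>h.
     h$1 * (c {1} + c {1,2} * x$2 + c {1,3} * x$3 + c {1,2,3} * (x$2 * x$3))
   + h$2 * (c {2} + c {1,2} * x$1 + c {2,3} * x$3 + c {1,2,3} * (x$1 * x$3))
   + h$3 * (c {3} + c {1,3} * x$1 + c {2,3} * x$2 + c {1,2,3} * (x$1 * x$2)))) (at x)"
proof -
  have [derivative_intros]: "((\<lambda>x::real^3. x $ i) has_derivative (\<lambda>h. h $ i)) (at x)" for i
    by (rule bounded_linear_imp_has_derivative[OF bounded_linear_vec_nth])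
  show ?thesis unfolding trilin_eq[abs_def]
    by (rule derivative_eq_intros refl)+ (simp add: algebra_simps fun_eq_iff)
qed

lemma trilin_differentiable [simp]: "trilin c differentiable (at x)"
  using trilin_has_derivative differentiable_def by blast

lemma partial_deriv_trilin:
  "partial_deriv 1 (trilin c) x = c {1} + c {1,2} * x$2 + c {1,3} * x$3 + c {1,2,3} * (x$2 * x$3)"
  "partial_deriv 2 (trilin c) x = c {2} + c {1,2} * x$1 + c {2,3} * x$3 + c {1,2,3} * (x$1 * x$3)"
  "partial_deriv 3 (trilin c) x = c {3} + c {1,3} * x$1 + c {2,3} * x$2 + c {1,2,3} * (x$1 * x$2)"
  by (simp_all add: partial_deriv_eq[OF trilin_has_derivative] axis_def)

text \<open>The two excluded monomials get coefficient 0, so that the derivative formulas for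
  \<open>trilin\<close> apply to bubbles.\<close>

lemma bubble_trilin: "(\<Sum>S | S \<noteq> {} \<and> S \<noteq> {i}. c S * (\<Prod>j\<in>S. y $ j)) =
  trilin (c({} := 0, {i} := 0)) y"
  unfolding trilin_def by (intro sum.mono_neutral_cong_left) auto

lemma bubble_differentiable:
  "(\<lambda>y. (\<chi> i. trilin (c i) y) $ i) differentiable (at x)"
  by simp

text \<open>By \<open>curl_cross3\<close> a bubble monomial of degree m in component i contributes
  -(m + 2) times itself to component i, and one copy comes back from x_i div b if it contains x_i;
  this yields the factors 3 and 4. The divergence of the other two bubble components supplies every
  term that is quadratic in x_i.\<close>

lemma ert_component:
  "ert \<alpha> \<beta> c x $ 1 = \<alpha>$1 + \<beta>$1 * x$1 + x$1 *
     (c 2 {1,2} * x$1 + c 2 {2,3} * x$3 + c 2 {1,2,3} * (x$1 * x$3) +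
      c 3 {1,3} * x$1 + c 3 {2,3} * x$2 + c 3 {1,2,3} * (x$1 * x$2))
     - 3 * c 1 {2} * x$2 - 3 * c 1 {3} * x$3 - 4 * c 1 {2,3} * (x$2 * x$3)
     - 3 * c 1 {1,2} * (x$1 * x$2) - 3 * c 1 {1,3} * (x$1 * x$3) - 4 * c 1 {1,2,3} * (x$1 * x$2 * x$3)"
  "ert \<alpha> \<beta> c x $ 2 = \<alpha>$2 + \<beta>$2 * x$2 + x$2 *
     (c 1 {1,2} * x$2 + c 1 {1,3} * x$3 + c 1 {1,2,3} * (x$2 * x$3) +
      c 3 {1,3} * x$1 + c 3 {2,3} * x$2 + c 3 {1,2,3} * (x$1 * x$2))
     - 3 * c 2 {1} * x$1 - 3 * c 2 {3} * x$3 - 4 * c 2 {1,3} * (x$1 * x$3)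
     - 3 * c 2 {1,2} * (x$1 * x$2) - 3 * c 2 {2,3} * (x$2 * x$3) - 4 * c 2 {1,2,3} * (x$1 * x$2 * x$3)"
  "ert \<alpha> \<beta> c x $ 3 = \<alpha>$3 + \<beta>$3 * x$3 + x$3 *
     (c 1 {1,2} * x$2 + c 1 {1,3} * x$3 + c 1 {1,2,3} * (x$2 * x$3) +
      c 2 {1,2} * x$1 + c 2 {2,3} * x$3 + c 2 {1,2,3} * (x$1 * x$3))
     - 3 * c 3 {1} * x$1 - 3 * c 3 {2} * x$2 - 4 * c 3 {1,2} * (x$1 * x$2)
     - 3 * c 3 {1,3} * (x$1 * x$3) - 3 * c 3 {2,3} * (x$2 * x$3) - 4 * c 3 {1,2,3} * (x$1 * x$2 * x$3)"
  unfolding ert_def bubble_trilin vector_add_component curl_cross3[OF bubble_differentiable]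
  unfolding sum_3 vec_lambda_beta partial_deriv_trilin
  unfolding trilin_eq
  by (simp_all add: distinct_index_sets_3 algebra_simps)

lemmas distinct_sets_3 = distinct_index_sets_3 distinct_index_sets_3[symmetric]

section \<open>Vertices of the reference cube and trilinear interpolation\<close>

definition vert :: "3 set \<Rightarrow> real^3" where
  "vert S = (\<chi> i. if i \<in> S then 1 else 0)"

lemma vert_nth [simp]: "vert S $ i = (if i \<in> S then 1 else 0)"
  by (simp add: vert_def)

lemma vert_eq_iff [simp]: "vert S = vert S' \<longleftrightarrow> S = S'"
  by (auto simp: vec_eq_iff split: if_splits)

lemma range_vert: "{x::real^3. \<forall>i. x $ i = 0 \<or> x $ i = 1} = range vert"
proof (intro set_eqI iffI)
  fix x :: "real^3" assume "x \<in> {x. \<forall>i. x $ i = 0 \<or> x $ i = 1}"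
  then have "x = vert {i. x $ i = 1}" by (auto simp: vec_eq_iff)
  then show "x \<in> range vert" by blast
qed auto

text \<open>The nodal trilinear function of the vertex \<open>S\<close>: one there and zero at the
  other seven.\<close>

definition shape :: "3 set \<Rightarrow> real^3 \<Rightarrow> real" where
  "shape S x = (\<Prod>i\<in>UNIV. if i \<in> S then x $ i else 1 - x $ i)"

lemma prod_3: "(\<Prod>i\<in>UNIV. f i) = f 1 * f 2 * f (3::3)" for f :: "3 \<Rightarrow> real"
  unfolding UNIV_3 by (simp add: algebra_simps)

lemma trilin_interpolation: "trilin c x = (\<Sum>S\<in>UNIV. shape S x * trilin c (vert S))"
  unfolding UNIV_set_3 trilin_eq shape_def prod_3
  by (simp add: distinct_sets_3 algebra_simps)

text \<open>Component i is split as a + x_i b with a and b trilinear: \<open>ert_b\<close> collects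
  the divergence of the other two bubble components, \<open>ert_a\<close> everything else.\<close>

definition ert_a :: "real^3 \<Rightarrow> real^3 \<Rightarrow> (3 \<Rightarrow> 3 set \<Rightarrow> real) \<Rightarrow> 3 \<Rightarrow> 3 set \<Rightarrow> real" where
  "ert_a \<alpha> \<beta> c i S = (if S = {} then \<alpha> $ i else if S = {i} then \<beta> $ i
     else if S = {1} \<or> S = {2} \<or> S = {3} \<or> (i \<in> S \<and> S \<noteq> {1,2,3}) then - 3 * c i S else - 4 * c i S)"

definition ert_b :: "(3 \<Rightarrow> 3 set \<Rightarrow> real) \<Rightarrow> 3 \<Rightarrow> 3 set \<Rightarrow> real" where
  "ert_b c i = (if i = 1 then ((\<lambda>_. 0)({1} := c 2 {1,2} + c 3 {1,3}, {2} := c 3 {2,3}, {3} := c 2 {2,3},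
       {1,2} := c 3 {1,2,3}, {1,3} := c 2 {1,2,3}))
    else if i = 2 then ((\<lambda>_. 0)({2} := c 1 {1,2} + c 3 {2,3}, {1} := c 3 {1,3}, {3} := c 1 {1,3},
       {1,2} := c 3 {1,2,3}, {2,3} := c 1 {1,2,3}))
    else ((\<lambda>_. 0)({3} := c 1 {1,3} + c 2 {2,3}, {1} := c 2 {1,2}, {2} := c 1 {1,2},
       {1,3} := c 2 {1,2,3}, {2,3} := c 1 {1,2,3})))"

lemma ert_component_trilin:
  "ert \<alpha> \<beta> c x $ i = trilin (ert_a \<alpha> \<beta> c i) x + x $ i * trilin (ert_b c i) x"
proof -
  have "\<forall>i. ert \<alpha> \<beta> c x $ i = trilin (ert_a \<alpha> \<beta> c i) x + x $ i * trilin (ert_b c i) x"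
    unfolding forall_3 ert_component trilin_eq ert_a_def ert_b_def
    by (simp add: distinct_sets_3 algebra_simps)
  then show ?thesis by blast
qed

lemma ERT0_component_trilin:
  assumes "v \<in> ERT0"
  obtains a b where "\<And>x i. v x $ i = trilin (a i) x + x $ i * trilin (b i) x"
  using assms ert_component_trilin unfolding ERT0_eq by blast

lemma continuous_trilin: "continuous_on A (trilin c)"
  using trilin_has_derivative by (meson continuous_at_imp_continuous_on has_derivative_continuous)

lemma ERT0_differentiable: "v \<in> ERT0 \<Longrightarrow> (\<lambda>x. v x $ i) differentiable (at x)"
  by (erule ERT0_component_trilin) (simp add: differentiable_mult)

lemma ERT0_continuous: "v \<in> ERT0 \<Longrightarrow> continuous_on A v"
proof -
  assume v: "v \<in> ERT0"
  have "continuous_on A (\<lambda>x. \<chi> i. v x $ i)"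
    by (intro continuous_on_vec_lambda continuous_at_imp_continuous_on ballI
        differentiable_imp_continuous_within ERT0_differentiable v)
  then show ?thesis by simp
qed

lemma continuous_partial_deriv_trilin: "continuous_on A (partial_deriv i (trilin c))"
proof -
  have "\<forall>i. continuous_on A (partial_deriv i (trilin c))"
    unfolding forall_3 partial_deriv_trilin[abs_def] by (intro conjI continuous_intros)
  then show ?thesis by blast
qed

lemma ERT0_continuous_partial_deriv:
  assumes "v \<in> ERT0"
  shows "continuous_on A (partial_deriv i (\<lambda>x. v x $ i))"
proof -
  obtain a b where v: "\<And>x i. v x $ i = trilin (a i) x + x $ i * trilin (b i) x"
    using ERT0_component_trilin[OF assms] by blast
  have "partial_deriv i (\<lambda>x. v x $ i) = (\<lambda>x. partial_deriv i (trilin (a i)) x +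
      (x $ i * partial_deriv i (trilin (b i)) x + trilin (b i) x))"
  proof
    fix x
    have "partial_deriv i (\<lambda>x. v x $ i) x = partial_deriv i (\<lambda>x. trilin (a i) x + x $ i * trilin (b i) x) x"
      by (simp add: v)
    also have "\<dots> = partial_deriv i (trilin (a i)) x +
      (x $ i * partial_deriv i (trilin (b i)) x + trilin (b i) x)"
      by (subst partial_deriv_add) (auto simp: partial_deriv_nth_mult differentiable_mult)
    finally show "partial_deriv i (\<lambda>x. v x $ i) x = \<dots>" .
  qed
  then show ?thesis
    by (auto intro!: continuous_intros continuous_partial_deriv_trilin continuous_trilin)
qed

lemma trilin_add_scale: "trilin a x + s * trilin b x = trilin (\<lambda>S. a S + s * b S) x"
  unfolding trilin_def by (simp add: sum.distrib sum_distrib_left algebra_simps)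

text \<open>On \<open>x $ i \<in> {0, 1}\<close> we have \<open>(x $ i)\<^sup>2 = x $ i\<close>, so that the normal component is bilinear there.\<close>

lemma ERT0_face:
  assumes "v \<in> ERT0" and s: "x $ i = (if i \<in> S0 then 1 else 0)"
  shows "v x $ i = (\<Sum>S\<in>UNIV. shape S x * v (vert S) $ i)"
proof -
  obtain a b where v: "\<And>x i. v x $ i = trilin (a i) x + x $ i * trilin (b i) x"
    using ERT0_component_trilin[OF assms(1)] by blast
  let ?k = "\<lambda>S. a i S + x $ i * b i S"
  have "v x $ i = trilin ?k x" by (simp add: v trilin_add_scale)
  also have "\<dots> = (\<Sum>S\<in>UNIV. shape S x * trilin ?k (vert S))" by (rule trilin_interpolation)
  also have "\<dots> = (\<Sum>S\<in>UNIV. shape S x * v (vert S) $ i)"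
  proof (rule sum.cong[OF refl])
    fix S :: "3 set"
    show "shape S x * trilin ?k (vert S) = shape S x * v (vert S) $ i"
    proof (cases "i \<in> S \<longleftrightarrow> i \<in> S0")
      case True
      then have "x $ i = vert S $ i" using s by simp
      then show ?thesis by (simp add: v trilin_add_scale[symmetric])
    next
      case False
      then have "shape S x = 0" using s unfolding shape_def
        by (intro prod_zero) (auto intro!: bexI[of _ i])
      then show ?thesis by simp
    qed
  qed
  finally show ?thesis .
qed

text \<open>The curl part is divergence free, so the divergence is constant. It equals the total
  outward flux through the faces of the unit cube, and the mean of a bilinear function over a face
  is a quarter of its vertex sum.\<close>

lemma ERT0_divergence:
  assumes "v \<in> ERT0"
  shows "(\<Sum>i\<in>UNIV. partial_deriv i (\<lambda>x. v x $ i) x) =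
    (\<Sum>S\<in>UNIV. \<Sum>i\<in>UNIV. (if i \<in> S then 1 / 4 else - 1 / 4) * v (vert S) $ i)"
proof -
  obtain \<alpha> \<beta> c where v: "v = ert \<alpha> \<beta> c" using assms unfolding ERT0_eq by blast
  have d: "partial_deriv i (\<lambda>x. v x $ i) x = partial_deriv i (trilin (ert_a \<alpha> \<beta> c i)) x +
      (x $ i * partial_deriv i (trilin (ert_b c i)) x + trilin (ert_b c i) x)" for i
    unfolding v ert_component_trilin
    by (subst partial_deriv_add) (auto simp: partial_deriv_nth_mult differentiable_mult)
  have "(\<Sum>i\<in>UNIV. partial_deriv i (\<lambda>x. v x $ i) x) = \<beta> $ 1 + \<beta> $ 2 + \<beta> $ 3"
    unfolding d sum_3 partial_deriv_trilin trilin_eq ert_a_def ert_b_def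
    by (simp add: distinct_sets_3 algebra_simps)
  also have "\<dots> = (\<Sum>S\<in>UNIV. \<Sum>i\<in>UNIV. (if i \<in> S then 1 / 4 else - 1 / 4) * v (vert S) $ i)"
    unfolding v UNIV_set_3 sum_3 ert_component by (simp add: distinct_sets_3 algebra_simps)
  finally show ?thesis .
qed

text \<open>At a vertex the square of x_i equals x_i, so each component takes there the values of a
  trilinear polynomial, whose coefficients \<open>P1\<close>, \<open>P2\<close>, \<open>P3\<close>
  are finite differences of the data. Matching them is a linear system that is triangular up to 2 x
  2 blocks.\<close>

lemma ERT0_prescribed_vertex_values:
  "\<exists>v\<in>ERT0. \<forall>S. v (vert S) = t S"
proof -
  define P1 where "P1 i j = t {j} $ i - t {} $ i" for i j
  define P2 where "P2 i j k = t {j,k} $ i - t {j} $ i - t {k} $ i + t {} $ i" for i j k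
  define P3 where "P3 i = t {1,2,3} $ i - t {1,2} $ i - t {1,3} $ i - t {2,3} $ i + t {1} $ i + t {2} $ i + t {3} $ i - t {} $ i" for i
  define c123 where "c123 i = - P3 i / 4" for i
  \<comment> \<open>\<open>A u w\<close> is the solution \<open>p\<close> of -3 p + q = u and p - 3
    q = w; the six bubble coefficients named below pair up into three such systems.\<close>
  define A where "A u w = - (3 * u + w) / 8" for u w :: real
  define c112 where "c112 = A (P2 1 1 2 - c123 3) (P2 3 2 3 - c123 1)"
  define c323 where "c323 = A (P2 3 2 3 - c123 1) (P2 1 1 2 - c123 3)"
  define c113 where "c113 = A (P2 1 1 3 - c123 2) (P2 2 2 3 - c123 1)"
  define c223 where "c223 = A (P2 2 2 3 - c123 1) (P2 1 1 3 - c123 2)"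
  define c212 where "c212 = A (P2 2 1 2 - c123 3) (P2 3 1 3 - c123 2)"
  define c313 where "c313 = A (P2 3 1 3 - c123 2) (P2 2 1 2 - c123 3)"
  define c where "c i S = (if S = {1,2,3} then c123 i
     else if S = {1} then - P1 i 1 / 3 else if S = {2} then - P1 i 2 / 3 else if S = {3} then - P1 i 3 / 3
     else if S = {1,2} then (if i = 1 then c112 else if i = 2 then c212 else - P2 3 1 2 / 4)
     else if S = {1,3} then (if i = 1 then c113 else if i = 2 then - P2 2 1 3 / 4 else c313)
     else (if i = 1 then - P2 1 2 3 / 4 else if i = 2 then c223 else c323))" for i :: 3 and S :: "3 set"
  \<comment> \<open>Bubble terms in which x_i occurs squared count as x_i at a vertex and are
    subtracted here.\<close>
  define \<beta> :: "real^3" where "\<beta> = vector [P1 1 1 - c212 - c313, P1 2 2 - c112 - c323, P1 3 3 - c113 - c223]"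
  have "ert (t {}) \<beta> c (vert S) = t S" for S
  proof -
    have S: "S \<in> {{},{1},{2},{3},{1,2},{1,3},{2,3},{1,2,3}}" using UNIV_set_3 by auto
    show ?thesis
      unfolding vec_eq_iff forall_3 ert_component c_def \<beta>_def vector_3 using S
      by (elim insertE emptyE; hypsubst; simp add: distinct_sets_3 c112_def c323_def c113_def c223_def c212_def c313_def;
         simp add: A_def c123_def P1_def P2_def P3_def field_simps)
  qed
  then show ?thesis unfolding ERT0_eq by blast
qed

text \<open>The same system with zero data, eliminated in this order: constants, then the linear and
  bilinear terms of component i without x_i, finally those that contain x_i.\<close>

lemma ERT0_unisolvent:
  assumes "v \<in> ERT0" "\<And>S. v (vert S) = 0"
  shows "v = (\<lambda>_. 0)"
proof -
  obtain \<alpha> \<beta> c where v: "v = ert \<alpha> \<beta> c" using assms unfolding ERT0_eq by blast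
  have e: "ert \<alpha> \<beta> c (vert S) $ i = 0" for S i using assms(2) v by simp
  have a: "\<alpha> $ 1 = 0" "\<alpha> $ 2 = 0" "\<alpha> $ 3 = 0"
    using e[of "{}" 1] e[of "{}" 2] e[of "{}" 3] unfolding ert_component by simp_all
  have l: "c 1 {2} = 0" "c 1 {3} = 0" "c 2 {1} = 0" "c 2 {3} = 0" "c 3 {1} = 0" "c 3 {2} = 0"
    using e[of "{2}" 1] e[of "{3}" 1] e[of "{1}" 2] e[of "{3}" 2] e[of "{1}" 3] e[of "{2}" 3]
    unfolding ert_component by (simp_all add: a)
  have q: "c 1 {2,3} = 0" "c 2 {1,3} = 0" "c 3 {1,2} = 0"
    using e[of "{2,3}" 1] e[of "{1,3}" 2] e[of "{1,2}" 3]
    unfolding ert_component by (simp_all add: a l)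
  note e1 = e[of "{1}" 1] e[of "{1,2}" 1] e[of "{1,3}" 1] e[of "{1,2,3}" 1]
    and e2 = e[of "{2}" 2] e[of "{1,2}" 2] e[of "{2,3}" 2] e[of "{1,2,3}" 2]
    and e3 = e[of "{3}" 3] e[of "{1,3}" 3] e[of "{2,3}" 3] e[of "{1,2,3}" 3]
  note e' = e1 e2 e3
  note s = e'[unfolded ert_component, simplified a l q, simplified]
  have t: "c 1 {1,2,3} = 0" "c 2 {1,2,3} = 0" "c 3 {1,2,3} = 0" using s by linarith+
  have u: "c 1 {1,2} = 0" "c 1 {1,3} = 0" "c 2 {1,2} = 0" "c 2 {2,3} = 0" "c 3 {1,3} = 0" "c 3 {2,3} = 0"
    using s t by linarith+
  have b: "\<beta> $ 1 = 0" "\<beta> $ 2 = 0" "\<beta> $ 3 = 0" using s t u by linarith+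
  have "ert \<alpha> \<beta> c x = 0" for x
    unfolding vec_eq_iff forall_3 ert_component by (simp add: a l q t u b)
  then show ?thesis by (simp add: v fun_eq_iff)
qed

section \<open>Cuboids\<close>

lemma affine_change_of_variables:
  fixes g :: "real^3 \<Rightarrow> real^3" and f :: "real^3 \<Rightarrow> real"
  assumes g: "linear g" "det (matrix g) \<noteq> 0" and f: "continuous_on ((\<lambda>x. a + g x) ` cbox l u) f"
  shows "f absolutely_integrable_on ((\<lambda>x. a + g x) ` cbox l u)" (is "?thesis1")
    and "integral ((\<lambda>x. a + g x) ` cbox l u) f = \<bar>det (matrix g)\<bar> * integral (cbox l u) (\<lambda>x. f (a + g x))" (is "?thesis2")
proof -
  let ?G = "\<lambda>x. a + g x" and ?S = "cbox l u"
  obtain h where h: "linear h" "\<And>x. h (g x) = x"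
    using g linear_injective_isomorphism det_nz_iff_inj by metis
  have contG: "continuous_on A ?G" for A
    using g(1) by (intro continuous_intros linear_continuous_on) (simp add: linear_linear)
  \<comment> \<open>The change of variables formula is used for values in \<open>real^1\<close>;
    \<open>vec\<close> transports the scalar integrand there.\<close>
  let ?v = "\<lambda>y. vec (f y) :: real^1" and ?d = "\<bar>det (matrix g)\<bar>"
  have inv: "(\<lambda>x. ?d *\<^sub>R ?v (?G x)) absolutely_integrable_on ?S \<and> integral ?S (\<lambda>x. ?d *\<^sub>R ?v (?G x)) = b \<longleftrightarrow>
         ?v absolutely_integrable_on (?G ` ?S) \<and> integral (?G ` ?S) ?v = b" for b
  proof (rule has_absolute_integral_change_of_variables_invertible)
    show "(?G has_derivative g) (at x within ?S)" for x
      using linear_imp_has_derivative[OF g(1)] by (auto intro!: derivative_eq_intros)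
    show "(\<lambda>y. h (y - a)) (?G x) = x" for x by (simp add: h)
    show "continuous_on (?G ` ?S) (\<lambda>y. h (y - a))"
      using h(1) by (intro continuous_on_compose2[OF linear_continuous_on[of h UNIV]] continuous_intros)
        (auto simp: linear_linear)
  qed
  have "continuous_on ?S (\<lambda>x. ?d * f (?G x))"
    using continuous_on_compose2[OF f contG subset_refl] by (intro continuous_intros)
  then have "(\<lambda>x. ?d * f (?G x)) absolutely_integrable_on ?S" by (rule absolutely_integrable_continuous)
  then have "?v absolutely_integrable_on (?G ` ?S) \<and>
      integral (?G ` ?S) ?v = integral ?S (\<lambda>x. ?d *\<^sub>R ?v (?G x))"
    using inv[of "integral ?S (\<lambda>x. ?d *\<^sub>R ?v (?G x))"] by (simp add: absolutely_integrable_on_1_iff)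
  then show ?thesis1 ?thesis2
    by (simp_all add: absolutely_integrable_on_1_iff integral_on_1_eq vec_eq_iff)
qed

lemma ref_map_sum: "ref_map E x = corner E + (\<Sum>j\<in>UNIV. x $ j *\<^sub>R column j (jac E))"
  by (simp add: ref_map_def matrix_mult_sum scalar_mult_eq_scaleR)

text \<open>The inverse of \<open>ref_map\<close>: the columns of \<open>jac\<close> are orthogonal,
  so the coordinates are normalised projections.\<close>

definition ref_coord :: "cuboid \<Rightarrow> real^3 \<Rightarrow> real^3" where
  "ref_coord E y = (\<chi> j. ((y - corner E) \<bullet> column j (jac E)) / (column j (jac E) \<bullet> column j (jac E)))"

lemma cuboid_column: "is_cuboid E \<Longrightarrow> column j (jac E) \<noteq> 0" "is_cuboid E \<Longrightarrow> i \<noteq> j \<Longrightarrow> column i (jac E) \<bullet> column j (jac E) = 0"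
  by (simp_all add: is_cuboid_def orthogonal_def)

lemma ref_coord_ref_map [simp]:
  assumes "is_cuboid E" shows "ref_coord E (ref_map E x) = x"
proof -
  have "(\<Sum>i\<in>UNIV. x $ i * (column i (jac E) \<bullet> column j (jac E))) = x $ j * (column j (jac E) \<bullet> column j (jac E))" for j
    by (subst sum.remove[of _ j]) (auto simp: cuboid_column[OF assms] intro!: sum.neutral)
  then show ?thesis
    using cuboid_column(1)[OF assms]
    by (simp add: ref_coord_def ref_map_sum vec_eq_iff[of "vec_lambda _"] inner_sum_left)
qed

lemma inj_ref_map: "is_cuboid E \<Longrightarrow> inj (ref_map E)"
  by (metis injI ref_coord_ref_map)

lemma det_jac: assumes "is_cuboid E" shows "det (jac E) \<noteq> 0"
proof -
  have "inj ((*v) (jac E))" using inj_ref_map[OF assms] by (auto simp: inj_def ref_map_def)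
  then show ?thesis using inj_matrix_vector_mult invertible_det_nz by (metis det_nz_iff_inj matrix_of_matrix_vector_mul matrix_vector_mul_linear)
qed

lemma ref_map_ref_coord [simp]:
  assumes "is_cuboid E" shows "ref_map E (ref_coord E y) = y"
proof -
  have "surj ((*v) (jac E))" using inj_ref_map[OF assms]
    by (intro linear_injective_imp_surjective) (auto simp: inj_def ref_map_def)
  then obtain x where "jac E *v x = y - corner E" by (metis surjD)
  then have "y = ref_map E x" by (simp add: ref_map_def)
  then show ?thesis using assms by simp
qed

lemma ref_map_image: "is_cuboid E \<Longrightarrow> ref_map E ` S = {y. ref_coord E y \<in> S}"
  by (auto simp: image_iff) (metis ref_map_ref_coord)

lemma continuous_ref_map: "continuous_on A (ref_map E)"
  unfolding ref_map_def by (intro continuous_intros linear_continuous_on bounded_linear_intros)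

lemma continuous_ref_coord: "continuous_on A (ref_coord E)"
  unfolding ref_coord_def divide_inverse by (intro continuous_intros)

lemma ref_cube_cbox: "ref_cube = cbox 0 1"
  by (auto simp: ref_cube_def mem_box_cart)

lemma interior_ref_cube: "interior ref_cube = {x. \<forall>i. 0 < x $ i \<and> x $ i < 1}"
  by (auto simp: ref_cube_cbox mem_box_cart)

lemma compact_ref_cube: "compact ref_cube" and convex_ref_cube: "convex ref_cube"
  by (simp_all add: ref_cube_cbox)

lemma ref_map_interior:
  assumes "is_cuboid E" shows "interior (ref_map E ` S) = ref_map E ` interior S"
proof -
  have "ref_map E ` X = (+) (corner E) ` ((*v) (jac E)) ` X" for X
    by (auto simp: ref_map_def image_image)
  moreover have "inj ((*v) (jac E))" using inj_ref_map[OF assms] by (auto simp: inj_def ref_map_def)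
  ultimately show ?thesis
    by (simp add: interior_translation interior_injective_linear_image)
qed

lemma interior_cell: "is_cuboid E \<Longrightarrow> interior (cell E) = ref_map E ` interior ref_cube"
  by (simp add: cell_def ref_map_interior)

lemma compact_cell: "compact (cell E)"
  unfolding cell_def by (intro compact_continuous_image continuous_ref_map compact_ref_cube)

lemma ref_map_convex_comb: "ref_map E ((1 - u) *\<^sub>R x + u *\<^sub>R y) = (1 - u) *\<^sub>R ref_map E x + u *\<^sub>R ref_map E y"
  unfolding ref_map_def by (simp add: matrix_vector_right_distrib matrix_vector_mult_scaleR algebra_simps)

lemma convex_ref_map_image: "convex S \<Longrightarrow> convex (ref_map E ` S)"
  unfolding convex_alt by (auto simp: ref_map_convex_comb[symmetric])

lemma convex_cell: "convex (cell E)"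
  unfolding cell_def by (rule convex_ref_map_image[OF convex_ref_cube])

lemma integral_cell:
  fixes f :: "real^3 \<Rightarrow> real"
  assumes "is_cuboid E" "continuous_on (cell E) f"
  shows "f absolutely_integrable_on cell E"
    and "integral (cell E) f = \<bar>det (jac E)\<bar> * integral ref_cube (\<lambda>x. f (ref_map E x))"
  using affine_change_of_variables[of "(*v) (jac E)" "corner E" 0 1 f] assms det_jac[OF assms(1)]
  by (simp_all add: cell_def ref_map_def[abs_def] matrix_of_matrix_vector_mul ref_cube_cbox)

lemma measure_cell:
  assumes "is_cuboid E" shows "measure lebesgue (cell E) = \<bar>det (jac E)\<bar>"
proof -
  have "integral (cell E) (\<lambda>_. 1) = \<bar>det (jac E)\<bar> * integral ref_cube (\<lambda>x. 1)"
    by (rule integral_cell[OF assms]) simp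
  moreover have "integral ref_cube (\<lambda>x. 1::real) = 1"
  proof -
    have "cbox (0::real^3) 1 \<noteq> {}" by (auto simp: interval_ne_empty_cart)
    then show ?thesis by (simp add: ref_cube_cbox content_cbox_cart)
  qed
  ultimately show ?thesis
    using lmeasure_integral[OF lmeasurable_compact[OF compact_cell]]
    by simp
qed

lemma interior_cell_nonempty: "is_cuboid E \<Longrightarrow> interior (cell E) \<noteq> {}"
  unfolding interior_cell interior_ref_cube by (auto intro!: exI[of _ "\<chi> i. 1/2"])

lemma closure_interior_cell: "is_cuboid E \<Longrightarrow> closure (interior (cell E)) = cell E"
  by (metis closure_closed compact_cell compact_imp_closed convex_cell convex_closure_interior interior_cell_nonempty)

lemma negligible_cell_boundary: "negligible (cell E - interior (cell E))"
  using negligible_convex_frontier[OF convex_cell]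
  by (metis closure_closed compact_cell compact_imp_closed frontier_def)

lemma interior_cell_nontrivial:
  assumes "is_cuboid E" "r \<in> cell E"
  shows "at r within interior (cell E) \<noteq> bot"
proof (cases "r \<in> interior (cell E)")
  case True
  then show ?thesis by (metis interior_interior interior_limit_point trivial_limit_within interior_subset subsetD)
next
  case False
  then show ?thesis using assms closure_interior_cell by (simp add: trivial_limit_within islimpt_in_closure)
qed

text \<open>A trace sees \<open>f\<close> only inside the cell, so it is computed from a continuous
  extension \<open>g\<close>; the limit is unique because every point of the cell is a limit point
  of the interior.\<close>

lemma trace_from_eq:
  assumes "is_cuboid E" "r \<in> cell E" and g: "continuous_on (cell E) g" "\<And>x. x \<in> interior (cell E) \<Longrightarrow> f x = g x"
  shows "trace_from E f r = g r"
proof -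
  have "(g \<longlongrightarrow> g r) (at r within cell E)" using g(1) assms(2) by (simp add: continuous_on_def)
  then have "(g \<longlongrightarrow> g r) (at r within interior (cell E))"
    by (rule tendsto_within_subset) (rule interior_subset)
  then have "(f \<longlongrightarrow> g r) (at r within interior (cell E))"
    by (rule Lim_cong_within[OF refl refl refl, THEN iffD2, rotated]) (simp add: g(2))
  then show ?thesis unfolding trace_from_def using interior_cell_nontrivial[OF assms(1,2)] tendsto_Lim by blast
qed

lemma vertices_eq: "vertices E = range (\<lambda>S. ref_map E (vert S))"
  by (simp add: vertices_def range_vert image_image)

section \<open>Integration along coordinate lines of the reference cube\<close>

definition set_coord :: "3 \<Rightarrow> real \<Rightarrow> real^3 \<Rightarrow> real^3" where
  "set_coord j s x = (\<chi> i. if i = j then s else x $ i)"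

lemma set_coord_nth [simp]: "set_coord j s x $ i = (if i = j then s else x $ i)"
  by (simp add: set_coord_def)

lemma set_coord_set_coord [simp]: "set_coord j s (set_coord j t x) = set_coord j s x"
  by (simp add: vec_eq_iff)

lemma continuous_set_coord: "continuous_on A (set_coord j s)"
proof -
  have "continuous_on A (\<lambda>x. if i = j then s else x $ i)" for i :: 3
    by (cases "i = j") (auto intro!: continuous_intros)
  then show ?thesis unfolding set_coord_def by (intro continuous_intros)
qed

lemma set_coord_has_derivative:
  "((\<lambda>t. set_coord j t x) has_derivative (\<lambda>h. h *\<^sub>R axis j 1)) (at t)"
proof -
  have "(\<lambda>t. set_coord j t x) = (\<lambda>t. set_coord j 0 x + t *\<^sub>R axis j 1)"
    by (auto simp: vec_eq_iff axis_def)
  then show ?thesis by (auto intro!: derivative_eq_intros)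
qed

lemma continuous_on_set_coord_line: "continuous_on A (\<lambda>t. set_coord j t x)"
  by (intro continuous_at_imp_continuous_on ballI has_derivative_continuous[OF set_coord_has_derivative])

lemma set_coord_ref_cube:
  assumes "set_coord j t z \<in> ref_cube"
  shows "set_coord j s z \<in> ref_cube \<longleftrightarrow> s \<in> {0..1}"
proof
  assume "set_coord j s z \<in> ref_cube"
  then have "0 \<le> set_coord j s z $ j \<and> set_coord j s z $ j \<le> 1" unfolding ref_cube_def by blast
  then show "s \<in> {0..1}" by simp
next
  assume s: "s \<in> {0..1}"
  have "0 \<le> set_coord j s z $ i \<and> set_coord j s z $ i \<le> 1" for i
  proof (cases "i = j")
    case False
    have "0 \<le> set_coord j t z $ i \<and> set_coord j t z $ i \<le> 1" using assms unfolding ref_cube_def by blast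
    then show ?thesis using False by simp
  qed (use s in simp)
  then show "set_coord j s z \<in> ref_cube" unfolding ref_cube_def by blast
qed

text \<open>Fubini with one coordinate split off: the integral over the cube is an integral, over
  the other two coordinates, of line integrals in direction \<open>j\<close>.\<close>

lemma integral_ref_cube_lines:
  fixes f g :: "real^3 \<Rightarrow> real"
  assumes f: "continuous_on ref_cube f" and g: "continuous_on ref_cube g"
    and eq: "\<And>x. x \<in> ref_cube \<Longrightarrow>
      integral {0..1} (\<lambda>t. f (set_coord j t x)) = integral {0..1} (\<lambda>t. g (set_coord j t x))"
  shows "integral ref_cube f = integral ref_cube g"
proof -
  let ?b = "axis j (1::real)"
  let ?B = "Basis - {?b} :: (real^3) set"
  let ?P = "\<lambda>h. \<Sum>c\<in>Basis. h c *\<^sub>R c :: real^3"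
  have b: "?b \<in> Basis" by (simp add: axis_in_Basis_iff)
  \<comment> \<open>Lebesgue measure on \<open>real^3\<close> is the image of the product over the
    basis vectors, from which the factor of \<open>axis j 1\<close> is separated.\<close>
  interpret product_sigma_finite "\<lambda>_::real^3. lborel :: real measure" ..
  have B: "Basis = insert ?b ?B" using b by blast
  have Pnth: "?P h $ i = h (axis i 1)" for h i
  proof -
    have "?P h $ i = ?P h \<bullet> axis i 1" by (simp add: inner_axis)
    also have "\<dots> = h (axis i 1)" by (subst inner_sum_left_Basis) (auto simp: axis_in_Basis_iff)
    finally show ?thesis .
  qed
  have *: "integral ref_cube k = (\<integral>h. (\<integral>y. indicat_real ref_cube (?P (h(?b := y))) * k (?P (h(?b := y))) \<partial>lborel)
      \<partial>Pi\<^sub>M ?B (\<lambda>_. lborel))"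
    if k: "continuous_on ref_cube k" for k :: "real^3 \<Rightarrow> real"
  proof -
    let ?k = "\<lambda>x. indicat_real ref_cube x * k x"
    have int: "integrable lborel ?k"
      using borel_integrable_compact[OF compact_ref_cube k] by (simp add: indicator_scaleR_eq_if[symmetric] if_distrib indicator_def mult.commute cong: if_cong)
    have "integral ref_cube k = integral UNIV ?k"
      by (subst integral_restrict_UNIV[symmetric]) (auto intro!: arg_cong[where f = "integral UNIV"] simp: fun_eq_iff)
    also have "\<dots> = integral\<^sup>L lborel ?k"
      using integral_lborel[OF int] by simp
    also have "\<dots> = integral\<^sup>L (distr (\<Pi>\<^sub>M b\<in>Basis. lborel) borel ?P) ?k"
      by (subst lborel_eq) simp
    also have "\<dots> = (\<integral>h. ?k (?P h) \<partial>(\<Pi>\<^sub>M b\<in>Basis. lborel))"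
      using int by (subst integral_distr) (auto dest: borel_measurable_integrable)
    also have "\<dots> = (\<integral>h. ?k (?P h) \<partial>(\<Pi>\<^sub>M b\<in>insert ?b ?B. lborel))"
      using B by simp
    also have "\<dots> = (\<integral>h. (\<integral>y. ?k (?P (h(?b := y))) \<partial>lborel) \<partial>Pi\<^sub>M ?B (\<lambda>_. lborel))"
    proof (rule product_integral_insert)
      have "integrable (distr (\<Pi>\<^sub>M b\<in>Basis. lborel) borel ?P) ?k"
        using int by (subst lborel_eq[symmetric])
      then have "integrable (\<Pi>\<^sub>M b\<in>Basis. lborel) (\<lambda>h. ?k (?P h))"
        by (rule integrable_distr[rotated]) measurable
      then show "integrable (\<Pi>\<^sub>M b\<in>insert ?b ?B. lborel) (\<lambda>h. ?k (?P h))"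
        using B by simp
    qed auto
    finally show ?thesis .
  qed
  let ?z = "\<lambda>h. (\<chi> i. h (axis i 1)) :: real^3"
  have P: "?P (h(?b := y)) = set_coord j y (?z h)" for h y
    by (rule vec_eq_iff[THEN iffD2]) (simp only: Pnth set_coord_nth fun_upd_apply vec_lambda_beta axis_eq_axis, simp)
  note ** = *[unfolded P]
  \<comment> \<open>A line in direction \<open>j\<close> either misses the cube or meets it exactly
    for the parameters in \<open>{0..1}\<close>.\<close>
  have line: "(\<integral>y. indicat_real ref_cube (set_coord j y z) * k (set_coord j y z) \<partial>lborel) =
     (if \<exists>y. set_coord j y z \<in> ref_cube then integral {0..1} (\<lambda>t. k (set_coord j t z)) else 0)"
    if k: "continuous_on ref_cube k" for k :: "real^3 \<Rightarrow> real" and z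
  proof (cases "\<exists>y. set_coord j y z \<in> ref_cube")
    case True
    have iff: "set_coord j y z \<in> ref_cube \<longleftrightarrow> y \<in> {0..1}" for y
      using True set_coord_ref_cube by blast
    have c: "continuous_on {0..1} (\<lambda>t. k (set_coord j t z))"
    proof (rule continuous_on_compose2[OF k])
      show "(\<lambda>t. set_coord j t z) ` {0..1} \<subseteq> ref_cube" using iff by blast
    qed (rule continuous_on_set_coord_line)
    have "(\<integral>y. indicat_real ref_cube (set_coord j y z) * k (set_coord j y z) \<partial>lborel) =
      (\<integral>y. indicat_real {0..1} y *\<^sub>R k (set_coord j y z) \<partial>lborel)"
      by (intro Bochner_Integration.integral_cong refl) (simp only: iff indicator_def real_scaleR_def)
    also have "\<dots> = integral {0..1} (\<lambda>t. k (set_coord j t z))"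
      using set_borel_integral_eq_integral(2)[OF borel_integrable_atLeastAtMost'[OF c]]
      by (simp add: set_lebesgue_integral_def)
    finally show ?thesis using True by simp
  next
    case False
    then show ?thesis by simp
  qed
  have "(if \<exists>y. set_coord j y z \<in> ref_cube then integral {0..1} (\<lambda>t. f (set_coord j t z)) else 0) =
      (if \<exists>y. set_coord j y z \<in> ref_cube then integral {0..1} (\<lambda>t. g (set_coord j t z)) else 0)" for z
    using eq by fastforce
  then show ?thesis unfolding **[OF f] **[OF g] line[OF f] line[OF g] by (simp only:)
qed

text \<open>By the fundamental theorem of calculus both sides have the same integral on every line
  in direction \<open>j\<close>. The boundary term stays an integral over the cube, of a function
  that is constant in direction \<open>j\<close>; this replaces surface measure on the
  faces.\<close>

lemma integral_partial_deriv_ref_cube: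
  fixes f :: "real^3 \<Rightarrow> real"
  assumes f: "\<And>x. f differentiable (at x)" and c: "continuous_on UNIV (partial_deriv j f)"
  shows "integral ref_cube (partial_deriv j f) =
    integral ref_cube (\<lambda>x. f (set_coord j 1 x) - f (set_coord j 0 x))"
proof (rule integral_ref_cube_lines[where j = j])
  have cf: "continuous_on A f" for A
    using f by (intro continuous_at_imp_continuous_on ballI differentiable_imp_continuous_within)
  show "continuous_on ref_cube (partial_deriv j f)" using c continuous_on_subset by blast
  show "continuous_on ref_cube (\<lambda>x. f (set_coord j 1 x) - f (set_coord j 0 x))"
    by (intro continuous_intros continuous_on_compose2[OF cf continuous_set_coord subset_UNIV])
  fix x :: "real^3"
  have "((\<lambda>t. partial_deriv j f (set_coord j t x)) has_integral f (set_coord j 1 x) - f (set_coord j 0 x)) {0..1}"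
  proof (rule fundamental_theorem_of_calculus)
    fix t :: real
    have "(f has_derivative frechet_derivative f (at (set_coord j t x))) (at (set_coord j t x))"
      using f frechet_derivative_works by blast
    then have "((\<lambda>t. f (set_coord j t x)) has_derivative (\<lambda>h. frechet_derivative f (at (set_coord j t x)) (h *\<^sub>R axis j 1))) (at t)"
      using has_derivative_compose[OF set_coord_has_derivative] by blast
    moreover have "(\<lambda>h. frechet_derivative f (at (set_coord j t x)) (h *\<^sub>R axis j 1)) = (\<lambda>h. h *\<^sub>R partial_deriv j f (set_coord j t x))"
      using linear_cmul[OF linear_frechet_derivative[OF f]] by (auto simp: partial_deriv_def)
    ultimately show "((\<lambda>t. f (set_coord j t x)) has_vector_derivative partial_deriv j f (set_coord j t x)) (at t within {0..1})"
      unfolding has_vector_derivative_def by (auto intro: has_derivative_at_withinI)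
  qed simp
  then show "integral {0..1} (\<lambda>t. partial_deriv j f (set_coord j t x)) =
      integral {0..1} (\<lambda>t. f (set_coord j 1 (set_coord j t x)) - f (set_coord j 0 (set_coord j t x)))"
    by (simp add: integral_unique)
qed

section \<open>Test functions\<close>

text \<open>The standard function exp(-1/t), divided by powers of t. The powers make the family
  closed under differentiation up to linear combinations, as \<open>flat_has_derivative\<close>
  shows.\<close>

definition flat :: "nat \<Rightarrow> real \<Rightarrow> real" where
  "flat k t = (if 0 < t then exp (- (1 / t)) / t ^ k else 0)"

text \<open>One term of the exponential series bounds \<open>exp (1 / t)\<close> from below by
  \<open>(1 / t) ^ (k + 2) / fact (k + 2)\<close>. The quadratic bound makes the derivative at 0
  vanish.\<close>

lemma flat_le: "\<exists>C\<ge>0. \<forall>t. flat k t \<le> C * t\<^sup>2"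
proof (intro exI conjI allI)
  let ?C = "fact (k + 2) :: real"
  show "0 \<le> ?C" by simp
  fix t :: real
  show "flat k t \<le> ?C * t\<^sup>2"
  proof (cases "0 < t")
    case True
    have "(1 / t) ^ (k + 2) / ?C \<le> (\<Sum>n\<le>k+2. (1 / t) ^ n / fact n)"
      using True by (intro member_le_sum) auto
    also have "\<dots> \<le> exp (1 / t)"
      using True sum_le_suminf[OF summable_exp[of "1/t"], of "{..k+2}"]
      by (simp add: exp_def scaleR_conv_of_real field_simps inverse_eq_divide)
    finally have *: "(1 / t) ^ (k + 2) / ?C \<le> exp (1 / t)" .
    have p: "0 < t ^ (k + 2)" "0 < ?C" using True by simp_all
    have "1 / t ^ (k + 2) / ?C \<le> exp (1 / t)" using * by (simp only: power_one_over)
    then have "1 \<le> exp (1 / t) * ?C * t ^ (k + 2)"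
      using p by (simp only: divide_le_eq if_True)
    then have "exp (- (1 / t)) * 1 \<le> exp (- (1 / t)) * (exp (1 / t) * ?C * t ^ (k + 2))"
      by (intro mult_left_mono) auto
    also have "\<dots> = ?C * t ^ (k + 2)"
      by (simp only: mult.assoc[symmetric] exp_minus) simp
    finally have "exp (- (1 / t)) / t ^ k \<le> ?C * t ^ (k + 2) / t ^ k"
      using True by (intro divide_right_mono) auto
    then show ?thesis using True by (simp only: flat_def if_True power_add) simp
  qed (simp add: flat_def)
qed

lemma flat_has_derivative: "(flat k has_real_derivative flat (k + 2) t - k * flat (k + 1) t) (at t)"
proof -
  consider "t < 0" | "t = 0" | "0 < t" by linarith
  then show ?thesis
  proof cases
    case 1
    have "((\<lambda>_. 0) has_real_derivative 0) (at t)" by simp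
    then have "(flat k has_real_derivative 0) (at t)"
      by (rule has_field_derivative_transform_within_open[of _ _ _ "{..<0}"]) (use 1 in \<open>auto simp: flat_def\<close>)
    then show ?thesis using 1 by (simp add: flat_def)
  next
    case 2
    obtain C where C: "0 \<le> C" "\<And>t. flat k t \<le> C * t\<^sup>2" using flat_le by blast
    have "((\<lambda>h. (flat k (0 + h) - flat k 0) / h) \<longlongrightarrow> 0) (at 0)"
    proof (rule Lim_null_comparison)
      show "\<forall>\<^sub>F h in at 0. norm ((flat k (0 + h) - flat k 0) / h) \<le> C * \<bar>h\<bar>"
      proof (intro always_eventually allI)
        fix h :: real
        show "norm ((flat k (0 + h) - flat k 0) / h) \<le> C * \<bar>h\<bar>"
        proof (cases "0 < h")
          case True
          moreover have "0 \<le> flat k h" using True by (simp add: flat_def)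
          ultimately show ?thesis using C(2)[of h] by (simp add: flat_def[of k 0] field_simps power2_eq_square)
        next
          case False
          then show ?thesis using mult_nonneg_nonneg[OF C(1) abs_ge_zero[of h]] by (simp only: flat_def if_False) simp
        qed
      qed
      show "((\<lambda>h::real. C * \<bar>h\<bar>) \<longlongrightarrow> 0) (at 0)"
        by (auto intro!: tendsto_eq_intros)
    qed
    then show ?thesis using 2 by (simp add: DERIV_def flat_def)
  next
    case 3
    have "((\<lambda>t. exp (- (1 / t)) / t ^ k) has_real_derivative flat (k + 2) t - k * flat (k + 1) t) (at t)"
    proof (cases k)
      case (Suc m)
      have "t ^ m = t * t ^ (m - 1)" if "m \<noteq> 0" using that by (cases m) auto
      then show ?thesis using 3 Suc
        by (cases "m = 0") (auto intro!: derivative_eq_intros simp: flat_def field_simps power2_eq_square power_add)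
    qed (use 3 in \<open>auto intro!: derivative_eq_intros simp: flat_def field_simps power2_eq_square\<close>)
    then show ?thesis
      by (rule has_field_derivative_transform_within_open[of _ _ _ "{0<..}"]) (use 3 in \<open>auto simp: flat_def\<close>)
  qed
qed

text \<open>The algebra generated by constants and by \<open>flat\<close> of affine functions. It is
  closed under partial derivatives, so all iterated derivatives are differentiable, as
  \<open>test_function\<close> demands.\<close>

inductive_set smooth :: "(real^3 \<Rightarrow> real) set" where
  const: "(\<lambda>_. c) \<in> smooth"
| flat: "(\<lambda>x. flat k (a \<bullet> x + c)) \<in> smooth"
| add: "f \<in> smooth \<Longrightarrow> g \<in> smooth \<Longrightarrow> (\<lambda>x. f x + g x) \<in> smooth"
| mult: "f \<in> smooth \<Longrightarrow> g \<in> smooth \<Longrightarrow> (\<lambda>x. f x * g x) \<in> smooth"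

lemma flat_inner_has_derivative:
  "((\<lambda>x. flat k (a \<bullet> x + c)) has_derivative
     (\<lambda>h. (a \<bullet> h) * (flat (k + 2) (a \<bullet> x + c) - k * flat (k + 1) (a \<bullet> x + c)))) (at x)"
proof -
  have "((\<lambda>x. a \<bullet> x + c) has_derivative (\<lambda>h. a \<bullet> h)) (at x)"
    by (auto intro!: derivative_eq_intros)
  from has_derivative_compose[OF this flat_has_derivative[THEN has_field_derivative_imp_has_derivative]]
  show ?thesis by (simp add: mult.commute)
qed

lemma smooth_differentiable:
  assumes "f \<in> smooth" shows "f differentiable (at x)"
  using assms
proof induction
  case (flat k a c)
  show ?case using flat_inner_has_derivative differentiable_def by blast
qed (auto intro: differentiable_add differentiable_mult)

lemma smooth_partial_deriv:
  assumes "f \<in> smooth" shows "partial_deriv i f \<in> smooth"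
  using assms
proof induction
  case (const c)
  have "partial_deriv i (\<lambda>_. c) = (\<lambda>_. 0)" by auto
  then show ?case by (simp add: smooth.const)
next
  case (flat k a c)
  have "partial_deriv i (\<lambda>x. flat k (a \<bullet> x + c)) = (\<lambda>x. (a \<bullet> axis i 1) * flat (k + 2) (a \<bullet> x + c)
     + (- (a \<bullet> axis i 1) * k) * flat (k + 1) (a \<bullet> x + c))"
    by (rule ext, subst partial_deriv_eq[OF flat_inner_has_derivative]) (simp add: algebra_simps)
  then show ?case by (simp only:) (intro smooth.intros)
next
  case (add f g)
  have "partial_deriv i (\<lambda>x. f x + g x) = (\<lambda>x. partial_deriv i f x + partial_deriv i g x)"
    using add smooth_differentiable partial_deriv_add by blast
  then show ?case using add by (auto intro!: smooth.add)
next
  case (mult f g)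
  have "partial_deriv i (\<lambda>x. f x * g x) = (\<lambda>x. f x * partial_deriv i g x + partial_deriv i f x * g x)"
    using mult smooth_differentiable partial_deriv_mult by blast
  then show ?case using mult by (auto intro!: smooth.add smooth.mult)
qed

lemma smooth_iterated: "f \<in> smooth \<Longrightarrow> foldr partial_deriv is f \<in> smooth"
  by (induction "is") (auto intro: smooth_partial_deriv)

lemma smooth_test_function:
  assumes "f \<in> smooth" "compact K" "\<And>x. f x \<noteq> 0 \<Longrightarrow> x \<in> K" "K \<subseteq> \<Omega>"
  shows "test_function \<Omega> f"
proof -
  have "closure {x. f x \<noteq> 0} \<subseteq> K"
    using assms by (intro closure_minimal) (auto intro: compact_imp_closed)
  moreover have "compact (closure {x. f x \<noteq> 0})"
    using calculation assms(2) by (meson bounded_subset closed_closure compact_eq_bounded_closed)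
  ultimately show ?thesis
    using assms smooth_iterated smooth_differentiable
    unfolding test_function_def differentiable_on_def by (auto intro: differentiable_at_withinI)
qed

text \<open>Nonzero only where all reference coordinates lie strictly between \<open>1 / n\<close>
  and \<open>1 - 1 / n\<close>, hence compactly supported inside the cell; as \<open>n\<close> grows
  it tends to the indicator function of the interior.\<close>

definition cell_bump :: "cuboid \<Rightarrow> nat \<Rightarrow> real^3 \<Rightarrow> real" where
  "cell_bump E n y = (\<Prod>j\<in>UNIV. flat 0 (real n * ref_coord E y $ j - 1) * flat 0 (real n * (1 - ref_coord E y $ j) - 1))"

lemma cell_bump_smooth: "cell_bump E n \<in> smooth"
proof -
  have "\<exists>a c. \<forall>y. p * ref_coord E y $ j + q = a \<bullet> y + c" for p q j
    by (intro exI[of _ "(p / (column j (jac E) \<bullet> column j (jac E))) *\<^sub>R column j (jac E)"]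
          exI[of _ "q - p * (corner E \<bullet> column j (jac E)) / (column j (jac E) \<bullet> column j (jac E))"])
       (simp add: ref_coord_def inner_diff_left inner_commute diff_divide_distrib algebra_simps)
  then have fl: "(\<lambda>y. flat 0 (p * ref_coord E y $ j + q)) \<in> smooth" for p q j
    using smooth.flat by (metis (no_types, lifting) ext)
  have "(\<lambda>y. flat 0 (real n * ref_coord E y $ j - 1) * flat 0 (real n * (1 - ref_coord E y $ j) - 1)) \<in> smooth" for j
    using smooth.mult[OF fl[of n j "-1"] fl[of "-n" j "real n - 1"]] by (simp add: algebra_simps)
  then show ?thesis unfolding cell_bump_def[abs_def] prod_3 by (intro smooth.mult[OF smooth.mult])
qed

lemma flat_nonneg: "0 \<le> flat 0 t" and flat_le_1: "flat 0 t \<le> 1"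
  by (auto simp: flat_def)

lemma cell_bump_bounds: "0 \<le> cell_bump E n y" "cell_bump E n y \<le> 1"
  unfolding cell_bump_def
  by (auto intro!: prod_nonneg prod_le_1 simp: flat_nonneg flat_le_1 mult_le_one)

lemma cell_bump_test_function:
  assumes E: "is_cuboid E" "interior (cell E) \<subseteq> \<Omega>"
  shows "test_function \<Omega> (cell_bump E n)" "cell_bump E n y \<noteq> 0 \<Longrightarrow> y \<in> interior (cell E)"
proof -
  let ?K = "ref_map E ` {x. \<forall>i. 1 / n \<le> x $ i \<and> x $ i \<le> 1 - 1 / n}"
  have K: "y \<in> ?K \<and> n \<noteq> 0" if "cell_bump E n y \<noteq> 0" for y
  proof -
    have *: "0 < n * ref_coord E y $ j - 1 \<and> 0 < n * (1 - ref_coord E y $ j) - 1" for j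
    proof -
      have "flat 0 (n * ref_coord E y $ j - 1) \<noteq> 0 \<and> flat 0 (n * (1 - ref_coord E y $ j) - 1) \<noteq> 0"
        using that unfolding cell_bump_def prod_zero_iff[OF finite] by (metis UNIV_I mult_eq_0_iff)
      then show ?thesis unfolding flat_def by (meson)
    qed
    have "n \<noteq> 0" using *[of 1] by (intro notI) simp
    moreover have "1 / n \<le> ref_coord E y $ j \<and> ref_coord E y $ j \<le> 1 - 1 / n" for j
      using *[of j] \<open>n \<noteq> 0\<close> by (simp add: field_simps)
    ultimately show ?thesis using E by (simp add: ref_map_image)
  qed
  have sub: "?K \<subseteq> interior (cell E)" if "n \<noteq> 0"
  proof -
    have "0 < 1 / real n" using that by simp
    then show ?thesis unfolding interior_cell[OF E(1)] interior_ref_cube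
      by (intro image_mono Collect_mono) (meson less_le_trans le_less_trans diff_less_eq less_add_same_cancel1)
  qed
  show "y \<in> interior (cell E)" if "cell_bump E n y \<noteq> 0" using K[OF that] sub by blast
  show "test_function \<Omega> (cell_bump E n)"
  proof (cases "n = 0")
    case True
    then have "\<And>y. cell_bump E n y = 0" using K by blast
    then show ?thesis by (intro smooth_test_function[of _ "{}"] cell_bump_smooth) auto
  next
    case False
    have "{x::real^3. \<forall>i. 1 / n \<le> x $ i \<and> x $ i \<le> 1 - 1 / n} = cbox (\<chi> i. 1/n) (\<chi> i. 1 - 1/n)"
      by (auto simp: mem_box_cart)
    then have "compact ?K" by (auto intro!: compact_continuous_image continuous_ref_map)
    then show ?thesis
      using K sub[OF False] E by (intro smooth_test_function[of _ ?K] cell_bump_smooth) auto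
  qed
qed

lemma cell_bump_tendsto:
  assumes "is_cuboid E" "y \<in> interior (cell E)"
  shows "(\<lambda>n. cell_bump E n y) \<longlonglongrightarrow> 1"
proof -
  have *: "(\<lambda>n. flat 0 (real n * t - 1)) \<longlonglongrightarrow> 1" if "0 < t" for t
  proof -
    have inf: "filterlim (\<lambda>n. real n * t - 1) at_top sequentially"
    proof (rule filterlim_at_top[THEN iffD2], intro allI)
      fix Z :: real
      have "\<forall>\<^sub>F n in sequentially. (Z + 1) / t \<le> real n"
        using filterlim_real_sequentially by (simp add: filterlim_at_top)
      then show "\<forall>\<^sub>F n in sequentially. Z \<le> real n * t - 1"
        by eventually_elim (use that in \<open>simp add: pos_divide_le_eq\<close>)
    qed
    have "((\<lambda>s::real. exp (- (1 / s))) \<longlongrightarrow> exp (- 0)) at_top"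
      by (intro tendsto_exp tendsto_minus tendsto_divide_0[OF tendsto_const] filterlim_at_top_imp_at_infinity filterlim_ident)
    then have "((\<lambda>s::real. exp (- (1 / s))) \<longlongrightarrow> 1) at_top" by simp
    then have "(flat 0 \<longlongrightarrow> 1) at_top"
    proof (rule Lim_transform_eventually)
      show "\<forall>\<^sub>F s::real in at_top. exp (- (1 / s)) = flat 0 s"
        using eventually_gt_at_top[of 0] by eventually_elim (simp add: flat_def)
    qed
    then show ?thesis using inf by (rule filterlim_compose)
  qed
  have "0 < ref_coord E y $ j \<and> ref_coord E y $ j < 1" for j
    using assms by (auto simp: interior_cell interior_ref_cube ref_map_image)
  then have "(\<lambda>n. cell_bump E n y) \<longlonglongrightarrow> (\<Prod>j\<in>(UNIV::3 set). 1 * 1)"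
    unfolding cell_bump_def by (intro tendsto_prod tendsto_mult *) auto
  then show ?thesis by simp
qed

section \<open>Faces and vertices\<close>

text \<open>The edge vector that leaves the vertex \<open>S\<close> of \<open>E\<close> in direction
  \<open>j\<close>; the sign makes it run along the cell also when the vertex sits at coordinate
  1.\<close>

definition edge :: "cuboid \<Rightarrow> 3 set \<Rightarrow> 3 \<Rightarrow> real^3" where
  "edge E S j = (if j \<in> S then -1 else 1) *\<^sub>R column j (jac E)"

text \<open>Passage to reference coordinates with the vertex \<open>S\<close> as origin; by
  \<open>ref_map_edges\<close> the edges at that vertex are then the axes.\<close>

definition flip :: "3 set \<Rightarrow> real^3 \<Rightarrow> real^3" where
  "flip S x = (\<chi> i. if i \<in> S then 1 - x $ i else x $ i)"

lemma flip_nth [simp]: "flip S x $ i = (if i \<in> S then 1 - x $ i else x $ i)"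
  by (simp add: flip_def)

lemma flip_flip [simp]: "flip S (flip S x) = x"
  by (simp add: vec_eq_iff)

lemma flip_ref_cube [simp]: "flip S x \<in> ref_cube \<longleftrightarrow> x \<in> ref_cube"
proof -
  have "0 \<le> flip S x $ i \<and> flip S x $ i \<le> 1 \<longleftrightarrow> 0 \<le> x $ i \<and> x $ i \<le> 1" for i by auto
  then show ?thesis unfolding ref_cube_def by simp
qed

lemma ref_map_edges: "ref_map E (flip S t) = ref_map E (vert S) + (\<Sum>i\<in>UNIV. t $ i *\<^sub>R edge E S i)"
  unfolding ref_map_sum add.assoc sum.distrib[symmetric]
  by (intro arg_cong2[where f = "(+)"] sum.cong refl) (auto simp: edge_def algebra_simps)

lemma edge_orthogonal: "is_cuboid E \<Longrightarrow> i \<noteq> j \<Longrightarrow> edge E S i \<bullet> edge E S j = 0"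
  by (simp add: edge_def cuboid_column)

lemma edge_nonzero: "is_cuboid E \<Longrightarrow> edge E S i \<noteq> 0"
  by (simp add: edge_def cuboid_column)

lemma norm_edge: "norm (edge E S i) = norm (column i (jac E))"
  by (simp add: edge_def)

lemma inner_sum_edges:
  assumes "is_cuboid E"
  shows "(\<Sum>i\<in>UNIV. t i *\<^sub>R edge E S i) \<bullet> edge E S j = t j * (edge E S j \<bullet> edge E S j)"
  unfolding inner_sum_left
  by (subst sum.remove[of _ j]) (auto simp: edge_orthogonal[OF assms] intro!: sum.neutral)

lemma edge_expansion:
  assumes "is_cuboid E"
  shows "v = (\<Sum>i\<in>UNIV. (v \<bullet> edge E S i / (edge E S i \<bullet> edge E S i)) *\<^sub>R edge E S i)"
proof -
  let ?y = "ref_map E (vert S) + v"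
  define t where "t = flip S (ref_coord E ?y)"
  have "?y = ref_map E (flip S t)" using assms by (simp add: t_def)
  then have v: "v = (\<Sum>i\<in>UNIV. t $ i *\<^sub>R edge E S i)" by (simp add: ref_map_edges)
  have t: "t $ i = v \<bullet> edge E S i / (edge E S i \<bullet> edge E S i)" for i
    by (subst v) (simp add: inner_sum_edges[OF assms] edge_nonzero[OF assms])
  from v show ?thesis unfolding t .
qed

lemma ref_map_in_cell [simp]: "is_cuboid E \<Longrightarrow> ref_map E x \<in> cell E \<longleftrightarrow> x \<in> ref_cube"
  by (simp add: cell_def ref_map_image)

lemma ref_map_in_face: "is_cuboid E \<Longrightarrow> ref_map E x \<in> face E j s \<longleftrightarrow> x \<in> ref_cube \<and> x $ j = s"
  by (simp add: face_def ref_map_image)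

lemma ref_map_in_interior: "is_cuboid E \<Longrightarrow> ref_map E x \<in> interior (cell E) \<longleftrightarrow> (\<forall>i. 0 < x $ i \<and> x $ i < 1)"
  by (simp add: interior_cell ref_map_image interior_ref_cube)

lemma ref_map_eq_iff [simp]: "is_cuboid E \<Longrightarrow> ref_map E x = ref_map E y \<longleftrightarrow> x = y"
  by (metis ref_coord_ref_map)

lemma face_subset_cell: "face E j s \<subseteq> cell E"
  by (auto simp: face_def cell_def)

lemma vert_in_ref_cube [simp]: "vert S \<in> ref_cube"
  by (simp add: ref_cube_def)

text \<open>A segment of the cube that starts at \<open>w\<close> can be continued beyond \<open>x\<close> if \<open>w\<close> lies in the smallest face containing \<open>x\<close>.\<close>

lemma ref_cube_extend:
  assumes x: "x \<in> ref_cube" and w: "w \<in> ref_cube" "\<And>i. x $ i \<in> {0<..<1} \<or> w $ i = x $ i"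
  obtains e where "0 < e" "x + e *\<^sub>R (x - w) \<in> ref_cube"
proof -
  define m where "m i = (if x $ i \<in> {0<..<1} then min (x $ i) (1 - x $ i) else 1)" for i
  define e where "e = Min (range m)"
  have "0 < e" unfolding e_def m_def by (subst Min_gr_iff) auto
  moreover have "x + e *\<^sub>R (x - w) \<in> ref_cube"
    unfolding ref_cube_def mem_Collect_eq
  proof
    fix i
    have em: "e \<le> m i" unfolding e_def by simp
    show "0 \<le> (x + e *\<^sub>R (x - w)) $ i \<and> (x + e *\<^sub>R (x - w)) $ i \<le> 1"
    proof (cases "x $ i \<in> {0<..<1}")
      case True
      have "0 \<le> w $ i" "w $ i \<le> 1" using w(1) by (auto simp: ref_cube_def)
      then have "\<bar>x $ i - w $ i\<bar> \<le> 1" using True by auto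
      then have "e * \<bar>x $ i - w $ i\<bar> \<le> e" using \<open>0 < e\<close> by (simp add: mult_left_le)
      then have "\<bar>e * (x $ i - w $ i)\<bar> \<le> e" using \<open>0 < e\<close> by (simp add: abs_mult)
      then show ?thesis using em True by (simp add: m_def split: if_splits) linarith
    next
      case False
      then have "w $ i = x $ i" using w(2) by blast
      then show ?thesis using x by (simp add: ref_cube_def)
    qed
  qed
  ultimately show ?thesis using that by blast
qed

text \<open>Unless \<open>w = x\<close>, the point \<open>x\<close> lies strictly between
  \<open>w\<close> and a point beyond \<open>x\<close> on the same line, and a face of
  \<open>C\<close> that contains an inner point of a segment of \<open>C\<close> contains its ends.
  So a face of a convex set grows from one point to the whole face of the cuboid around it.\<close>

lemma face_of_spread:
  assumes K: "K face_of C" "ref_map E x \<in> K" and E: "is_cuboid E" and x: "x \<in> ref_cube"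
    and w: "w \<in> ref_cube" "\<And>i. x $ i \<in> {0<..<1} \<or> w $ i = x $ i"
    and C: "\<And>w. w \<in> ref_cube \<Longrightarrow> (\<And>i. x $ i \<in> {0<..<1} \<or> w $ i = x $ i) \<Longrightarrow> ref_map E w \<in> C"
  shows "ref_map E w \<in> K"
proof (cases "w = x")
  case False
  obtain e where e: "0 < e" "x + e *\<^sub>R (x - w) \<in> ref_cube" using ref_cube_extend[OF x w] by blast
  let ?z = "x + e *\<^sub>R (x - w)"
  have z: "x $ i \<in> {0<..<1} \<or> ?z $ i = x $ i" for i using w(2)[of i] by auto
  have comb: "x = (1 - 1 / (1 + e)) *\<^sub>R w + (1 / (1 + e)) *\<^sub>R ?z"
  proof -
    define c where "c = 1 / (1 + e)"
    have c: "c + c * e = 1" using e(1) by (simp add: c_def field_simps)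
    have "(1 - c) * a + c * (b + e * (b - a)) = (c + c * e) * b + (1 - (c + c * e)) * a" for a b
      by (simp add: algebra_simps)
    then show ?thesis unfolding c_def[symmetric] vec_eq_iff by (simp add: c)
  qed
  have "ref_map E x = (1 - 1 / (1 + e)) *\<^sub>R ref_map E w + (1 / (1 + e)) *\<^sub>R ref_map E ?z"
    unfolding ref_map_convex_comb[symmetric] comb[symmetric] ..
  moreover have "w \<noteq> ?z"
  proof
    assume "w = ?z"
    then have "(1 + e) *\<^sub>R (w - x) = 0" by (simp add: algebra_simps)
    then show False using False e(1) by simp
  qed
  ultimately have "ref_map E x \<in> open_segment (ref_map E w) (ref_map E ?z)"
    using E e(1) by (auto simp: in_segment intro!: exI[of _ "1 / (1 + e)"])
  then show ?thesis using K(1) C[OF w] C[OF e(2) z] K(2) unfolding face_of_def by blast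
qed (use K in simp)

text \<open>Coordinate \<open>j\<close> is extremal on the face, so a proper convex combination
  reaches that value only if both ends do.\<close>

lemma face_face_of:
  assumes E: "is_cuboid E" and s: "s \<in> {0, 1}"
  shows "face E j s face_of cell E"
proof -
  have c: "convex {x \<in> ref_cube. x $ j = s}"
    using convex_ref_cube by (auto simp: convex_def distrib_right[symmetric])
  have "a \<in> face E j s \<and> b \<in> face E j s"
    if ab: "a \<in> cell E" "b \<in> cell E" "x \<in> face E j s" "x \<in> open_segment a b" for a b x
  proof -
    obtain a' b' x' where abx: "a = ref_map E a'" "b = ref_map E b'" "x = ref_map E x'"
      "a' \<in> ref_cube" "b' \<in> ref_cube" "x' \<in> ref_cube" "x' $ j = s"
      using ab by (auto simp: cell_def face_def)
    obtain u where u: "0 < u" "u < 1" "x = (1 - u) *\<^sub>R a + u *\<^sub>R b"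
      using ab(4) by (auto simp: in_segment)
    then have "x' = (1 - u) *\<^sub>R a' + u *\<^sub>R b'"
      using E abx ref_map_convex_comb[of E u a' b'] by (metis ref_map_eq_iff)
    then have eq: "s = (1 - u) * a' $ j + u * b' $ j" using abx by auto
    have r: "0 \<le> a' $ j" "a' $ j \<le> 1" "0 \<le> b' $ j" "b' $ j \<le> 1" using abx by (auto simp: ref_cube_def)
    have "a' $ j = s \<and> b' $ j = s"
    proof (cases "s = 0")
      case True
      then show ?thesis using eq r u by (simp add: add_nonneg_eq_0_iff)
    next
      case False
      then have "(1 - u) * (1 - a' $ j) + u * (1 - b' $ j) = 0" using eq s by (simp add: algebra_simps)
      then show ?thesis using r u False s by (subst (asm) add_nonneg_eq_0_iff) auto
    qed
    then show ?thesis using abx E by (simp add: ref_map_in_face)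
  qed
  moreover have "convex (face E j s)" unfolding face_def by (rule convex_ref_map_image[OF c])
  ultimately show ?thesis unfolding face_of_def using face_subset_cell by blast
qed

text \<open>Vertices are recovered from the face as a point set, which makes them comparable between
  two cuboids with unrelated reference maps.\<close>

lemma extreme_point_face_iff:
  assumes E: "is_cuboid E"
  shows "r extreme_point_of face E j (of_bool \<sigma>) \<longleftrightarrow> (\<exists>S. r = ref_map E (vert S) \<and> (j \<in> S \<longleftrightarrow> \<sigma>))"
proof
  assume r: "r extreme_point_of face E j (of_bool \<sigma>)"
  then obtain x where x: "r = ref_map E x" "x \<in> ref_cube" "x $ j = of_bool \<sigma>"
    by (auto simp: extreme_point_of_def face_def)
  have "x $ i = 0 \<or> x $ i = 1" for i
  proof (rule ccontr)
    assume n: "\<not> (x $ i = 0 \<or> x $ i = 1)"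
    then have i: "x $ i \<in> {0<..<1}" "i \<noteq> j" using x by (auto simp: ref_cube_def less_le)
    \<comment> \<open>An inner coordinate could be moved to 0 within the face, so \<open>{r}\<close>
      would contain a second point.\<close>
    let ?w = "x - x $ i *\<^sub>R axis i 1"
    have w: "?w $ k = (if k = i then 0 else x $ k)" for k by (simp add: axis_def)
    have cw: "?w \<in> ref_cube" using x(2) unfolding ref_cube_def mem_Collect_eq w by auto
    have "{r} face_of face E j (of_bool \<sigma>)" using r by (simp add: face_of_singleton)
    then have "ref_map E ?w \<in> {r}"
    proof (rule face_of_spread[where x = x])
      show "x $ k \<in> {0<..<1} \<or> ?w $ k = x $ k" for k using i w by auto
      show "ref_map E w \<in> face E j (of_bool \<sigma>)" if "w \<in> ref_cube" "\<And>i. x $ i \<in> {0<..<1} \<or> w $ i = x $ i" for w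
        using that(1) that(2)[of j] x(3) E by (auto simp: ref_map_in_face)
    qed (use x E cw in auto)
    then have "?w = x" using x(1) E by simp
    then show False using i w by (metis greaterThanLessThan_iff less_irrefl)
  qed
  then have "x \<in> range vert" using range_vert by auto
  then obtain S where "x = vert S" by blast
  then show "\<exists>S. r = ref_map E (vert S) \<and> (j \<in> S \<longleftrightarrow> \<sigma>)" using x by (auto split: if_splits)
next
  assume "\<exists>S. r = ref_map E (vert S) \<and> (j \<in> S \<longleftrightarrow> \<sigma>)"
  then obtain S where S: "r = ref_map E (vert S)" "j \<in> S \<longleftrightarrow> \<sigma>" by blast
  have "r \<in> face E j (of_bool \<sigma>)" using S E by (simp add: ref_map_in_face)
  moreover have "r \<notin> open_segment a b" if ab: "a \<in> face E j (of_bool \<sigma>)" "b \<in> face E j (of_bool \<sigma>)" for a b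
  proof
    assume seg: "r \<in> open_segment a b"
    have "a \<in> face E i (vert S $ i) \<and> b \<in> face E i (vert S $ i)" for i
    proof -
      have "face E i (vert S $ i) face_of cell E" by (rule face_face_of[OF E]) auto
      moreover have "r \<in> face E i (vert S $ i)" using S E by (simp add: ref_map_in_face)
      ultimately show ?thesis using seg ab face_subset_cell unfolding face_of_def by blast
    qed
    then have "ref_coord E a $ i = vert S $ i \<and> ref_coord E b $ i = vert S $ i" for i
      using E by (metis ref_map_in_face ref_map_ref_coord)
    then have "ref_coord E a = ref_coord E b" by (simp add: vec_eq_iff)
    then have "a = b" using E by (metis ref_map_ref_coord)
    then show False using seg by simp
  qed
  ultimately show "r extreme_point_of face E j (of_bool \<sigma>)" by (simp add: extreme_point_of_def)
qed

lemma ex_3: "(\<exists>i::3. P i) \<longleftrightarrow> P 1 \<or> P 2 \<or> P 3"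
proof
  assume "\<exists>i. P i"
  then obtain i where "P i" by blast
  then show "P 1 \<or> P 2 \<or> P 3" using exhaust_3[of i] by auto
qed blast

lemma third_index: "i \<noteq> j \<Longrightarrow> \<exists>k::3. k \<noteq> i \<and> k \<noteq> j \<and> (\<forall>l. l = i \<or> l = j \<or> l = k)"
proof -
  have "\<forall>i j::3. i \<noteq> j \<longrightarrow> (\<exists>k. k \<noteq> i \<and> k \<noteq> j \<and> (\<forall>l. l = i \<or> l = j \<or> l = k))"
    by (simp add: forall_3 ex_3)
  then show "i \<noteq> j \<Longrightarrow> ?thesis" by blast
qed

lemma other_indices: "\<exists>a b::3. a \<noteq> j \<and> b \<noteq> j \<and> a \<noteq> b \<and> (\<forall>l. l = a \<or> l = b \<or> l = j)"
proof -
  have "\<forall>j::3. \<exists>a b. a \<noteq> j \<and> b \<noteq> j \<and> a \<noteq> b \<and> (\<forall>l. l = a \<or> l = b \<or> l = j)"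
    by (simp add: forall_3 ex_3)
  then show ?thesis by blast
qed

section \<open>Conforming meshes and shared faces\<close>

locale cuboid_domain =
  fixes \<Omega> :: "(real^3) set" and T :: "cuboid set"
  assumes open_domain: "open \<Omega>" and bounded_domain: "bounded \<Omega>" and mesh: "cuboid_mesh \<Omega> T"
    and frontier_faces: "union_of_faces T (frontier \<Omega>)"
begin

lemmas mesh_def = mesh[unfolded cuboid_mesh_def]

lemmas finite_mesh = mesh_def[THEN conjunct1]
  and mesh_cuboid = mesh_def[THEN conjunct2, THEN conjunct1, THEN bspec]
  and mesh_cover = mesh_def[THEN conjunct2, THEN conjunct2, THEN conjunct1]
  and interior_subset_domain = mesh_def[THEN conjunct2, THEN conjunct2, THEN conjunct2, THEN conjunct1, THEN bspec]

lemma mesh_pair: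
  assumes "E \<in> T" "E' \<in> T" "E \<noteq> E'"
  shows "interior (cell E) \<inter> interior (cell E') = {} \<and>
    (cell E \<inter> cell E') face_of cell E \<and> (cell E \<inter> cell E') face_of cell E'"
proof -
  note mesh_def[THEN conjunct2, THEN conjunct2, THEN conjunct2, THEN conjunct2]
  from this[rule_format, OF assms] show ?thesis .
qed

lemmas mesh_disjoint = mesh_pair[THEN conjunct1]
  and mesh_face_of = mesh_pair[THEN conjunct2, THEN conjunct1]

lemma mesh_face_of': "E \<in> T \<Longrightarrow> E' \<in> T \<Longrightarrow> E \<noteq> E' \<Longrightarrow> (cell E \<inter> cell E') face_of cell E'"
  using mesh_face_of[of E' E] by (simp add: Int_commute)

lemma mesh_interior_cell_disjoint:
  assumes "E \<in> T" "E' \<in> T" "E \<noteq> E'" shows "interior (cell E) \<inter> cell E' = {}"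
proof -
  have "interior (cell E) \<inter> closure (interior (cell E')) = {}"
    using open_Int_closure_eq_empty[OF open_interior] mesh_disjoint[OF assms] by blast
  then show ?thesis using closure_interior_cell[OF mesh_cuboid[OF assms(2)]] by simp
qed

text \<open>The case of \<open>face_of_spread\<close> in which the point lies in the relative
  interior of a face of the cuboid.\<close>

lemma face_spread:
  assumes E: "is_cuboid E" and K: "K face_of C" "face E j s \<subseteq> C" "ref_map E x \<in> K"
    and x: "x $ j = s" "s \<in> {0, 1}" "\<And>i. i \<noteq> j \<Longrightarrow> x $ i \<in> {0<..<1}"
  shows "face E j s \<subseteq> K"
proof
  fix z assume z: "z \<in> face E j s"
  then obtain w where w: "z = ref_map E w" "w \<in> ref_cube" "w $ j = s" by (auto simp: face_def)
  have "0 \<le> x $ i \<and> x $ i \<le> 1" for i using x by (cases "i = j") (auto simp: less_imp_le)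
  then have xc: "x \<in> ref_cube" unfolding ref_cube_def by blast
  show "z \<in> K" unfolding w(1)
  proof (rule face_of_spread[OF K(1) K(3) E xc w(2)])
    show "x $ i \<in> {0<..<1} \<or> w $ i = x $ i" for i using x w by (cases "i = j") auto
    show "ref_map E w' \<in> C" if "w' \<in> ref_cube" "\<And>i. x $ i \<in> {0<..<1} \<or> w' $ i = x $ i" for w'
    proof -
      have "w' $ j = s" using that(2)[of j] x by auto
      then show ?thesis using K(2) E that(1) by (auto simp: ref_map_in_face subset_iff)
    qed
  qed
qed

text \<open>A point of the relative interior that is not in \<Omega> lies on the frontier, hence on
  an element face contained in the frontier. By conformity that face, possibly of another element,
  swallows the whole given face, against the assumption.\<close>

lemma interior_face_subset_domain:
  assumes E: "E \<in> T" and F: "\<not> face E j s \<subseteq> frontier \<Omega>"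
    and x: "x $ j = s" "s \<in> {0, 1}" "\<And>i. i \<noteq> j \<Longrightarrow> x $ i \<in> {0<..<1}"
  shows "ref_map E x \<in> \<Omega>"
proof (rule ccontr)
  assume n: "ref_map E x \<notin> \<Omega>"
  note cE = mesh_cuboid[OF E]
  have "0 \<le> x $ i \<and> x $ i \<le> 1" for i using x by (cases "i = j") (auto simp: less_imp_le)
  then have xc: "x \<in> ref_cube" unfolding ref_cube_def by blast
  then have y: "ref_map E x \<in> cell E" using cE by simp
  then have "ref_map E x \<in> closure \<Omega>" using mesh_cover E by blast
  then have "ref_map E x \<in> frontier \<Omega>"
    using n open_domain by (simp add: frontier_def interior_open)
  moreover obtain \<F> where \<F>: "\<F> \<subseteq> (\<Union>E\<in>T. faces E)" "frontier \<Omega> = \<Union>\<F>"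
    using frontier_faces unfolding union_of_faces_def by blast
  ultimately obtain F2 where F2: "F2 \<in> \<F>" "ref_map E x \<in> F2" by auto
  obtain E2 where "E2 \<in> T" "F2 \<in> faces E2" using F2(1) \<F>(1) by auto
  then obtain j2 s2 where E2: "E2 \<in> T" "s2 \<in> {0, 1}" "ref_map E x \<in> face E2 j2 s2" "face E2 j2 s2 \<subseteq> frontier \<Omega>"
    using F2 \<F>(2) unfolding faces_def by auto
  have f2: "face E2 j2 s2 face_of cell E2" by (rule face_face_of[OF mesh_cuboid[OF E2(1)] E2(2)])
  have "face E j s \<subseteq> cell E2"
  proof (cases "E = E2")
    case False
    have "ref_map E x \<in> cell E2" using E2(3) face_subset_cell by blast
    then have "face E j s \<subseteq> cell E \<inter> cell E2"
      using y face_subset_cell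
      by (intro face_spread[OF cE mesh_face_of[OF E E2(1) False] _ _ x]) auto
    then show ?thesis by blast
  qed (use face_subset_cell in blast)
  then have "face E j s \<subseteq> face E2 j2 s2" by (rule face_spread[OF cE f2 _ E2(3) x])
  then show False using E2 F by blast
qed

text \<open>The face centre lies in \<Omega>, so points slightly beyond it do too, and they have to
  be covered by another element.\<close>

lemma exists_neighbour:
  assumes E: "E \<in> T" and F: "\<not> face E j s \<subseteq> frontier \<Omega>" and s: "s \<in> {0, 1}"
  obtains E' where "E' \<in> T" "E' \<noteq> E" "cell E \<inter> cell E' = face E j s"
proof -
  note cE = mesh_cuboid[OF E]
  define c where "c = (\<chi> i. if i = j then s else 1 / 2)"
  have c: "c $ j = s" "\<And>i. i \<noteq> j \<Longrightarrow> c $ i \<in> {0<..<1}" by (auto simp: c_def)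
  let ?y = "ref_map E c"
  have cc: "c \<in> ref_cube" using s by (auto simp: ref_cube_def c_def)
  have y: "?y \<in> \<Omega>" by (rule interior_face_subset_domain[OF E F c(1) s c(2)])
  obtain E' where E': "E' \<in> T" "E' \<noteq> E" "?y \<in> cell E'"
  proof (rule ccontr)
    assume "\<not> thesis"
    then have "?y \<notin> (\<Union>E'\<in>T - {E}. cell E')" using that by blast
    moreover have "closed (\<Union>E'\<in>T - {E}. cell E')"
      using finite_mesh compact_cell compact_imp_closed by blast
    ultimately have op: "open (\<Omega> - (\<Union>E'\<in>T - {E}. cell E'))" "?y \<in> \<Omega> - (\<Union>E'\<in>T - {E}. cell E')"
      using open_domain y by auto
    \<comment> \<open>The centre displaced outwards by \<open>e\<close> in reference
      coordinates.\<close>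
    let ?d = "\<lambda>e. c + (e * (if s = 1 then 1 else -1)) *\<^sub>R axis j 1"
    have "continuous_on UNIV (\<lambda>e. ref_map E (?d e))"
      by (rule continuous_on_compose2[OF continuous_ref_map[of UNIV]]) (auto intro!: continuous_intros)
    then have "((\<lambda>e. ref_map E (?d e)) \<longlongrightarrow> ref_map E (?d 0)) (at 0)"
      unfolding continuous_on_def by (metis UNIV_I)
    then have "\<forall>\<^sub>F e in at 0. ref_map E (?d e) \<in> \<Omega> - (\<Union>E'\<in>T - {E}. cell E')"
      by (rule topological_tendstoD[OF _ op(1)]) (use op(2) in simp)
    then have "\<forall>\<^sub>F e in at_right 0. ref_map E (?d e) \<in> \<Omega> - (\<Union>E'\<in>T - {E}. cell E')"
      by (simp add: eventually_at_split)
    then obtain e :: real where e: "0 < e" "ref_map E (?d e) \<in> \<Omega> - (\<Union>E'\<in>T - {E}. cell E')"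
      using eventually_conj[OF _ eventually_at_right_less[of "0::real"]] eventually_happens' trivial_limit_at_right_real
      by (metis (no_types, lifting))
    then have "ref_map E (?d e) \<in> cell E"
      using mesh_cover closure_subset by blast
    then have "0 \<le> ?d e $ j \<and> ?d e $ j \<le> 1" using cE unfolding ref_map_in_cell[OF cE] ref_cube_def by blast
    then show False using e(1) s c by (auto simp: axis_def split: if_splits)
  qed
  let ?K = "cell E \<inter> cell E'"
  have sub: "face E j s \<subseteq> ?K"
    using E' cc face_subset_cell cE by (intro face_spread[OF cE mesh_face_of[OF E E'(1) E'(2)[symmetric]] _ _ c(1) s c(2)]) auto
  have "?K \<subseteq> face E j s"
  proof
    fix z assume z: "z \<in> ?K"
    then obtain w where w: "z = ref_map E w" "w \<in> ref_cube" by (auto simp: cell_def)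
    show "z \<in> face E j s"
    proof (rule ccontr)
      assume "z \<notin> face E j s"
      then have ws: "w $ j \<noteq> s" using w cE by (simp add: ref_map_in_face)
      \<comment> \<open>A common point off the face would put its midpoint with the centre into the
        interior of \<open>E\<close>.\<close>
      let ?m = "(1 - 1/2) *\<^sub>R c + (1/2) *\<^sub>R w"
      have "ref_map E ?m \<in> cell E'"
        unfolding ref_map_convex_comb using z w E' by (intro convexD_alt[OF convex_cell]) auto
      moreover have "ref_map E ?m \<in> interior (cell E)"
        unfolding ref_map_in_interior[OF cE]
      proof
        fix i
        have "0 \<le> w $ i" "w $ i \<le> 1" using w(2) by (auto simp: ref_cube_def)
        then show "0 < ?m $ i \<and> ?m $ i < 1" using ws s c(1) c(2)[of i] by (cases "i = j") (auto simp: c_def)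
      qed
      ultimately show False using mesh_interior_cell_disjoint[OF E E'(1)] E'(2) by blast
    qed
  qed
  then show ?thesis using that E' sub by blast
qed

text \<open>Conformity only makes the intersection a convex face of \<open>cell E'\<close>. It
  consists of the points that agree with the face centre in those reference coordinates of
  \<open>E'\<close> that are 0 or 1 at the centre. There is at least one such coordinate, since the
  interior of a cell misses the other cell, and at most one, since the face is
  two-dimensional.\<close>

lemma shared_face_is_face:
  assumes E: "E \<in> T" and s: "s \<in> {0, 1}"
    and E': "E' \<in> T" "E' \<noteq> E" "cell E \<inter> cell E' = face E j s"
  obtains j' s' where "s' \<in> {0, 1}" "face E' j' s' = face E j s"
proof -
  note cE = mesh_cuboid[OF E] and cE' = mesh_cuboid[OF E'(1)]
  let ?K = "face E j s"
  have fK: "?K face_of cell E'" using mesh_face_of'[OF E E'(1)] E' by metis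
  define c where "c = (\<chi> i. if i = j then s else 1 / 2)"
  have c: "c $ j = s" "\<And>i. i \<noteq> j \<Longrightarrow> c $ i \<in> {0<..<1}" by (auto simp: c_def)
  have cc: "c \<in> ref_cube" using s by (auto simp: ref_cube_def c_def)
  let ?y = "ref_map E c"
  have yK: "?y \<in> ?K" using cE c cc by (simp add: ref_map_in_face)
  then have "?y \<in> cell E'" using E' by blast
  define x where "x = ref_coord E' ?y"
  have x: "?y = ref_map E' x" "x \<in> ref_cube"
    using cE' \<open>?y \<in> cell E'\<close> by (auto simp: x_def cell_def ref_map_image)
  define I where "I = {i. x $ i = 0 \<or> x $ i = 1}"
  have I: "i \<notin> I \<longleftrightarrow> x $ i \<in> {0<..<1}" for i using x(2) by (auto simp: I_def ref_cube_def less_le)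
  have K1: "ref_map E' w \<in> ?K" if "w \<in> ref_cube" "\<And>i. i \<in> I \<Longrightarrow> w $ i = x $ i" for w
  proof (rule face_of_spread[OF fK _ cE' x(2) that(1)])
    show "x $ i \<in> {0<..<1} \<or> w $ i = x $ i" for i using I that by blast
  qed (use x yK cE' in auto)
  have K2: "w $ i = x $ i" if w: "ref_map E' w \<in> ?K" and i: "i \<in> I" for w i
  proof -
    have "?K \<subseteq> face E' i (x $ i)"
    proof (rule face_spread[OF cE _ _ _ c(1) s c(2)])
      show "face E' i (x $ i) face_of cell E'" using i by (intro face_face_of[OF cE']) (auto simp: I_def)
      show "?K \<subseteq> cell E'" using E' by blast
      show "?y \<in> face E' i (x $ i)" using x cE' by (simp add: ref_map_in_face)
    qed
    then show ?thesis using w cE' by (auto simp: ref_map_in_face)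
  qed
  have "I \<noteq> {}"
  proof
    assume "I = {}"
    then have "?y \<in> interior (cell E')" unfolding x(1) ref_map_in_interior[OF cE'] using I by auto
    then show False using mesh_interior_cell_disjoint[OF E'(1) E] E'(2) yK face_subset_cell by blast
  qed
  then obtain j' where j': "j' \<in> I" by blast
  have only: "i = j'" if i: "i \<in> I" for i
  proof (rule ccontr)
    assume ne: "i \<noteq> j'"
    text \<open>Otherwise the two orthogonal edges of the face would both be parallel to one edge of \<open>E'\<close>.\<close>
    obtain k where k: "\<And>l. l = i \<or> l = j' \<or> l = k" "k \<noteq> i" "k \<noteq> j'"
      using third_index[OF ne] by blast
    have par: "\<exists>t. ref_map E w - ?y = t *\<^sub>R column k (jac E')" if w: "w \<in> ref_cube" "w $ j = s" for w
    proof -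
      have wK: "ref_map E w \<in> ?K" using w cE by (simp add: ref_map_in_face)
      obtain v where v: "ref_map E w = ref_map E' v" using cE' by (metis ref_map_ref_coord)
      have "v $ i = x $ i" "v $ j' = x $ j'" using K2 wK v i j' by metis+
      then have d: "v $ l *\<^sub>R column l (jac E') - x $ l *\<^sub>R column l (jac E') =
         (if l = k then (v $ k - x $ k) *\<^sub>R column k (jac E') else 0)" for l
        using k(1)[of l] k(2,3) by (auto simp: algebra_simps)
      have "ref_map E w - ?y = (\<Sum>l\<in>UNIV. v $ l *\<^sub>R column l (jac E') - x $ l *\<^sub>R column l (jac E'))"
        unfolding v x(1) sum_subtractf by (simp add: ref_map_sum)
      then have "ref_map E w - ?y = (v $ k - x $ k) *\<^sub>R column k (jac E')"
        unfolding d by simp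
      then show ?thesis by blast
    qed
    obtain a b where ab: "a \<noteq> j" "b \<noteq> j" "a \<noteq> b"
      using other_indices by blast
    have dir: "\<exists>t. column l (jac E) = t *\<^sub>R column k (jac E')" if l: "l \<noteq> j" for l
    proof -
      let ?w = "c + (1/2) *\<^sub>R axis l 1"
      have w: "?w $ m = (if m = l then 1 else c $ m)" for m using l by (auto simp: axis_def c_def)
      have "?w \<in> ref_cube" using cc unfolding ref_cube_def mem_Collect_eq w by auto
      moreover have "?w $ j = s" using l c unfolding w by auto
      ultimately obtain t where t: "ref_map E ?w - ?y = t *\<^sub>R column k (jac E')" using par by blast
      have "ref_map E ?w - ?y = jac E *v ((1/2) *\<^sub>R axis l 1)"
        unfolding ref_map_def by (simp add: matrix_vector_right_distrib)
      also have "\<dots> = (1/2) *\<^sub>R column l (jac E)"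
        by (simp add: matrix_vector_mult_scaleR matrix_vector_mult_basis)
      finally have "(1/2) *\<^sub>R column l (jac E) = t *\<^sub>R column k (jac E')" using t by simp
      then have "2 *\<^sub>R ((1/2) *\<^sub>R column l (jac E)) = 2 *\<^sub>R (t *\<^sub>R column k (jac E'))" by simp
      then show ?thesis by (intro exI[of _ "2 * t"]) simp
    qed
    obtain ta tb where t: "column a (jac E) = ta *\<^sub>R column k (jac E')" "column b (jac E) = tb *\<^sub>R column k (jac E')"
      using dir ab by metis
    have "column a (jac E) \<bullet> column b (jac E) = 0" using cuboid_column(2)[OF cE ab(3)] .
    then have "ta = 0 \<or> tb = 0" using cuboid_column(1)[OF cE', of k] by (auto simp: t)
    then show False using cuboid_column(1)[OF cE, of a] cuboid_column(1)[OF cE, of b] t by auto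
  qed
  have "face E' j' (x $ j') = ?K"
  proof
    show "face E' j' (x $ j') \<subseteq> ?K" using K1 only by (auto simp: face_def[of E'])
    show "?K \<subseteq> face E' j' (x $ j')"
    proof
      fix z assume z: "z \<in> ?K"
      then obtain w where w: "z = ref_map E' w" "w \<in> ref_cube" using E' by (auto simp: cell_def)
      then show "z \<in> face E' j' (x $ j')" using K2[of w j'] z j' cE' by (simp add: ref_map_in_face)
    qed
  qed
  moreover have "x $ j' \<in> {0, 1}" using j' by (auto simp: I_def)
  ultimately show ?thesis using that by blast
qed

end

section \<open>Local frames at the vertices of a shared face\<close>

lemma vert_flip: "\<exists>D. vert S' = flip S (vert D) \<and> (\<forall>i. i \<in> D \<longleftrightarrow> (i \<in> S \<longleftrightarrow> i \<notin> S'))"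
  \<comment> \<open>Seen from the vertex \<open>S\<close>, the label of \<open>S'\<close> is the
    symmetric difference of the two sets.\<close>
  by (intro exI[of _ "{i. i \<in> S \<longleftrightarrow> i \<notin> S'}"]) (auto simp: vec_eq_iff)

lemma flip_vert: "\<exists>S'. flip S (vert D) = vert S' \<and> (\<forall>i. i \<in> D \<longleftrightarrow> (i \<in> S \<longleftrightarrow> i \<notin> S'))"
  by (intro exI[of _ "{i. i \<in> S \<longleftrightarrow> i \<notin> D}"]) (auto simp: vec_eq_iff)

lemma extreme_point_face_edges:
  assumes E: "is_cuboid E" and S: "j \<in> S \<longleftrightarrow> \<sigma>"
  shows "w extreme_point_of face E j (of_bool \<sigma>) \<longleftrightarrow>
    (\<exists>D. w = ref_map E (vert S) + (\<Sum>i\<in>UNIV. vert D $ i *\<^sub>R edge E S i) \<and> j \<notin> D)"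
  unfolding extreme_point_face_iff[OF E] ref_map_edges[symmetric]
proof
  assume "\<exists>S'. w = ref_map E (vert S') \<and> (j \<in> S' \<longleftrightarrow> \<sigma>)"
  then obtain S' where S': "w = ref_map E (vert S')" "j \<in> S' \<longleftrightarrow> \<sigma>" by blast
  obtain D where "vert S' = flip S (vert D)" "j \<in> D \<longleftrightarrow> (j \<in> S \<longleftrightarrow> j \<notin> S')" using vert_flip by blast
  then show "\<exists>D. w = ref_map E (flip S (vert D)) \<and> j \<notin> D" using S S' by auto
next
  assume "\<exists>D. w = ref_map E (flip S (vert D)) \<and> j \<notin> D"
  then obtain D where D: "w = ref_map E (flip S (vert D))" "j \<notin> D" by blast
  obtain S' where "flip S (vert D) = vert S'" "j \<in> D \<longleftrightarrow> (j \<in> S \<longleftrightarrow> j \<notin> S')" using flip_vert by blast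
  then show "\<exists>S'. w = ref_map E (vert S') \<and> (j \<in> S' \<longleftrightarrow> \<sigma>)" using S D by auto
qed

text \<open>Edges are orthogonal and the summands are squared lengths or 0, so only a common index
  makes the product nonzero.\<close>

lemma inner_edge_sums:
  assumes E: "is_cuboid E"
  shows "(\<Sum>i\<in>UNIV. vert D $ i *\<^sub>R edge E S i) \<bullet> (\<Sum>i\<in>UNIV. vert D' $ i *\<^sub>R edge E S i) = 0 \<longleftrightarrow> D \<inter> D' = {}"
proof -
  have "(\<Sum>i\<in>UNIV. vert D $ i *\<^sub>R edge E S i) \<bullet> (\<Sum>i\<in>UNIV. vert D' $ i *\<^sub>R edge E S i) =
    (\<Sum>i\<in>UNIV. vert D' $ i * (vert D $ i * (edge E S i \<bullet> edge E S i)))"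
    by (simp add: inner_sum_right[of _ "\<lambda>i. vert D' $ i *\<^sub>R edge E S i"] inner_sum_edges[OF E] del: vert_nth)
  also have "\<dots> = 0 \<longleftrightarrow> (\<forall>i\<in>UNIV. vert D' $ i * (vert D $ i * (edge E S i \<bullet> edge E S i)) = 0)"
    by (rule sum_nonneg_eq_0_iff) auto
  also have "\<dots> \<longleftrightarrow> D \<inter> D' = {}" by (auto simp: edge_nonzero[OF E])
  finally show ?thesis .
qed

lemma edge_sum_singleton: "(\<Sum>i\<in>UNIV. vert {k} $ i *\<^sub>R edge E S i) = edge E S k"
  by (simp add: if_distrib[of "\<lambda>c. c *\<^sub>R _"] cong: if_cong)

lemma edge_sum_eq_0:
  assumes "is_cuboid E"
  shows "(\<Sum>i\<in>UNIV. vert D $ i *\<^sub>R edge E S i) = 0 \<longleftrightarrow> D = {}"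
  using inner_edge_sums[OF assms, of D S D] by simp

text \<open>The edges of a face at one of its vertices depend only on the face as a set.\<close>

lemma face_edges:
  assumes E: "is_cuboid E" and S: "j \<in> S \<longleftrightarrow> \<sigma>"
  defines "r \<equiv> ref_map E (vert S)" and "K \<equiv> face E j (of_bool \<sigma>)"
  shows "v \<in> edge E S ` (- {j}) \<longleftrightarrow> v \<noteq> 0 \<and> (r + v) extreme_point_of K \<and>
    (\<exists>v'. v' \<noteq> 0 \<and> (r + v') extreme_point_of K \<and> v \<bullet> v' = 0)"
proof
  assume "v \<in> edge E S ` (- {j})"
  then obtain i where i: "v = edge E S i" "i \<noteq> j" by blast
  obtain k where k: "k \<noteq> i" "k \<noteq> j" using third_index[OF i(2)] by blast
  have x: "(r + edge E S i) extreme_point_of K" if "i \<noteq> j" for i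
    unfolding K_def extreme_point_face_edges[OF E S] r_def
  proof (intro exI conjI)
    show "ref_map E (vert S) + edge E S i = ref_map E (vert S) + (\<Sum>l\<in>UNIV. vert {i} $ l *\<^sub>R edge E S l)"
      by (simp only: edge_sum_singleton)
    show "j \<notin> {i}" using that by auto
  qed
  show "v \<noteq> 0 \<and> (r + v) extreme_point_of K \<and> (\<exists>v'. v' \<noteq> 0 \<and> (r + v') extreme_point_of K \<and> v \<bullet> v' = 0)"
    unfolding i(1)
    using edge_nonzero[OF E] edge_orthogonal[OF E, of i k S] x[OF i(2)] x[OF k(2)] k(1) by metis
next
  assume "v \<noteq> 0 \<and> (r + v) extreme_point_of K \<and> (\<exists>v'. v' \<noteq> 0 \<and> (r + v') extreme_point_of K \<and> v \<bullet> v' = 0)"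
  then obtain v' where v: "v \<noteq> 0" "(r + v) extreme_point_of K" "v' \<noteq> 0" "(r + v') extreme_point_of K" "v \<bullet> v' = 0"
    by blast
  obtain D D' where D: "v = (\<Sum>i\<in>UNIV. vert D $ i *\<^sub>R edge E S i)" "j \<notin> D"
      "v' = (\<Sum>i\<in>UNIV. vert D' $ i *\<^sub>R edge E S i)" "j \<notin> D'"
    using v(2,4) unfolding K_def extreme_point_face_edges[OF E S] r_def by auto
  have "D \<noteq> {}" using v(1) unfolding D(1) edge_sum_eq_0[OF E] .
  have "D' \<noteq> {}" using v(3) unfolding D(3) edge_sum_eq_0[OF E] .
  have "D \<inter> D' = {}" using v(5) unfolding D(1,3) inner_edge_sums[OF E] .
  \<comment> \<open>Two disjoint nonempty subsets of a two-element set are singletons. This excludes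
    the diagonal of the face, to which no nonzero difference from \<open>r\<close> to a corner is
    orthogonal.\<close>
  obtain a where "D = {a}" "a \<noteq> j"
  proof -
    obtain a b where ab: "a \<noteq> j" "b \<noteq> j" "a \<noteq> b" "\<And>l. l = a \<or> l = b \<or> l = j"
      using other_indices by blast
    have sub: "D \<subseteq> {a, b}" "D' \<subseteq> {a, b}" using ab(4) D(2,4) by blast+
    show ?thesis
    proof (cases "a \<in> D")
      case True
      then have "b \<in> D'" using sub(2) \<open>D' \<noteq> {}\<close> \<open>D \<inter> D' = {}\<close> by blast
      then have "D = {a}" using True sub(1) \<open>D \<inter> D' = {}\<close> by blast
      then show ?thesis using that ab(1) by blast
    next
      case False
      then have "D = {b}" using sub(1) \<open>D \<noteq> {}\<close> by blast
      then show ?thesis using that ab(2) by blast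
    qed
  qed
  then have "v = edge E S a" using D(1) edge_sum_singleton by metis
  then show "v \<in> edge E S ` (- {j})" using \<open>a \<noteq> j\<close> by blast
qed

lemma edge_inj: assumes "is_cuboid E" shows "edge E S i = edge E S k \<longleftrightarrow> i = k"
  using edge_orthogonal[OF assms, of i k S] edge_nonzero[OF assms, of S i] by fastforce

context cuboid_domain
begin

text \<open>By \<open>face_edges\<close> both cuboids have the same two edges inside the face, up to
  the permutation \<rho> of indices. Their third edges are orthogonal to these, hence parallel, and
  they point to opposite sides because the cells meet only in the face.\<close>

lemma shared_face_vertex:
  assumes E: "E \<in> T" and E': "E' \<in> T" "E' \<noteq> E" "cell E \<inter> cell E' = face E j (of_bool \<sigma>)"
    and F: "face E' j' (of_bool \<sigma>') = face E j (of_bool \<sigma>)"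
    and S: "j \<in> S \<longleftrightarrow> \<sigma>"
  obtains S' \<rho> where "j' \<in> S' \<longleftrightarrow> \<sigma>'" "ref_map E' (vert S') = ref_map E (vert S)"
    "bij \<rho>" "\<rho> j' = j" "\<forall>k. k \<noteq> j' \<longrightarrow> edge E' S' k = edge E S (\<rho> k)"
    "edge E' S' j' = - (norm (column j' (jac E')) / norm (column j (jac E))) *\<^sub>R edge E S j"
proof -
  note cE = mesh_cuboid[OF E] and cE' = mesh_cuboid[OF E'(1)]
  let ?r = "ref_map E (vert S)"
  have "?r extreme_point_of face E j (of_bool \<sigma>)" using S extreme_point_face_iff[OF cE] by blast
  then have "?r extreme_point_of face E' j' (of_bool \<sigma>')" using F by simp
  then obtain S' where S': "ref_map E' (vert S') = ?r" "j' \<in> S' \<longleftrightarrow> \<sigma>'"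
    using extreme_point_face_iff[OF cE'] by metis
  have edges: "edge E' S' ` (- {j'}) = edge E S ` (- {j})"
    using face_edges[OF cE' S'(2)] face_edges[OF cE S] S'(1) F by (intro set_eqI) simp
  then have "\<forall>k\<in>-{j'}. \<exists>i. i \<noteq> j \<and> edge E' S' k = edge E S i" by (metis ComplD image_iff imageI singletonI)
  then obtain f where f: "\<And>k. k \<noteq> j' \<Longrightarrow> f k \<noteq> j \<and> edge E' S' k = edge E S (f k)"
    by (metis ComplI singletonD)
  define \<rho> where "\<rho> = f(j' := j)"
  have "inj \<rho>"
  proof (rule injI)
    fix a b assume "\<rho> a = \<rho> b"
    then show "a = b" using f edge_inj[OF cE'] unfolding \<rho>_def by (metis fun_upd_apply)
  qed
  then have bij: "bij \<rho>" by (simp add: finite_UNIV_inj_surj bij_def)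
  let ?v = "edge E' S' j'" and ?e = "edge E S j"
  have "?v \<bullet> edge E S i = 0" if "i \<noteq> j" for i
  proof -
    have "edge E S i \<in> edge E' S' ` (- {j'})" using edges that by blast
    then obtain k where "k \<noteq> j'" "edge E S i = edge E' S' k" by auto
    then show ?thesis using edge_orthogonal[OF cE', of j' k S'] by simp
  qed
  then have d: "(?v \<bullet> edge E S i / (edge E S i \<bullet> edge E S i)) *\<^sub>R edge E S i =
      (if i = j then (?v \<bullet> ?e / (?e \<bullet> ?e)) *\<^sub>R ?e else 0)" for i by auto
  have "?v = (\<Sum>i\<in>UNIV. (?v \<bullet> edge E S i / (edge E S i \<bullet> edge E S i)) *\<^sub>R edge E S i)"
    by (rule edge_expansion[OF cE])
  also have "\<dots> = (\<Sum>i\<in>UNIV. if i = j then (?v \<bullet> ?e / (?e \<bullet> ?e)) *\<^sub>R ?e else 0)"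
    by (rule sum.cong[OF refl d])
  also have "\<dots> = (?v \<bullet> ?e / (?e \<bullet> ?e)) *\<^sub>R ?e" by simp
  finally have v: "?v = (?v \<bullet> ?e / (?e \<bullet> ?e)) *\<^sub>R ?e" .
  define c where "c = ?v \<bullet> ?e / (?e \<bullet> ?e)"
  from v have vc: "?v = c *\<^sub>R ?e" unfolding c_def .
  have "c \<noteq> 0" using vc edge_nonzero[OF cE', of S' j'] by auto
  \<comment> \<open>With \<open>c\<close> positive, a short step along the common direction would
    stay in both cells and leave the face.\<close>
  have "\<not> 0 < c"
  proof
    assume c: "0 < c"
    define d where "d = min 1 c"
    have d: "0 < d" "d \<le> 1" "d / c \<le> 1" "0 \<le> d / c" using c by (auto simp: d_def)
    have y1: "?r + d *\<^sub>R ?e = ref_map E (flip S (d *\<^sub>R axis j 1))"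
      unfolding ref_map_edges by (simp add: axis_def if_distrib[of "\<lambda>c. c *\<^sub>R _"] if_distrib[of "\<lambda>c. _ * c"] cong: if_cong)
    have y2: "?r + d *\<^sub>R ?e = ref_map E' (flip S' ((d / c) *\<^sub>R axis j' 1))"
      unfolding ref_map_edges S'(1) using \<open>c \<noteq> 0\<close>
      by (simp add: axis_def vc if_distrib[of "\<lambda>c. c *\<^sub>R _"] if_distrib[of "\<lambda>c. _ * c"] cong: if_cong)
    have cu: "t *\<^sub>R axis i 1 \<in> ref_cube" if "0 \<le> t" "t \<le> 1" for t i
      using that by (auto simp: ref_cube_def axis_def)
    have "?r + d *\<^sub>R ?e \<in> cell E'" unfolding y2 ref_map_in_cell[OF cE'] flip_ref_cube using d by (intro cu) auto
    moreover have "?r + d *\<^sub>R ?e \<in> cell E" unfolding y1 ref_map_in_cell[OF cE] flip_ref_cube using d by (intro cu) auto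
    ultimately have "ref_map E (flip S (d *\<^sub>R axis j 1)) \<in> face E j (of_bool \<sigma>)" using E'(3) y1 by auto
    then have "flip S (d *\<^sub>R axis j 1) $ j = of_bool \<sigma>"
      unfolding ref_map_in_face[OF cE] by blast
    then show False using S d(1) by (auto simp: axis_def split: if_splits)
  qed
  then have "c < 0" using \<open>c \<noteq> 0\<close> by simp
  have "norm ?v = \<bar>c\<bar> * norm ?e" using vc by simp
  then have "c = - (norm (column j' (jac E')) / norm (column j (jac E)))"
    using \<open>c < 0\<close> cuboid_column(1)[OF cE, of j] by (simp add: norm_edge field_simps)
  then have "?v = - (norm (column j' (jac E')) / norm (column j (jac E))) *\<^sub>R ?e" using vc by simp
  then show ?thesis using that[of S' \<rho>] S' bij f by (simp add: \<rho>_def)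
qed

end

section \<open>Fluxes through faces\<close>

text \<open>Up to a constant factor this is the integral of \<open>\<phi>\<close> over a face, weighted by the nodal function of a vertex.\<close>

definition face_integral :: "cuboid \<Rightarrow> 3 set \<Rightarrow> 3 \<Rightarrow> (real^3 \<Rightarrow> real) \<Rightarrow> real" where
  "face_integral E S j \<phi> = integral ref_cube (\<lambda>x. let y = set_coord j (vert S $ j) x in shape S y * \<phi> (ref_map E y))"

lemma continuous_shape: "continuous_on A (shape S)"
proof -
  have "continuous_on A (\<lambda>x. if i \<in> S then x $ i else 1 - x $ i)" for i :: 3
    by (cases "i \<in> S") (auto intro!: continuous_intros)
  then show ?thesis unfolding shape_def by (intro continuous_intros)
qed

lemma shape_flip: "shape S (flip S t) = (\<Prod>i\<in>UNIV. 1 - t $ i)"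
  unfolding shape_def by (intro prod.cong) auto

lemma flip_set_coord: "set_coord j (vert S $ j) (flip S t) = flip S (set_coord j 0 t)"
  by (auto simp: vec_eq_iff)

text \<open>Symmetries of the cube preserve integrals. The absolute determinant of the symmetry is
  not computed but read off from the integral of the constant function 1.\<close>

lemma integral_ref_cube_flip_perm:
  fixes f :: "real^3 \<Rightarrow> real"
  assumes f: "continuous_on ref_cube f" and \<rho>: "bij \<rho>"
  shows "integral ref_cube (\<lambda>x. f (flip S' (\<chi> k. flip S x $ \<rho> k))) = integral ref_cube f"
proof -
  define g where "g x = (\<chi> k. (if k \<in> S' then -1 else 1) * ((if \<rho> k \<in> S then -1 else 1) * x $ \<rho> k))" for x :: "real^3"
  define a where "a = flip S' (\<chi> k. flip S 0 $ \<rho> k)"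
  have P: "flip S' (\<chi> k. flip S x $ \<rho> k) = a + g x" for x
    by (simp add: a_def g_def vec_eq_iff)
  have lin: "linear g" unfolding g_def by (rule linearI) (auto simp: vec_eq_iff algebra_simps)
  have "inj g"
  proof (rule injI)
    fix x y assume "g x = g y"
    then have "x $ \<rho> k = y $ \<rho> k" for k by (auto simp: g_def vec_eq_iff dest!: spec[of _ k] split: if_splits)
    then show "x = y" using \<rho> by (metis vec_eq_iff bij_pointE)
  qed
  then have det: "det (matrix g) \<noteq> 0" using det_nz_iff_inj[OF lin] by simp
  have im: "(\<lambda>x. a + g x) ` ref_cube = ref_cube"
  proof -
    have cube: "(\<chi> k. x $ \<rho> k) \<in> ref_cube \<longleftrightarrow> x \<in> ref_cube" for x
      unfolding ref_cube_def using \<rho> by simp (metis bij_pointE)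
    have "a + g x \<in> ref_cube \<longleftrightarrow> x \<in> ref_cube" for x
      unfolding P[symmetric] flip_ref_cube cube ..
    moreover have "\<exists>x. y = a + g x" for y
    proof -
      have "surj g" using linear_injective_imp_surjective[OF lin \<open>inj g\<close>] by simp
      then obtain x where "g x = y - a" by (metis surjD)
      then show ?thesis by (intro exI[of _ x]) simp
    qed
    ultimately show ?thesis by (auto simp: image_iff) metis
  qed
  have one: "integral ref_cube (\<lambda>x. 1::real) = 1"
  proof -
    have "cbox (0::real^3) 1 \<noteq> {}" by (auto simp: interval_ne_empty_cart)
    then show ?thesis by (simp add: ref_cube_cbox content_cbox_cart)
  qed
  have "integral ref_cube (\<lambda>x. 1::real) = \<bar>det (matrix g)\<bar> * integral ref_cube (\<lambda>x. 1)"
    using affine_change_of_variables(2)[OF lin det, of a 0 1 "\<lambda>_. 1"] by (simp add: im ref_cube_cbox[symmetric])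
  then have "\<bar>det (matrix g)\<bar> = 1" using one by simp
  then show ?thesis
    unfolding P using affine_change_of_variables(2)[OF lin det, of a 0 1 f] f by (simp add: im ref_cube_cbox[symmetric])
qed

text \<open>In coordinates with the vertex as origin the two integrands differ only by the
  permutation \<rho>, since the coordinate transversal to the face is set to 0. Thus the weighted
  face integral belongs to the face and the vertex and to neither cuboid in particular.\<close>

lemma face_integral_eq:
  assumes \<phi>: "continuous_on UNIV \<phi>" and r: "ref_map E' (vert S') = ref_map E (vert S)"
    and \<rho>: "bij \<rho>" "\<rho> j' = j" and e: "\<And>k. k \<noteq> j' \<Longrightarrow> edge E' S' k = edge E S (\<rho> k)"
  shows "face_integral E S j \<phi> = face_integral E' S' j' \<phi>"
proof -
  let ?P = "\<lambda>x. flip S' (\<chi> k. flip S x $ \<rho> k)"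
  let ?f = "\<lambda>x. let y = set_coord j' (vert S' $ j') x in shape S' y * \<phi> (ref_map E' y)"
  have "continuous_on UNIV (\<lambda>y. shape S' y * \<phi> (ref_map E' y))"
    by (rule continuous_on_mult[OF continuous_shape continuous_on_compose2[OF \<phi> continuous_ref_map subset_UNIV]])
  from continuous_on_compose2[OF this continuous_set_coord subset_UNIV]
  have "continuous_on ref_cube ?f" unfolding Let_def .
  then have e1: "face_integral E' S' j' \<phi> = integral ref_cube (\<lambda>x. ?f (?P x))"
    unfolding face_integral_def by (rule integral_ref_cube_flip_perm[OF _ \<rho>(1), symmetric])
  have key: "?f (?P x) = (let y = set_coord j (vert S $ j) x in shape S y * \<phi> (ref_map E y))" for x
  proof -
    define t where "t = flip S x"
    define t' where "t' = (\<chi> k. t $ \<rho> k)"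
    have x: "x = flip S t" by (simp add: t_def)
    have s: "set_coord j' 0 t' = (\<chi> k. set_coord j 0 t $ \<rho> k)"
    proof -
      have "\<rho> k = j \<longleftrightarrow> k = j'" for k using \<rho> by (metis bij_pointE)
      then show ?thesis by (auto simp: vec_eq_iff t'_def)
    qed
    have "(\<Prod>k\<in>UNIV. 1 - set_coord j' 0 t' $ k) = (\<Prod>k\<in>UNIV. 1 - set_coord j 0 t $ \<rho> k)"
      unfolding s by simp
    also have "\<dots> = (\<Prod>i\<in>UNIV. 1 - set_coord j 0 t $ i)"
      using prod.reindex_bij_betw[OF \<rho>(1)] .
    finally have p: "(\<Prod>k\<in>UNIV. 1 - set_coord j' 0 t' $ k) = (\<Prod>i\<in>UNIV. 1 - set_coord j 0 t $ i)" .
    have "(\<Sum>k\<in>UNIV. set_coord j' 0 t' $ k *\<^sub>R edge E' S' k) = (\<Sum>k\<in>UNIV. set_coord j 0 t $ \<rho> k *\<^sub>R edge E S (\<rho> k))"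
    proof (rule sum.cong[OF refl])
      fix k show "set_coord j' 0 t' $ k *\<^sub>R edge E' S' k = set_coord j 0 t $ \<rho> k *\<^sub>R edge E S (\<rho> k)"
        using e[of k] \<rho> by (cases "k = j'") (auto simp: s)
    qed
    also have "\<dots> = (\<Sum>i\<in>UNIV. set_coord j 0 t $ i *\<^sub>R edge E S i)"
      using sum.reindex_bij_betw[OF \<rho>(1)] .
    finally have q: "ref_map E' (flip S' (set_coord j' 0 t')) = ref_map E (flip S (set_coord j 0 t))"
      unfolding ref_map_edges r by simp
    have P: "?P x = flip S' t'" by (simp add: t'_def t_def)
    show ?thesis unfolding P Let_def flip_set_coord shape_flip p q
      unfolding x flip_set_coord shape_flip ..
  qed
  show ?thesis unfolding e1 key unfolding face_integral_def ..
qed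

text \<open>Sign of the outward normal in direction \<open>j\<close> on the face through the vertex
  \<open>S\<close>.\<close>

definition vsign :: "3 set \<Rightarrow> 3 \<Rightarrow> real" where
  "vsign S j = (if j \<in> S then 1 else -1)"

lemma partial_deriv_compose_ref_map:
  assumes "\<phi> differentiable (at (ref_map E x))"
  shows "(\<lambda>x. \<phi> (ref_map E x)) differentiable (at x)"
    and "partial_deriv j (\<lambda>x. \<phi> (ref_map E x)) x = column j (jac E) \<bullet> grad \<phi> (ref_map E x)"
proof -
  have "(ref_map E has_derivative (\<lambda>h. jac E *v h)) (at x)"
    unfolding ref_map_def[abs_def]
    by (auto intro!: derivative_eq_intros linear_imp_has_derivative)
  from has_derivative_compose[OF this has_derivative_partial[OF assms]]
  have *: "((\<lambda>x. \<phi> (ref_map E x)) has_derivative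
     (\<lambda>h. \<Sum>i\<in>UNIV. (jac E *v h) $ i * partial_deriv i \<phi> (ref_map E x))) (at x)" .
  then show "(\<lambda>x. \<phi> (ref_map E x)) differentiable (at x)" using differentiable_def by blast
  have "jac E *v axis j 1 = column j (jac E)" by (rule matrix_vector_mult_basis)
  then show "partial_deriv j (\<lambda>x. \<phi> (ref_map E x)) x = column j (jac E) \<bullet> grad \<phi> (ref_map E x)"
    unfolding partial_deriv_eq[OF *] by (simp add: inner_vec_def grad_def)
qed

lemma test_function_C1:
  assumes "test_function \<Omega> \<phi>"
  shows "\<phi> differentiable (at x)" "continuous_on A \<phi>" "continuous_on A (partial_deriv i \<phi>)" "continuous_on A (grad \<phi>)"
proof -
  have d: "foldr partial_deriv is \<phi> differentiable_on UNIV" for "is"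
    using assms by (simp add: test_function_def)
  show d0: "\<phi> differentiable (at x)" for x
    using d[of "[]"] by (simp add: differentiable_on_def)
  have d1: "partial_deriv i \<phi> differentiable (at x)" for x i
    using d[of "[i]"] by (simp add: differentiable_on_def)
  show "continuous_on A \<phi>"
    by (intro continuous_at_imp_continuous_on ballI differentiable_imp_continuous_within d0)
  show c: "continuous_on A (partial_deriv i \<phi>)" for i
    by (intro continuous_at_imp_continuous_on ballI differentiable_imp_continuous_within d1)
  show "continuous_on A (grad \<phi>)" unfolding grad_def by (intro continuous_on_vec_lambda c)
qed

text \<open>Integration by parts in each coordinate. The normal component on a face is the
  interpolant of its vertex values, so the boundary term is a sum of values of
  \<open>face_integral\<close> over vertices; the divergence is constant and comes out of the volume
  term.\<close>

lemma integral_ref_cube_ERT0: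
  assumes v: "v \<in> ERT0" and \<phi>: "test_function \<Omega> \<phi>"
  shows "integral ref_cube (\<lambda>x. (jac E *v v x) \<bullet> grad \<phi> (ref_map E x)) =
    (\<Sum>S\<in>UNIV. \<Sum>j\<in>UNIV. vsign S j * v (vert S) $ j * face_integral E S j \<phi>) -
    (\<Sum>S\<in>UNIV. \<Sum>j\<in>UNIV. vsign S j / 4 * v (vert S) $ j) * integral ref_cube (\<lambda>x. \<phi> (ref_map E x))"
proof -
  note \<phi>1 = test_function_C1[OF \<phi>]
  let ?f = "\<lambda>x. \<phi> (ref_map E x)" and ?vj = "\<lambda>j x. v x $ j"
  let ?D = "\<Sum>S\<in>UNIV. \<Sum>j\<in>UNIV. vsign S j / 4 * v (vert S) $ j"
  have cf: "continuous_on A ?f" for A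
    by (rule continuous_on_compose2[OF \<phi>1(2) continuous_ref_map subset_UNIV])
  have cg: "continuous_on A (\<lambda>x. grad \<phi> (ref_map E x))" for A
    by (rule continuous_on_compose2[OF \<phi>1(4) continuous_ref_map subset_UNIV])
  have cdf: "continuous_on A (partial_deriv j ?f)" for A j
    unfolding partial_deriv_compose_ref_map(2)[OF \<phi>1(1), abs_def] by (intro continuous_intros cg)
  have cv: "continuous_on A (?vj j)" for A j
    by (intro continuous_intros ERT0_continuous[OF v])
  have dp: "(\<lambda>x. ?vj j x * ?f x) differentiable (at x)" for j x
    by (intro differentiable_mult ERT0_differentiable v partial_deriv_compose_ref_map(1) \<phi>1(1))
  have pd: "partial_deriv j (\<lambda>x. ?vj j x * ?f x) x = v x $ j * partial_deriv j ?f x + partial_deriv j (?vj j) x * ?f x" for j x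
    by (intro partial_deriv_mult ERT0_differentiable v partial_deriv_compose_ref_map(1) \<phi>1(1))
  have cpd: "continuous_on A (partial_deriv j (\<lambda>x. ?vj j x * ?f x))" for A j
    unfolding pd[abs_def] by (intro continuous_intros cv cdf cf ERT0_continuous_partial_deriv v)
  have int: "g integrable_on ref_cube" if "continuous_on ref_cube g" for g :: "real^3 \<Rightarrow> real"
    using that unfolding ref_cube_cbox by (rule integrable_continuous)
  \<comment> \<open>Only vertices on the face where coordinate \<open>j\<close> is
    \<open>of_bool b\<close> have a nodal function that does not vanish identically there.\<close>
  have face: "(\<lambda>x. (?vj j (set_coord j (of_bool b) x)) * ?f (set_coord j (of_bool b) x)) =
     (\<lambda>x. \<Sum>S\<in>UNIV. if (j \<in> S) = b then v (vert S) $ j * (let y = set_coord j (vert S $ j) x in shape S y * \<phi> (ref_map E y)) else 0)" for j b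
  proof
    fix x
    let ?y = "set_coord j (of_bool b) x"
    have "?vj j ?y = (\<Sum>S\<in>UNIV. shape S ?y * v (vert S) $ j)"
      by (rule ERT0_face[OF v, of _ _ "if b then UNIV else {}"]) simp
    then have "?vj j ?y * ?f ?y = (\<Sum>S\<in>UNIV. shape S ?y * v (vert S) $ j * ?f ?y)"
      by (simp add: sum_distrib_right)
    also have "\<dots> = (\<Sum>S\<in>UNIV. if (j \<in> S) = b then v (vert S) $ j * (let y = set_coord j (vert S $ j) x in shape S y * \<phi> (ref_map E y)) else 0)"
    proof (rule sum.cong[OF refl])
      fix S :: "3 set"
      have "shape S ?y = 0" if "(j \<in> S) \<noteq> b"
        unfolding shape_def using that by (intro prod_zero) (auto intro!: bexI[of _ j])
      moreover have "vert S $ j = of_bool b" if "(j \<in> S) = b" using that by auto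
      ultimately show "shape S ?y * v (vert S) $ j * ?f ?y = (if (j \<in> S) = b then v (vert S) $ j * (let y = set_coord j (vert S $ j) x in shape S y * \<phi> (ref_map E y)) else 0)"
        by (simp add: Let_def)
    qed
    finally show "?vj j ?y * ?f ?y = \<dots>" .
  qed
  have cs: "continuous_on A (\<lambda>x. let y = set_coord j (vert S $ j) x in shape S y * \<phi> (ref_map E y))" for A j S
    unfolding Let_def
    by (rule continuous_on_compose2[OF _ continuous_set_coord subset_UNIV])
       (rule continuous_on_mult[OF continuous_shape cf])
  have face_int: "integral ref_cube (\<lambda>x. (?vj j (set_coord j (of_bool b) x)) * ?f (set_coord j (of_bool b) x)) =
      (\<Sum>S\<in>UNIV. if (j \<in> S) = b then v (vert S) $ j * face_integral E S j \<phi> else 0)" for j b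
    unfolding face
  proof (subst integral_sum)
    show "(\<lambda>x. if (j \<in> S) = b then v (vert S) $ j * (let y = set_coord j (vert S $ j) x in shape S y * \<phi> (ref_map E y)) else 0) integrable_on ref_cube" for S
      by (rule int, cases "(j \<in> S) = b")
        (simp_all only: simp_thms if_True if_False continuous_on_const continuous_on_mult[OF continuous_on_const cs])
    show "(\<Sum>S\<in>UNIV. integral ref_cube (\<lambda>x. if (j \<in> S) = b then v (vert S) $ j * (let y = set_coord j (vert S $ j) x in shape S y * \<phi> (ref_map E y)) else 0)) =
      (\<Sum>S\<in>UNIV. if (j \<in> S) = b then v (vert S) $ j * face_integral E S j \<phi> else 0)"
      unfolding face_integral_def by (intro sum.cong refl) simp
  qed simp
  have ibp: "integral ref_cube (partial_deriv j (\<lambda>x. ?vj j x * ?f x)) =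
     (\<Sum>S\<in>UNIV. vsign S j * v (vert S) $ j * face_integral E S j \<phi>)" for j
  proof -
    have fi: "continuous_on ref_cube (\<lambda>x. ?vj j (set_coord j s x) * ?f (set_coord j s x))" for s
      by (rule continuous_on_compose2[OF _ continuous_set_coord subset_UNIV])
         (intro continuous_intros cv cf)
    have "integral ref_cube (partial_deriv j (\<lambda>x. ?vj j x * ?f x)) =
      integral ref_cube (\<lambda>x. ?vj j (set_coord j 1 x) * ?f (set_coord j 1 x) - ?vj j (set_coord j 0 x) * ?f (set_coord j 0 x))"
      by (rule integral_partial_deriv_ref_cube[OF dp cpd])
    also have "\<dots> = integral ref_cube (\<lambda>x. ?vj j (set_coord j (of_bool True) x) * ?f (set_coord j (of_bool True) x)) -
        integral ref_cube (\<lambda>x. ?vj j (set_coord j (of_bool False) x) * ?f (set_coord j (of_bool False) x))"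
      by (simp add: integral_diff[OF int[OF fi] int[OF fi]])
    also have "\<dots> = (\<Sum>S\<in>UNIV. vsign S j * v (vert S) $ j * face_integral E S j \<phi>)"
      unfolding face_int sum_subtractf[symmetric] by (intro sum.cong refl) (simp add: vsign_def)
    finally show ?thesis .
  qed
  have "(jac E *v v x) \<bullet> grad \<phi> (ref_map E x) =
     (\<Sum>j\<in>UNIV. partial_deriv j (\<lambda>x. ?vj j x * ?f x) x) - ?D * ?f x" for x
  proof -
    have "jac E *v v x = (\<Sum>j\<in>UNIV. v x $ j *\<^sub>R column j (jac E))"
      by (simp add: matrix_mult_sum scalar_mult_eq_scaleR)
    then have "(jac E *v v x) \<bullet> grad \<phi> (ref_map E x) = (\<Sum>j\<in>UNIV. v x $ j * partial_deriv j ?f x)"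
      by (simp add: inner_sum_left partial_deriv_compose_ref_map(2)[OF \<phi>1(1)])
    moreover have "(\<Sum>j\<in>UNIV. partial_deriv j (?vj j) x) = ?D"
      unfolding ERT0_divergence[OF v] by (intro sum.cong refl) (simp add: vsign_def)
    ultimately show ?thesis unfolding pd by (simp add: sum.distrib sum_distrib_right[symmetric])
  qed
  then have "integral ref_cube (\<lambda>x. (jac E *v v x) \<bullet> grad \<phi> (ref_map E x)) =
    integral ref_cube (\<lambda>x. (\<Sum>j\<in>UNIV. partial_deriv j (\<lambda>x. ?vj j x * ?f x) x) - ?D * ?f x)" by simp
  also have "\<dots> = (\<Sum>j\<in>UNIV. integral ref_cube (partial_deriv j (\<lambda>x. ?vj j x * ?f x))) - ?D * integral ref_cube ?f"
  proof (subst integral_diff)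
    show "(\<lambda>x. \<Sum>j\<in>UNIV. partial_deriv j (\<lambda>x. ?vj j x * ?f x) x) integrable_on ref_cube"
      by (intro int continuous_intros cpd)
    show "(\<lambda>x. ?D * ?f x) integrable_on ref_cube" by (intro int continuous_intros cf)
    show "integral ref_cube (\<lambda>x. \<Sum>j\<in>UNIV. partial_deriv j (\<lambda>x. ?vj j x * ?f x) x) - integral ref_cube (\<lambda>x. ?D * ?f x) =
      (\<Sum>j\<in>UNIV. integral ref_cube (partial_deriv j (\<lambda>x. ?vj j x * ?f x))) - ?D * integral ref_cube ?f"
      by (subst integral_sum) (auto intro!: int cpd)
  qed
  also have "(\<Sum>j\<in>UNIV. integral ref_cube (partial_deriv j (\<lambda>x. ?vj j x * ?f x))) =
     (\<Sum>S\<in>UNIV. \<Sum>j\<in>UNIV. vsign S j * v (vert S) $ j * face_integral E S j \<phi>)"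
    unfolding ibp by (rule sum.swap)
  finally show ?thesis .
qed

section \<open>Integration over the mesh\<close>

lemma integrable_lebesgue_on_iff:
  fixes f :: "'a::euclidean_space \<Rightarrow> 'b::euclidean_space"
  assumes "S \<in> sets lebesgue"
  shows "integrable (lebesgue_on S) f \<longleftrightarrow> f absolutely_integrable_on S"
  using assms by (simp add: integrable_restrict_space set_integrable_def)

context cuboid_domain
begin

lemma domain_sets: "\<Omega> \<in> sets lebesgue"
  using open_domain by (simp add: borel_open)

lemma negligible_skeleton: "negligible (\<Omega> - (\<Union>E\<in>T. interior (cell E)))"
proof (rule negligible_subset)
  show "negligible (\<Union>E\<in>T. cell E - interior (cell E))"
    using finite_mesh negligible_cell_boundary by (intro negligible_Union) auto
  show "\<Omega> - (\<Union>E\<in>T. interior (cell E)) \<subseteq> (\<Union>E\<in>T. cell E - interior (cell E))"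
    using mesh_cover closure_subset by blast
qed

text \<open>The cell boundaries form a null set, so the values inside the elements decide about
  integrability and the integral.\<close>

lemma integral_mesh:
  fixes h :: "real^3 \<Rightarrow> 'b::euclidean_space"
  assumes k: "\<And>E. E \<in> T \<Longrightarrow> k E absolutely_integrable_on interior (cell E)"
    and h: "\<And>E x. E \<in> T \<Longrightarrow> x \<in> interior (cell E) \<Longrightarrow> h x = k E x"
  shows "integrable (lebesgue_on \<Omega>) h"
    and "integral\<^sup>L (lebesgue_on \<Omega>) h = (\<Sum>E\<in>T. integral (interior (cell E)) (k E))"
proof -
  let ?k = "\<lambda>E x. if x \<in> interior (cell E) then k E x else 0"
  let ?h = "\<lambda>x. if x \<in> \<Omega> then h x else 0"
  have int: "?k E absolutely_integrable_on UNIV" if "E \<in> T" for E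
    using k[OF that] by (simp add: absolutely_integrable_restrict_UNIV)
  have ai: "(\<lambda>x. \<Sum>E\<in>T. ?k E x) absolutely_integrable_on UNIV"
    using finite_mesh int by (intro absolutely_integrable_sum) auto
  have eq: "?h x = (\<Sum>E\<in>T. ?k E x)" if "x \<in> UNIV - (\<Omega> - (\<Union>E\<in>T. interior (cell E)))" for x
  proof (cases "x \<in> (\<Union>E\<in>T. interior (cell E))")
    case True
    then obtain E where E: "E \<in> T" "x \<in> interior (cell E)" by blast
    have "?k E' x = (if E' = E then k E x else 0)" if "E' \<in> T" for E'
      using mesh_disjoint[OF E(1) that] E by auto
    then have "(\<Sum>E\<in>T. ?k E x) = (\<Sum>E'\<in>T. if E' = E then k E x else 0)" by (rule sum.cong[OF refl])
    also have "\<dots> = k E x" using E finite_mesh by simp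
    finally show ?thesis using h[OF E] E interior_subset_domain by auto
  next
    case False
    then have "x \<notin> \<Omega>" using that by blast
    moreover have "(\<Sum>E\<in>T. ?k E x) = 0" using False by (intro sum.neutral) auto
    ultimately show ?thesis by simp
  qed
  have "?h absolutely_integrable_on UNIV"
    by (rule absolutely_integrable_spike[OF ai negligible_skeleton eq])
  then have "h absolutely_integrable_on \<Omega>" by (simp add: absolutely_integrable_restrict_UNIV)
  then show int_h: "integrable (lebesgue_on \<Omega>) h" by (simp add: integrable_lebesgue_on_iff domain_sets)
  have "integral\<^sup>L (lebesgue_on \<Omega>) h = integral UNIV ?h"
    by (simp add: lebesgue_integral_eq_integral[OF int_h domain_sets] integral_restrict_UNIV)
  also have "\<dots> = integral UNIV (\<lambda>x. \<Sum>E\<in>T. ?k E x)"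
    by (rule integral_spike[OF negligible_skeleton]) (use eq in simp)
  also have "\<dots> = (\<Sum>E\<in>T. integral UNIV (?k E))"
    using int by (intro integral_sum finite_mesh) (auto simp: absolutely_integrable_on_def)
  finally show "integral\<^sup>L (lebesgue_on \<Omega>) h = (\<Sum>E\<in>T. integral (interior (cell E)) (k E))"
    by (simp add: integral_restrict_UNIV)
qed

lemma integral_interior_cell:
  fixes g :: "real^3 \<Rightarrow> real"
  assumes E: "E \<in> T" and g: "continuous_on (cell E) g"
  shows "g absolutely_integrable_on interior (cell E)"
    "integral (interior (cell E)) g = \<bar>det (jac E)\<bar> * integral ref_cube (\<lambda>x. g (ref_map E x))"
proof -
  note cE = mesh_cuboid[OF E]
  have n: "negligible {x \<in> interior (cell E) - cell E. g x \<noteq> 0}" "negligible {x \<in> cell E - interior (cell E). g x \<noteq> 0}"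
    using interior_subset[of "cell E"] by (auto intro: negligible_subset[OF negligible_cell_boundary[of E]] simp: Diff_eq_empty_iff[THEN iffD2])
  then show "g absolutely_integrable_on interior (cell E)"
    using integral_cell(1)[OF cE g] absolutely_integrable_spike_set_eq by blast
  show "integral (interior (cell E)) g = \<bar>det (jac E)\<bar> * integral ref_cube (\<lambda>x. g (ref_map E x))"
    using integral_spike_set[OF n] integral_cell(2)[OF cE g] by simp
qed

lemma integral_mesh_continuous:
  fixes h :: "real^3 \<Rightarrow> real"
  assumes g: "\<And>E. E \<in> T \<Longrightarrow> continuous_on (cell E) (g E)"
    and h: "\<And>E x. E \<in> T \<Longrightarrow> x \<in> interior (cell E) \<Longrightarrow> h x = g E x"
  shows "integrable (lebesgue_on \<Omega>) h"
    and "integral\<^sup>L (lebesgue_on \<Omega>) h = (\<Sum>E\<in>T. \<bar>det (jac E)\<bar> * integral ref_cube (\<lambda>x. g E (ref_map E x)))"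
  using integral_mesh[OF integral_interior_cell(1)[OF _ g] h] integral_interior_cell(2)[OF _ g]
  by simp_all

end

section \<open>Piecewise fields and the weak divergence\<close>

text \<open>The Piola transform of \<open>X_space\<close> written row by row, which removes the
  transpositions; see \<open>piola_iff\<close>.\<close>

definition piola :: "cuboid \<Rightarrow> (real^3 \<Rightarrow> real^3^3) \<Rightarrow> real^3 \<Rightarrow> real^3^3" where
  "piola E \<tau> x = (\<chi> i. (1 / \<bar>det (jac E)\<bar>) *\<^sub>R (jac E *v \<tau> x $ i))"

lemma piola_iff: "transpose A = (1 / \<bar>det (jac E)\<bar>) *\<^sub>R (jac E ** transpose (\<tau> x)) \<longleftrightarrow> A = piola E \<tau> x"
proof -
  have "transpose A = (1 / \<bar>det (jac E)\<bar>) *\<^sub>R (jac E ** transpose (\<tau> x)) \<longleftrightarrow>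
    (\<forall>k i. A $ i $ k = (piola E \<tau> x) $ i $ k)"
    by (simp add: vec_eq_iff transpose_def piola_def matrix_matrix_mult_def matrix_vector_mult_def mult.commute)
  then show ?thesis by (auto simp: vec_eq_iff)
qed

definition is_hat :: "cuboid \<Rightarrow> (real^3 \<Rightarrow> real^3^3) \<Rightarrow> (real^3 \<Rightarrow> real^3^3) \<Rightarrow> bool" where
  "is_hat E \<tau> th \<longleftrightarrow> (\<forall>i. (\<lambda>x. th x $ i) \<in> ERT0) \<and> (\<forall>x\<in>interior ref_cube. \<tau> (ref_map E x) = piola E th x)"

lemma row_eq_nth: "row i A = A $ i"
  by (simp add: row_def vec_eq_iff)

lemma X_space_iff:
  "\<tau> \<in> X_space \<Omega> \<Gamma>N T \<longleftrightarrow> L2_on \<Omega> \<tau> \<and> (\<exists>d. has_L2_div \<Omega> \<tau> d) \<and> (\<forall>E\<in>T. \<exists>th. is_hat E \<tau> th) \<and>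
     (\<forall>E\<in>T. \<forall>j. \<forall>s\<in>{0, 1}. face E j s \<subseteq> \<Gamma>N \<longrightarrow> (\<forall>x\<in>face E j s. trace_from E \<tau> x *v normal E j s = 0))"
  unfolding X_space_def mem_Collect_eq row_eq_nth piola_iff is_hat_def ..

lemma is_hat_continuous:
  assumes "\<And>i. (\<lambda>x. th x $ i) \<in> ERT0"
  shows "continuous_on A (\<lambda>y. piola E th (ref_coord E y))"
proof -
  have "continuous_on UNIV (\<lambda>x. piola E th x)"
    unfolding piola_def
    by (intro continuous_on_vec_lambda continuous_intros linear_continuous_on_compose[OF ERT0_continuous[OF assms]]
        matrix_vector_mul_linear)
  from continuous_on_compose2[OF this continuous_ref_coord subset_UNIV] show ?thesis .
qed

lemma is_hat_trace:
  assumes E: "is_cuboid E" and th: "is_hat E \<tau> th" and x: "x \<in> ref_cube"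
  shows "trace_from E \<tau> (ref_map E x) = piola E th x"
proof -
  have "trace_from E \<tau> (ref_map E x) = piola E th (ref_coord E (ref_map E x))"
  proof (rule trace_from_eq[OF E])
    show "continuous_on (cell E) (\<lambda>y. piola E th (ref_coord E y))"
      using th by (intro is_hat_continuous) (simp add: is_hat_def)
    show "\<tau> y = piola E th (ref_coord E y)" if "y \<in> interior (cell E)" for y
      using that th E by (auto simp: interior_cell is_hat_def)
  qed (use E x in simp)
  then show ?thesis using E by simp
qed

context cuboid_domain
begin

text \<open>After summation of the element formulas the face terms collect the jumps of normal
  components, and the rest pairs \<phi> with a function that is constant on each element. The
  determinants of the Piola map and of the change of variables cancel.\<close>

lemma integral_grad:
  assumes th: "\<And>E. E \<in> T \<Longrightarrow> is_hat E \<tau> (th E)" and \<phi>: "test_function \<Omega> \<phi>"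
  shows "integrable (lebesgue_on \<Omega>) (\<lambda>x. \<tau> x $ i \<bullet> grad \<phi> x)"
    "(LINT x|lebesgue_on \<Omega>. \<tau> x $ i \<bullet> grad \<phi> x) = (\<Sum>E\<in>T.
      (\<Sum>S\<in>UNIV. \<Sum>j\<in>UNIV. vsign S j * th E (vert S) $ i $ j * face_integral E S j \<phi>) -
      (\<Sum>S\<in>UNIV. \<Sum>j\<in>UNIV. vsign S j / 4 * th E (vert S) $ i $ j) * integral ref_cube (\<lambda>x. \<phi> (ref_map E x)))"
proof -
  let ?g = "\<lambda>E y. piola E (th E) (ref_coord E y) $ i \<bullet> grad \<phi> y"
  have c: "continuous_on (cell E) (?g E)" if "E \<in> T" for E
    using th[OF that] by (intro continuous_intros is_hat_continuous test_function_C1[OF \<phi>]) (simp add: is_hat_def)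
  have eq: "\<tau> x $ i \<bullet> grad \<phi> x = ?g E x" if "E \<in> T" "x \<in> interior (cell E)" for E x
    using that th[OF that(1)] mesh_cuboid[OF that(1)] by (auto simp: interior_cell is_hat_def)
  show "integrable (lebesgue_on \<Omega>) (\<lambda>x. \<tau> x $ i \<bullet> grad \<phi> x)"
    by (rule integral_mesh_continuous(1)[OF c eq])
  have "(LINT x|lebesgue_on \<Omega>. \<tau> x $ i \<bullet> grad \<phi> x) =
      (\<Sum>E\<in>T. \<bar>det (jac E)\<bar> * integral ref_cube (\<lambda>x. ?g E (ref_map E x)))"
    by (rule integral_mesh_continuous(2)[OF c eq])
  also have "\<dots> = (\<Sum>E\<in>T. integral ref_cube (\<lambda>x. (jac E *v th E x $ i) \<bullet> grad \<phi> (ref_map E x)))"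
  proof (rule sum.cong[OF refl])
    fix E assume "E \<in> T"
    note cE = mesh_cuboid[OF this]
    have "\<bar>det (jac E)\<bar> * ?g E (ref_map E x) = (jac E *v th E x $ i) \<bullet> grad \<phi> (ref_map E x)" for x
      using det_jac[OF cE] cE by (simp add: piola_def)
    then show "\<bar>det (jac E)\<bar> * integral ref_cube (\<lambda>x. ?g E (ref_map E x)) =
      integral ref_cube (\<lambda>x. (jac E *v th E x $ i) \<bullet> grad \<phi> (ref_map E x))"
      unfolding integral_mult_right[symmetric] by simp
  qed
  also have "\<dots> = (\<Sum>E\<in>T.
      (\<Sum>S\<in>UNIV. \<Sum>j\<in>UNIV. vsign S j * th E (vert S) $ i $ j * face_integral E S j \<phi>) -
      (\<Sum>S\<in>UNIV. \<Sum>j\<in>UNIV. vsign S j / 4 * th E (vert S) $ i $ j) * integral ref_cube (\<lambda>x. \<phi> (ref_map E x)))"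
    by (intro sum.cong refl integral_ref_cube_ERT0[OF _ \<phi>]) (use th in \<open>simp add: is_hat_def\<close>)
  finally show "(LINT x|lebesgue_on \<Omega>. \<tau> x $ i \<bullet> grad \<phi> x) = \<dots>" .
qed

end

lemma integrable_vec:
  fixes f :: "'a \<Rightarrow> real^3"
  assumes "\<And>i. integrable M (\<lambda>x. f x $ i)" shows "integrable M f"
proof -
  have "f = (\<lambda>x. \<Sum>i\<in>UNIV. f x $ i *\<^sub>R axis i 1)"
    by (simp add: fun_eq_iff vec_eq_iff axis_def if_distrib cong: if_cong)
  moreover have "integrable M (\<lambda>x. \<Sum>i\<in>UNIV. f x $ i *\<^sub>R axis i (1::real))"
    using assms by (intro Bochner_Integration.integrable_sum integrable_scaleR_left) auto
  ultimately show ?thesis by simp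
qed

lemma integral_vec_nth:
  fixes f :: "'a \<Rightarrow> real^3"
  assumes "integrable M f" shows "integral\<^sup>L M f $ i = (LINT x|M. f x $ i)"
  using integral_bounded_linear[OF bounded_linear_vec_nth assms, of i] by simp

text \<open>The constant reference divergence of each row, by \<open>ERT0_divergence\<close>; after
  the Piola map it is the integral of the divergence over the element.\<close>

definition hat_div :: "(real^3 \<Rightarrow> real^3^3) \<Rightarrow> real^3" where
  "hat_div th = (\<chi> i. \<Sum>S\<in>UNIV. \<Sum>j\<in>UNIV. vsign S j / 4 * th (vert S) $ i $ j)"

context cuboid_domain
begin

lemma finite_measure_domain: "finite_measure (lebesgue_on \<Omega>)"
  by (intro finite_measure_lebesgue_on lmeasurable_open bounded_domain open_domain)

lemma L2_on_integrable:
  fixes f :: "real^3 \<Rightarrow> 'b::euclidean_space"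
  assumes "L2_on \<Omega> f" shows "integrable (lebesgue_on \<Omega>) f"
proof (rule Bochner_Integration.integrable_bound)
  interpret finite_measure "lebesgue_on \<Omega>" by (rule finite_measure_domain)
  show "integrable (lebesgue_on \<Omega>) (\<lambda>x. 1 + (norm (f x))\<^sup>2)"
    using assms by (auto simp: L2_on_def)
  show "f \<in> borel_measurable (lebesgue_on \<Omega>)" using assms by (simp add: L2_on_def)
  have "norm a \<le> 1 + (norm a)\<^sup>2" for a :: 'b
    using zero_le_power2[of "norm a - 1/2"] by (simp add: power2_diff field_simps)
  then show "AE x in lebesgue_on \<Omega>. norm (f x) \<le> norm (1 + (norm (f x))\<^sup>2)" by simp
qed

lemma L2_on_nth_integrable:
  fixes d :: "real^3 \<Rightarrow> real^3"
  assumes "L2_on \<Omega> d" shows "integrable (lebesgue_on \<Omega>) (\<lambda>x. d x $ i)"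
  using integrable_bounded_linear[OF bounded_linear_vec_nth L2_on_integrable[OF assms]] .

lemma L2_on_piecewise_continuous:
  fixes f :: "real^3 \<Rightarrow> 'b::euclidean_space"
  assumes g: "\<And>E. E \<in> T \<Longrightarrow> continuous_on (cell E) (g E)"
    and f: "\<And>E x. E \<in> T \<Longrightarrow> x \<in> interior (cell E) \<Longrightarrow> f x = g E x"
  shows "L2_on \<Omega> f"
  unfolding L2_on_def
proof
  show "f \<in> borel_measurable (lebesgue_on \<Omega>)"
  proof (rule borel_measurable_euclidean_space[THEN iffD2], rule ballI)
    fix b :: 'b
    have "integrable (lebesgue_on \<Omega>) (\<lambda>x. f x \<bullet> b)"
      by (rule integral_mesh_continuous(1)[where g = "\<lambda>E x. g E x \<bullet> b"]) (auto intro!: continuous_intros g simp: f)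
    then show "(\<lambda>x. f x \<bullet> b) \<in> borel_measurable (lebesgue_on \<Omega>)" by (rule borel_measurable_integrable)
  qed
  show "integrable (lebesgue_on \<Omega>) (\<lambda>x. (norm (f x))\<^sup>2)"
    by (rule integral_mesh_continuous(1)[where g = "\<lambda>E x. (norm (g E x))\<^sup>2"]) (auto intro!: continuous_intros g simp: f)
qed

lemma interior_cell_unique:
  "E \<in> T \<Longrightarrow> E' \<in> T \<Longrightarrow> x \<in> interior (cell E) \<Longrightarrow> x \<in> interior (cell E') \<longleftrightarrow> E' = E"
  using mesh_disjoint by blast

text \<open>A sum instead of a choice of the element that contains \<open>x\<close>; interiors are
  disjoint, so at most one summand is active.\<close>

definition glue :: "(cuboid \<Rightarrow> real^3 \<Rightarrow> 'b) \<Rightarrow> real^3 \<Rightarrow> 'b::real_vector" where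
  "glue g x = (\<Sum>E\<in>T. if x \<in> interior (cell E) then g E x else 0)"

lemma glue_eq:
  assumes "E \<in> T" "x \<in> interior (cell E)" shows "glue g x = g E x"
proof -
  have "glue g x = (\<Sum>E'\<in>T. if E' = E then g E x else 0)"
    unfolding glue_def using interior_cell_unique[OF assms(1) _ assms(2)] by (intro sum.cong) auto
  then show ?thesis using assms finite_mesh by simp
qed

text \<open>If the face terms cancel for every test function, the glued field has a piecewise
  constant distributional divergence; normal components that vanish at the vertices of a face vanish
  on all of it by interpolation. Membership in \<open>X_space\<close> thus becomes a condition on
  vertex data.\<close>

lemma X_space_construct:
  fixes t :: "cuboid \<Rightarrow> 3 set \<Rightarrow> 3 \<Rightarrow> 3 \<Rightarrow> real"
  assumes flux: "\<And>\<phi> i. test_function \<Omega> \<phi> \<Longrightarrow>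
      (\<Sum>E\<in>T. \<Sum>S\<in>UNIV. \<Sum>j\<in>UNIV. vsign S j * t E S i j * face_integral E S j \<phi>) = 0"
    and N: "\<And>E j S i. E \<in> T \<Longrightarrow> face E j (of_bool (j \<in> S)) \<subseteq> \<Gamma>N \<Longrightarrow> t E S i j = 0"
  obtains \<tau> th where "\<tau> \<in> X_space \<Omega> \<Gamma>N T" "\<And>E. E \<in> T \<Longrightarrow> is_hat E \<tau> (th E)"
    "\<And>E S i j. th E (vert S) $ i $ j = t E S i j"
proof -
  have "\<forall>E i. \<exists>v\<in>ERT0. \<forall>S. v (vert S) = (\<chi> j. t E S i j)"
    by (intro allI ERT0_prescribed_vertex_values)
  then obtain v where v: "\<And>E i. v E i \<in> ERT0" "\<And>E i S. v E i (vert S) = (\<chi> j. t E S i j)" by metis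
  define th where "th E x = (\<chi> i. v E i x)" for E x
  have thE: "(\<lambda>x. th E x $ i) \<in> ERT0" for E i using v(1)[of E i] by (simp add: th_def)
  have tht: "th E (vert S) $ i $ j = t E S i j" for E S i j by (simp add: th_def v(2))
  define \<tau> where "\<tau> = glue (\<lambda>E y. piola E (th E) (ref_coord E y))"
  have hat: "is_hat E \<tau> (th E)" if E: "E \<in> T" for E
    unfolding is_hat_def
  proof (intro conjI allI ballI thE)
    fix x :: "real^3" assume "x \<in> interior ref_cube"
    then have m: "ref_map E x \<in> interior (cell E)" using mesh_cuboid[OF E] by (simp add: interior_cell)
    show "\<tau> (ref_map E x) = piola E (th E) x"
      unfolding \<tau>_def glue_eq[OF E m] using mesh_cuboid[OF E] by simp
  qed
  \<comment> \<open>The divergence of a Piola transform is the reference divergence divided by the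
    absolute determinant.\<close>
  define D where "D E = (1 / \<bar>det (jac E)\<bar>) *\<^sub>R hat_div (th E)" for E
  define d where "d = glue (\<lambda>E _. D E)"
  have L2\<tau>: "L2_on \<Omega> \<tau>"
    by (rule L2_on_piecewise_continuous[OF is_hat_continuous[OF thE]]) (simp add: \<tau>_def glue_eq)
  have L2d: "L2_on \<Omega> d"
    by (rule L2_on_piecewise_continuous[where g = "\<lambda>E _. D E"]) (simp_all add: d_def glue_eq)
  have "has_L2_div \<Omega> \<tau> d"
    unfolding has_L2_div_def
  proof (intro conjI L2d allI impI)
    fix \<phi> assume \<phi>: "test_function \<Omega> \<phi>"
    note grad = integral_grad[OF hat \<phi>]
    let ?I = "\<lambda>E. integral ref_cube (\<lambda>x. \<phi> (ref_map E x))"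
    have d: "integrable (lebesgue_on \<Omega>) (\<lambda>x. \<phi> x * d x $ i)"
      "(LINT x|lebesgue_on \<Omega>. \<phi> x * d x $ i) = (\<Sum>E\<in>T. \<bar>det (jac E)\<bar> * integral ref_cube (\<lambda>x. \<phi> (ref_map E x) * D E $ i))" for i
      by (rule integral_mesh_continuous[where g = "\<lambda>E x. \<phi> x * D E $ i"];
          (intro continuous_intros test_function_C1[OF \<phi>] | simp add: d_def glue_eq))+
    have int1: "integrable (lebesgue_on \<Omega>) (\<lambda>x. \<tau> x *v grad \<phi> x)"
      by (rule integrable_vec) (simp add: matrix_vector_mul_component grad(1))
    have int2: "integrable (lebesgue_on \<Omega>) (\<lambda>x. \<phi> x *\<^sub>R d x)"
      by (rule integrable_vec) (simp add: d(1))
    show "(LINT x|lebesgue_on \<Omega>. \<tau> x *v grad \<phi> x) = - (LINT x|lebesgue_on \<Omega>. \<phi> x *\<^sub>R d x)"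
    proof (rule vec_eq_iff[THEN iffD2], rule allI)
      fix i
      have "(LINT x|lebesgue_on \<Omega>. \<tau> x *v grad \<phi> x) $ i = (LINT x|lebesgue_on \<Omega>. \<tau> x $ i \<bullet> grad \<phi> x)"
        by (simp add: integral_vec_nth[OF int1] matrix_vector_mul_component)
      also have "\<dots> = - (\<Sum>E\<in>T. hat_div (th E) $ i * ?I E)"
        by (subst grad(2), assumption) (simp add: sum_subtractf tht flux[OF \<phi>] hat_div_def)
      also have "(\<Sum>E\<in>T. hat_div (th E) $ i * ?I E) = (LINT x|lebesgue_on \<Omega>. \<phi> x * d x $ i)"
        unfolding d(2) by (intro sum.cong refl) (use det_jac mesh_cuboid in \<open>auto simp: D_def\<close>)
      also have "\<dots> = (LINT x|lebesgue_on \<Omega>. \<phi> x *\<^sub>R d x) $ i"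
        by (simp add: integral_vec_nth[OF int2])
      finally show "(LINT x|lebesgue_on \<Omega>. \<tau> x *v grad \<phi> x) $ i = (- (LINT x|lebesgue_on \<Omega>. \<phi> x *\<^sub>R d x)) $ i"
        by simp
    qed
  qed
  moreover have "trace_from E \<tau> y *v normal E j s = 0"
    if E: "E \<in> T" and s: "s \<in> {0, 1}" and N': "face E j s \<subseteq> \<Gamma>N" and y: "y \<in> face E j s" for E j s y
  proof -
    note cE = mesh_cuboid[OF E]
    obtain x where x: "y = ref_map E x" "x \<in> ref_cube" "x $ j = s" using y by (auto simp: face_def)
    have z: "th E x $ i $ j = 0" for i
    proof -
      have "th E x $ i $ j = (\<Sum>S\<in>UNIV. shape S x * th E (vert S) $ i $ j)"
        by (rule ERT0_face[OF thE, of _ _ "if s = 1 then UNIV else {}"]) (use x s in auto)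
      also have "\<dots> = 0"
      proof (intro sum.neutral ballI)
        fix S :: "3 set"
        show "shape S x * th E (vert S) $ i $ j = 0"
        proof (cases "s = of_bool (j \<in> S)")
          case True
          then show ?thesis using N[OF E, of j S i] N' by (simp add: tht)
        next
          case False
          then have "shape S x = 0" unfolding shape_def
            using x(3) s by (intro prod_zero) (auto intro!: bexI[of _ j])
          then show ?thesis by simp
        qed
      qed
      finally show ?thesis .
    qed
    have n: "column k (jac E) \<bullet> normal E j s = 0" if "k \<noteq> j" for k
      using cuboid_column(2)[OF cE that] by (simp add: normal_def sgn_div_norm)
    have "(jac E *v th E x $ i) \<bullet> normal E j s = 0" for i
    proof -
      have "jac E *v th E x $ i = (\<Sum>k\<in>UNIV. th E x $ i $ k *\<^sub>R column k (jac E))"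
        by (simp add: matrix_mult_sum scalar_mult_eq_scaleR)
      moreover have "th E x $ i $ k * (column k (jac E) \<bullet> normal E j s) = 0" for k
        using z n by (cases "k = j") simp_all
      ultimately show ?thesis by (simp only: inner_sum_left inner_scaleR_left sum.neutral_const)
    qed
    then have "(piola E (th E) x *v normal E j s) $ i = 0" for i
      by (simp add: piola_def matrix_vector_mul_component)
    then show ?thesis unfolding x(1) is_hat_trace[OF cE hat[OF E] x(2)] by (simp add: vec_eq_iff)
  qed
  ultimately have "\<tau> \<in> X_space \<Omega> \<Gamma>N T" unfolding X_space_iff using L2\<tau> hat by blast
  then show ?thesis using that hat tht by blast
qed

text \<open>\<open>d\<close> is an arbitrary representative, so its cell integral is obtained by
  testing with \<open>cell_bump\<close>. These functions vanish on all faces and on the other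
  elements and tend to the indicator function of the interior; dominated convergence applies on both
  sides.\<close>

lemma integral_weak_div:
  assumes E: "E \<in> T" and th: "\<And>E. E \<in> T \<Longrightarrow> is_hat E \<tau> (th E)" and d: "has_L2_div \<Omega> \<tau> d"
  shows "integral (interior (cell E)) (\<lambda>x. d x $ i) = hat_div (th E) $ i"
proof -
  note cE = mesh_cuboid[OF E]
  let ?\<phi> = "cell_bump E" and ?C = "interior (cell E)"
  note \<phi> = cell_bump_test_function[OF cE interior_subset_domain[OF E]]
  have L2d: "L2_on \<Omega> d" using d by (simp add: has_L2_div_def)
  note id = L2_on_nth_integrable[OF L2d]
  have zero: "?\<phi> n (ref_map E' y) = 0" if E': "E' \<in> T" "y \<in> ref_cube" "E' \<noteq> E \<or> (\<exists>j. y $ j = 0 \<or> y $ j = 1)" for E' n y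
  proof (rule ccontr)
    assume "?\<phi> n (ref_map E' y) \<noteq> 0"
    then have i: "ref_map E' y \<in> ?C" by (rule \<phi>(2))
    have "ref_map E' y \<in> cell E'" using E' mesh_cuboid by simp
    then have "E' = E" using i mesh_interior_cell_disjoint[OF E E'(1)] by blast
    moreover have "\<forall>j. 0 < y $ j \<and> y $ j < 1" using i calculation cE by (simp add: ref_map_in_interior)
    ultimately show False using E'(3) by (metis less_irrefl)
  qed
  have face0: "face_integral E' S j (?\<phi> n) = 0" if "E' \<in> T" for E' S j n
  proof -
    have "set_coord j (vert S $ j) x \<in> ref_cube" if "x \<in> ref_cube" for x
    proof -
      have "set_coord j (x $ j) x = x" by (simp add: vec_eq_iff)
      then show ?thesis using set_coord_ref_cube[of j "x $ j" x "vert S $ j"] that by auto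
    qed
    note cube = this
    have "?\<phi> n (ref_map E' (set_coord j (vert S $ j) x)) = 0" if "x \<in> ref_cube" for x
    proof (rule zero[OF \<open>E' \<in> T\<close>])
      show "set_coord j (vert S $ j) x \<in> ref_cube" by (rule cube[OF that])
      show "E' \<noteq> E \<or> (\<exists>k. set_coord j (vert S $ j) x $ k = 0 \<or> set_coord j (vert S $ j) x $ k = 1)"
        by (rule disjI2, rule exI[of _ j]) simp
    qed
    then have "face_integral E' S j (?\<phi> n) = integral ref_cube (\<lambda>x. 0)"
      unfolding face_integral_def Let_def by (intro integral_cong) simp
    then show ?thesis by simp
  qed
  define c where "c n = integral ref_cube (\<lambda>x. ?\<phi> n (ref_map E x))" for n
  have eq: "(LINT x|lebesgue_on \<Omega>. ?\<phi> n x * d x $ i) = hat_div (th E) $ i * c n" for n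
  proof -
    have bd: "integrable (lebesgue_on \<Omega>) (\<lambda>x. ?\<phi> n x * d x $ j)" for j
    proof (rule Bochner_Integration.integrable_bound[OF id[of j]])
      show "(\<lambda>x. ?\<phi> n x * d x $ j) \<in> borel_measurable (lebesgue_on \<Omega>)"
        using continuous_imp_measurable_on_sets_lebesgue[OF test_function_C1(2)[OF \<phi>(1)] domain_sets] id
        by (intro borel_measurable_times) auto
      show "AE x in lebesgue_on \<Omega>. norm (?\<phi> n x * d x $ j) \<le> norm (d x $ j)"
        using cell_bump_bounds[of E n] by (simp add: abs_mult mult_left_le_one_le)
    qed
    have int1: "integrable (lebesgue_on \<Omega>) (\<lambda>x. \<tau> x *v grad (?\<phi> n) x)"
      by (rule integrable_vec) (simp add: matrix_vector_mul_component integral_grad(1)[OF th \<phi>(1)])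
    have int2: "integrable (lebesgue_on \<Omega>) (\<lambda>x. ?\<phi> n x *\<^sub>R d x)"
      by (rule integrable_vec) (simp add: bd)
    have "(LINT x|lebesgue_on \<Omega>. ?\<phi> n x * d x $ i) = (LINT x|lebesgue_on \<Omega>. ?\<phi> n x *\<^sub>R d x) $ i"
      by (simp add: integral_vec_nth[OF int2])
    also have "\<dots> = - (LINT x|lebesgue_on \<Omega>. \<tau> x *v grad (?\<phi> n) x) $ i"
      using d \<phi>(1)[of n] by (simp add: has_L2_div_def)
    also have "\<dots> = - (LINT x|lebesgue_on \<Omega>. \<tau> x $ i \<bullet> grad (?\<phi> n) x)"
      by (simp add: integral_vec_nth[OF int1] matrix_vector_mul_component)
    also have "(LINT x|lebesgue_on \<Omega>. \<tau> x $ i \<bullet> grad (?\<phi> n) x) =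
        (\<Sum>E'\<in>T. - (hat_div (th E') $ i * integral ref_cube (\<lambda>x. ?\<phi> n (ref_map E' x))))"
      by (subst integral_grad(2)[OF th \<phi>(1)], assumption, intro sum.cong refl) (simp add: face0 hat_div_def)
    also have "- \<dots> = (\<Sum>E'\<in>T. hat_div (th E') $ i * integral ref_cube (\<lambda>x. ?\<phi> n (ref_map E' x)))"
      by (simp add: sum_negf)
    also have "\<dots> = (\<Sum>E'\<in>T. if E' = E then hat_div (th E) $ i * c n else 0)"
    proof (rule sum.cong[OF refl])
      fix E' assume E': "E' \<in> T"
      have "integral ref_cube (\<lambda>x. ?\<phi> n (ref_map E' x)) = integral ref_cube (\<lambda>x. 0)" if "E' \<noteq> E"
        using zero[OF E'] that by (intro integral_cong) auto
      then show "hat_div (th E') $ i * integral ref_cube (\<lambda>x. ?\<phi> n (ref_map E' x)) = (if E' = E then hat_div (th E) $ i * c n else 0)"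
        by (auto simp: c_def)
    qed
    also have "\<dots> = hat_div (th E) $ i * c n" using E finite_mesh by simp
    finally show ?thesis .
  qed
  have lim: "(\<lambda>n. ?\<phi> n x) \<longlonglongrightarrow> (if x \<in> ?C then 1 else 0)" for x
  proof (cases "x \<in> ?C")
    case True then show ?thesis using cell_bump_tendsto[OF cE] by simp
  next
    case False
    then have "?\<phi> n x = 0" for n using \<phi>(2) by blast
    then show ?thesis using False by simp
  qed
  have "c \<longlonglongrightarrow> integral ref_cube (\<lambda>x. if ref_map E x \<in> ?C then 1 else 0)"
    unfolding c_def
  proof (rule dominated_convergence(2))
    show "(\<lambda>x. ?\<phi> n (ref_map E x)) integrable_on ref_cube" for n
      unfolding ref_cube_cbox
      by (intro integrable_continuous continuous_on_compose2[OF test_function_C1(2)[OF \<phi>(1)] continuous_ref_map subset_UNIV])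
    show "(\<lambda>x. 1::real) integrable_on ref_cube" unfolding ref_cube_cbox by (rule integrable_const)
    show "norm (?\<phi> n (ref_map E x)) \<le> 1" for n x using cell_bump_bounds[of E n] by simp
    show "(\<lambda>n. ?\<phi> n (ref_map E x)) \<longlonglongrightarrow> (if ref_map E x \<in> ?C then 1 else 0)" for x by (rule lim)
  qed
  moreover have "integral ref_cube (\<lambda>x. if ref_map E x \<in> ?C then 1 else 0) = (1::real)"
  proof -
    have "integral ref_cube (\<lambda>x. if ref_map E x \<in> ?C then 1 else 0) = integral ref_cube (\<lambda>x. 1::real)"
    proof (rule integral_spike)
      show "negligible (ref_cube - interior ref_cube)"
        using negligible_convex_frontier[OF convex_ref_cube] compact_imp_closed[OF compact_ref_cube]
        by (simp add: frontier_def)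
      show "1 = (if ref_map E x \<in> ?C then 1 else 0)" if "x \<in> ref_cube - (ref_cube - interior ref_cube)" for x
        using that cE by (simp add: interior_cell ref_map_image)
    qed
    also have "\<dots> = 1"
    proof -
      have "cbox (0::real^3) 1 \<noteq> {}" by (auto simp: interval_ne_empty_cart)
      then show ?thesis by (simp add: ref_cube_cbox content_cbox_cart)
    qed
    finally show ?thesis .
  qed
  ultimately have "(\<lambda>n. hat_div (th E) $ i * c n) \<longlonglongrightarrow> hat_div (th E) $ i * 1"
    by (intro tendsto_mult tendsto_const) simp
  moreover have "(\<lambda>n. LINT x|lebesgue_on \<Omega>. ?\<phi> n x * d x $ i) \<longlonglongrightarrow>
      (LINT x|lebesgue_on \<Omega>. (if x \<in> ?C then 1 else 0) * d x $ i)"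
  proof (rule integral_dominated_convergence)
    show "integrable (lebesgue_on \<Omega>) (\<lambda>x. \<bar>d x $ i\<bar>)" using id by (rule integrable_abs)
    have m\<phi>: "?\<phi> n \<in> borel_measurable (lebesgue_on \<Omega>)" for n
      using continuous_imp_measurable_on_sets_lebesgue[OF test_function_C1(2)[OF \<phi>(1)] domain_sets] .
    have md: "(\<lambda>x. d x $ i) \<in> borel_measurable (lebesgue_on \<Omega>)" using id by auto
    show "(\<lambda>x. ?\<phi> n x * d x $ i) \<in> borel_measurable (lebesgue_on \<Omega>)" for n
      by (rule borel_measurable_times[OF m\<phi> md])
    have "(\<lambda>x. if x \<in> ?C then 1 else 0::real) \<in> borel_measurable (lebesgue_on \<Omega>)"
      by (rule borel_measurable_LIMSEQ_real[OF lim m\<phi>])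
    then show "(\<lambda>x. (if x \<in> ?C then 1 else 0) * d x $ i) \<in> borel_measurable (lebesgue_on \<Omega>)"
      by (rule borel_measurable_times[OF _ md])
    show "AE x in lebesgue_on \<Omega>. (\<lambda>n. ?\<phi> n x * d x $ i) \<longlonglongrightarrow> (if x \<in> ?C then 1 else 0) * d x $ i"
      by (intro AE_I2 tendsto_mult lim tendsto_const)
    show "AE x in lebesgue_on \<Omega>. norm (?\<phi> n x * d x $ i) \<le> \<bar>d x $ i\<bar>" for n
      using cell_bump_bounds[of E n] by (simp add: abs_mult mult_left_le_one_le)
  qed
  ultimately have "hat_div (th E) $ i = (LINT x|lebesgue_on \<Omega>. (if x \<in> ?C then 1 else 0) * d x $ i)"
    unfolding eq using LIMSEQ_unique by fastforce
  also have "\<dots> = integral \<Omega> (\<lambda>x. if x \<in> ?C then d x $ i else 0)"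
  proof -
    have "integrable (lebesgue_on \<Omega>) (\<lambda>x. (if x \<in> ?C then 1 else 0) * d x $ i)"
    proof (rule Bochner_Integration.integrable_bound[OF id[of i]])
      have m\<phi>: "?\<phi> n \<in> borel_measurable (lebesgue_on \<Omega>)" for n
        using continuous_imp_measurable_on_sets_lebesgue[OF test_function_C1(2)[OF \<phi>(1)] domain_sets] .
      have "(\<lambda>x. if x \<in> ?C then 1 else 0::real) \<in> borel_measurable (lebesgue_on \<Omega>)"
        by (rule borel_measurable_LIMSEQ_real[OF lim m\<phi>])
      then show "(\<lambda>x. (if x \<in> ?C then 1 else 0) * d x $ i) \<in> borel_measurable (lebesgue_on \<Omega>)"
        using id by (intro borel_measurable_times) auto
    qed simp
    from lebesgue_integral_eq_integral[OF this domain_sets] show ?thesis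
      by (simp add: if_distrib[of "\<lambda>c. c * _"] cong: if_cong)
  qed
  also have "\<dots> = integral ?C (\<lambda>x. d x $ i)"
    using interior_subset_domain[OF E] by (simp add: integral_restrict_Int Int_absorb2)
  finally show ?thesis by simp
qed

lemma L2_inner_piecewise_constant:
  fixes d :: "real^3 \<Rightarrow> real^3"
  assumes d: "L2_on \<Omega> d" and u: "\<And>E x. E \<in> T \<Longrightarrow> x \<in> interior (cell E) \<Longrightarrow> u x = c E"
  shows "L2_inner \<Omega> u d = (\<Sum>E\<in>T. c E \<bullet> (\<chi> i. integral (interior (cell E)) (\<lambda>x. d x $ i)))"
    and "L2_inner \<Omega> d u = (\<Sum>E\<in>T. c E \<bullet> (\<chi> i. integral (interior (cell E)) (\<lambda>x. d x $ i)))"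
proof -
  have "(\<lambda>x. d x $ i) absolutely_integrable_on \<Omega>" for i
    using L2_on_nth_integrable[OF d] integrable_lebesgue_on_iff[OF domain_sets] by blast
  then have ai: "(\<lambda>x. d x $ i) absolutely_integrable_on interior (cell E)" if "E \<in> T" for E i
    using interior_subset_domain[OF that] set_integrable_subset borel_open[OF open_interior] by (metis sets_completionI_sets sets_lborel)
  have k: "(\<lambda>x. c E \<bullet> d x) absolutely_integrable_on interior (cell E)" if "E \<in> T" for E
    unfolding inner_vec_def by (intro absolutely_integrable_sum) (auto intro!: absolutely_integrable_scaleR_left ai[OF that] set_integrable_mult_right)
  have "L2_inner \<Omega> u d = (\<Sum>E\<in>T. integral (interior (cell E)) (\<lambda>x. c E \<bullet> d x))"
    unfolding L2_inner_def by (rule integral_mesh(2)[OF k]) (simp_all add: u)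
  also have "\<dots> = (\<Sum>E\<in>T. c E \<bullet> (\<chi> i. integral (interior (cell E)) (\<lambda>x. d x $ i)))"
  proof (rule sum.cong[OF refl])
    fix E assume E: "E \<in> T"
    have i: "(\<lambda>x. d x $ i) integrable_on interior (cell E)" for i
      using ai[OF E] by (simp add: absolutely_integrable_on_def)
    have "integral (interior (cell E)) (\<lambda>x. c E \<bullet> d x) = (\<Sum>i\<in>UNIV. c E $ i * integral (interior (cell E)) (\<lambda>x. d x $ i))"
      unfolding inner_vec_def by (subst integral_sum) (auto intro: integrable_cmul[where 'b = real, unfolded real_scaleR_def] i)
    then show "integral (interior (cell E)) (\<lambda>x. c E \<bullet> d x) = c E \<bullet> (\<chi> i. integral (interior (cell E)) (\<lambda>x. d x $ i))"
      by (simp add: inner_vec_def)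
  qed
  finally show "L2_inner \<Omega> u d = (\<Sum>E\<in>T. c E \<bullet> (\<chi> i. integral (interior (cell E)) (\<lambda>x. d x $ i)))" .
  then show "L2_inner \<Omega> d u = (\<Sum>E\<in>T. c E \<bullet> (\<chi> i. integral (interior (cell E)) (\<lambda>x. d x $ i)))"
    by (simp add: L2_inner_def inner_commute)
qed

text \<open>Against piecewise constants only the cell integrals of the divergence matter, so the
  choice made by \<open>weak_div\<close> is invisible.\<close>

lemma L2_inner_weak_div:
  assumes \<tau>: "\<tau> \<in> X_space \<Omega> \<Gamma>N T" and th: "\<And>E. E \<in> T \<Longrightarrow> is_hat E \<tau> (th E)"
    and u: "\<And>E x. E \<in> T \<Longrightarrow> x \<in> interior (cell E) \<Longrightarrow> u x = c E"
  shows "L2_inner \<Omega> u (weak_div \<Omega> \<tau>) = (\<Sum>E\<in>T. c E \<bullet> hat_div (th E))"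
    and "L2_inner \<Omega> (weak_div \<Omega> \<tau>) u = (\<Sum>E\<in>T. c E \<bullet> hat_div (th E))"
proof -
  let ?d = "weak_div \<Omega> \<tau>"
  have d: "has_L2_div \<Omega> \<tau> ?d"
    using \<tau> unfolding X_space_iff weak_div_def by (metis someI_ex)
  then have L2: "L2_on \<Omega> ?d" by (simp add: has_L2_div_def)
  have "(\<chi> i. integral (interior (cell E)) (\<lambda>x. ?d x $ i)) = hat_div (th E)" if E: "E \<in> T" for E
  proof -
    have "integral (interior (cell E)) (\<lambda>x. ?d x $ i) = hat_div (th E) $ i" for i
      by (rule integral_weak_div[OF E th d])
    then show ?thesis by (simp add: vec_eq_iff)
  qed
  then have e: "(\<Sum>E\<in>T. c E \<bullet> (\<chi> i. integral (interior (cell E)) (\<lambda>x. ?d x $ i))) = (\<Sum>E\<in>T. c E \<bullet> hat_div (th E))"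
    by simp
  show "L2_inner \<Omega> u ?d = (\<Sum>E\<in>T. c E \<bullet> hat_div (th E))"
    by (rule trans[OF L2_inner_piecewise_constant(1)[OF L2 u] e])
  show "L2_inner \<Omega> ?d u = (\<Sum>E\<in>T. c E \<bullet> hat_div (th E))"
    by (rule trans[OF L2_inner_piecewise_constant(2)[OF L2 u] e])
qed

end

section \<open>Corners of the mesh\<close>

context cuboid_domain
begin

text \<open>At an extreme point of the convex hull of the cells in \<open>C\<close> no face can be shared, since the
  neighbour would continue the edge to the opposite side.\<close>

lemma corner_exists:
  assumes C: "C \<subseteq> T" "C \<noteq> {}"
    and closed: "\<And>E E' j b. E \<in> C \<Longrightarrow> E' \<in> T \<Longrightarrow> E' \<noteq> E \<Longrightarrow> \<not> face E j (of_bool b) \<subseteq> frontier \<Omega> \<Longrightarrow>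
      cell E \<inter> cell E' = face E j (of_bool b) \<Longrightarrow> E' \<in> C"
  obtains E S where "E \<in> C" "\<And>j. face E j (of_bool (j \<in> S)) \<subseteq> frontier \<Omega>" "\<And>j. g \<bullet> edge E S j \<le> 0"
proof -
  let ?U = "\<Union>E\<in>C. cell E"
  let ?H = "convex hull ?U"
  have finC: "finite C" using C(1) finite_mesh finite_subset by blast
  have "compact ?U" using finC compact_cell by (intro compact_UN) auto
  then have H: "compact ?H" by (rule compact_convex_hull)
  obtain E0 where E0: "E0 \<in> C" using C(2) by blast
  then have "corner E0 \<in> ?U"
    using mesh_cuboid C(1) ref_map_in_cell[of E0 0] by (force simp: ref_map_def ref_cube_def)
  then have "?H \<noteq> {}" using hull_subset[of ?U convex] by blast
  moreover have "continuous_on ?H (\<lambda>x. g \<bullet> x)" by (intro continuous_intros)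
  ultimately obtain m where m: "m \<in> ?H" "\<And>y. y \<in> ?H \<Longrightarrow> g \<bullet> y \<le> g \<bullet> m"
    using continuous_attains_sup[OF H] by blast
  \<comment> \<open>An extreme point of the face \<open>K\<close> of maximisers is also extreme in
    the hull, hence belongs to one of the cells.\<close>
  define K where "K = ?H \<inter> {x. g \<bullet> x = g \<bullet> m}"
  have K: "K face_of ?H"
    unfolding K_def using m(2) by (intro face_of_Int_supporting_hyperplane_le) auto
  have "compact K" unfolding K_def by (intro compact_Int_closed H closed_hyperplane)
  moreover have "convex K" using K face_of_imp_convex by blast
  moreover have "K \<noteq> {}" using m(1) by (auto simp: K_def)
  ultimately obtain v where v: "v extreme_point_of K" using extreme_point_exists_convex by blast
  then have vH: "v extreme_point_of ?H" using extreme_point_of_face[OF K] by blast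
  then have "v \<in> ?U" by (rule extreme_point_of_convex_hull)
  then obtain E where E: "E \<in> C" "v \<in> cell E" by blast
  have gv: "g \<bullet> v = g \<bullet> m" using v by (auto simp: extreme_point_of_def K_def)
  have ET: "E \<in> T" and cE: "is_cuboid E" using E C(1) mesh_cuboid by auto
  have inH: "y \<in> ?H" if "y \<in> cell E'" "E' \<in> C" for y E' using that hull_subset[of ?U convex] by blast
  have ext: "\<not> (v \<in> open_segment a b)" if "a \<in> ?H" "b \<in> ?H" for a b
    using vH that by (auto simp: extreme_point_of_def)
  obtain x where x: "v = ref_map E x" "x \<in> ref_cube" using E by (auto simp: cell_def)
  \<comment> \<open>\<open>v\<close> is extreme in the hull and therefore in its cell, so it is a
    vertex of \<open>E\<close>.\<close>
  have "x $ i = 0 \<or> x $ i = 1" for i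
  proof (rule ccontr)
    assume n: "\<not> (x $ i = 0 \<or> x $ i = 1)"
    then have i: "x $ i \<in> {0<..<1}" using x by (auto simp: ref_cube_def less_le)
    let ?w = "x - x $ i *\<^sub>R axis i 1"
    have w: "?w $ k = (if k = i then 0 else x $ k)" for k by (simp add: axis_def)
    have cw: "?w \<in> ref_cube" using x(2) unfolding ref_cube_def mem_Collect_eq w by auto
    have "{v} face_of ?H" using vH by (simp add: face_of_singleton)
    then have "ref_map E ?w \<in> {v}"
    proof (rule face_of_spread[where x = x])
      show "x $ k \<in> {0<..<1} \<or> ?w $ k = x $ k" for k using i w by auto
      show "ref_map E w \<in> ?H" if "w \<in> ref_cube" for w
        using that cE E(1) by (intro inH) auto
    qed (use x cE cw in auto)
    then have "?w = x" using x(1) cE by simp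
    then show False using i w by (metis greaterThanLessThan_iff less_irrefl)
  qed
  then have "x \<in> range vert" using range_vert by auto
  then obtain S where S: "v = ref_map E (vert S)" using x by blast
  have edge_in: "v + edge E' S' j \<in> cell E'" if "v = ref_map E' (vert S')" "is_cuboid E'" for E' S' j
  proof -
    have "v + edge E' S' j = ref_map E' (flip S' (vert {j}))"
      unfolding ref_map_edges edge_sum_singleton using that by simp
    then show ?thesis using that(2) by simp
  qed
  have "g \<bullet> edge E S j \<le> 0" for j
    using m(2)[OF inH[OF edge_in[OF S cE] E(1)], of j] gv by (simp add: inner_add_right)
  moreover have "face E j (of_bool (j \<in> S)) \<subseteq> frontier \<Omega>" for j
  proof (rule ccontr)
    assume F: "\<not> face E j (of_bool (j \<in> S)) \<subseteq> frontier \<Omega>"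
    have s: "of_bool (j \<in> S) \<in> {0, 1::real}" by auto
    obtain E' where E': "E' \<in> T" "E' \<noteq> E" "cell E \<inter> cell E' = face E j (of_bool (j \<in> S))"
      by (rule exists_neighbour[OF ET F s])
    obtain j' s' where F': "s' \<in> {0, 1}" "face E' j' s' = face E j (of_bool (j \<in> S))"
      by (rule shared_face_is_face[OF ET s E'])
    obtain b where b: "s' = of_bool b" by (rule that[of "s' = 1"]) (use F'(1) in auto)
    obtain S' \<rho> where "j' \<in> S' \<longleftrightarrow> b" and S1: "ref_map E' (vert S') = ref_map E (vert S)" and "bij \<rho>" "\<rho> j' = j"
      "\<forall>k. k \<noteq> j' \<longrightarrow> edge E' S' k = edge E S (\<rho> k)"
      and S2: "edge E' S' j' = - (norm (column j' (jac E')) / norm (column j (jac E))) *\<^sub>R edge E S j"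
      by (rule shared_face_vertex[OF ET E' F'(2)[unfolded b] refl])
    define mu where "mu = norm (column j' (jac E')) / norm (column j (jac E))"
    have S': "ref_map E' (vert S') = v" "edge E' S' j' = - mu *\<^sub>R edge E S j"
      using S S1 S2 by (simp_all add: mu_def)
    have mu: "0 < mu"
      using cuboid_column(1)[OF cE] cuboid_column(1)[OF mesh_cuboid[OF E'(1)]] by (simp add: mu_def)
    have "E' \<in> C" using closed[OF E(1) E'(1,2) F E'(3)] .
    then have 1: "v - mu *\<^sub>R edge E S j \<in> ?H"
      using inH[OF edge_in[OF S'(1)[symmetric] mesh_cuboid[OF E'(1)]], of j'] S'(2) by simp
    have 2: "v + edge E S j \<in> ?H" by (rule inH[OF edge_in[OF S cE] E(1)])
    \<comment> \<open>The weight for which the ends of the two opposite edges at \<open>v\<close>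
      average to \<open>v\<close>, against extremality.\<close>
    define u where "u = mu / (1 + mu)"
    have u: "0 < u" "u < 1" using mu by (simp_all add: u_def field_simps)
    have "- ((1 - u) * mu) + u = 0" using mu by (simp add: u_def field_simps)
    moreover have "(1 - u) *\<^sub>R (v - mu *\<^sub>R edge E S j) + u *\<^sub>R (v + edge E S j) =
      v + (- ((1 - u) * mu) + u) *\<^sub>R edge E S j"
      by (simp add: algebra_simps)
    ultimately have "v = (1 - u) *\<^sub>R (v - mu *\<^sub>R edge E S j) + u *\<^sub>R (v + edge E S j)" by simp
    moreover have "v - mu *\<^sub>R edge E S j \<noteq> v + edge E S j"
    proof
      assume "v - mu *\<^sub>R edge E S j = v + edge E S j"
      then have "(1 + mu) *\<^sub>R edge E S j = 0" by (simp add: algebra_simps)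
      then show False using mu edge_nonzero[OF cE] by simp
    qed
    ultimately have "v \<in> open_segment (v - mu *\<^sub>R edge E S j) (v + edge E S j)"
      unfolding in_segment using u by blast
    then show False using ext[OF 1 2] by blast
  qed
  ultimately show ?thesis using that E(1) by blast
qed

end

section \<open>Skew fields on the vertices of a cuboid\<close>

lemma face_inj:
  assumes E: "is_cuboid E" and eq: "face E j (of_bool b) = face E j' (of_bool b')"
  shows "j = j' \<and> b = b'"
proof -
  \<comment> \<open>Only coordinate \<open>j\<close> of the face centre is 0 or 1.\<close>
  let ?c = "(\<chi> i. if i = j then of_bool b else 1 / 2) :: real^3"
  have "ref_map E ?c \<in> face E j (of_bool b)"
    using E by (auto simp: ref_map_in_face ref_cube_def)
  then have "?c $ j' = of_bool b'" using eq E by (simp only: ref_map_in_face)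
  then show ?thesis by (cases b'; cases b) (auto split: if_splits)
qed

text \<open>Of the four faces orthogonal to the directions \<open>i\<close> and \<open>j\<close> at
  most one is bad, so one direction \<open>k\<close> has two good faces and the other,
  \<open>l\<close>, at least one. Within a face of direction \<open>k\<close> every vertex is joined
  to a vertex of the good face of direction \<open>l\<close>.\<close>

lemma constant_three_faces:
  fixes f :: "3 set \<Rightarrow> 'a"
  assumes ij: "i \<noteq> j"
    and f: "\<And>k b S S'. k = i \<or> k = j \<Longrightarrow> (k, b) \<noteq> bad \<Longrightarrow> (k \<in> S) = b \<Longrightarrow> (k \<in> S') = b \<Longrightarrow> f S = f S'"
  shows "f S = f S'"
proof -
  have main: "f S = f S'" if k: "k = i \<and> l = j \<or> k = j \<and> l = i" and good: "fst bad \<noteq> k" for k l S S'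
  proof -
    obtain b where b: "(l, b) \<noteq> bad" by (metis prod.inject)
    have *: "f S = f {x. (x = l \<and> b) \<or> (x = k \<and> k \<in> S)}" for S
      using k ij good by (intro f[where k = k and b = "k \<in> S"]) auto
    have "f {x. (x = l \<and> b) \<or> (x = k \<and> k \<in> S)} = f {x. (x = l \<and> b) \<or> (x = k \<and> k \<in> S')}"
      using k ij b by (intro f[where k = l and b = b]) auto
    then show ?thesis using * by metis
  qed
  show ?thesis using main[of i j S S'] main[of j i S S'] ij by blast
qed

lemma inner_columns_eq:
  assumes E: "is_cuboid E" and eq: "\<And>i. column i (jac E) \<bullet> v = column i (jac E) \<bullet> w"
  shows "v = w"
proof -
  have "v - w = (\<Sum>i\<in>UNIV. ((v - w) \<bullet> edge E {} i / (edge E {} i \<bullet> edge E {} i)) *\<^sub>R edge E {} i)"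
    by (rule edge_expansion[OF E])
  also have "\<dots> = 0" using eq by (intro sum.neutral) (simp add: edge_def inner_diff_left inner_commute)
  finally show ?thesis by simp
qed

lemma matrix_eq_columns:
  fixes A B :: "real^3^3"
  assumes E: "is_cuboid E" and eq: "\<And>j. A *v column j (jac E) = B *v column j (jac E)"
  shows "A = B"
proof -
  have "A $ k = B $ k" for k
    by (rule inner_columns_eq[OF E]) (metis eq inner_commute matrix_vector_mul_component)
  then show ?thesis by (simp add: vec_eq_iff)
qed

lemma matrix_vector_mult_uminus: "(- A) *v v = - (A *v v)" for A :: "real^3^3"
  by (simp add: matrix_vector_mult_def vec_eq_iff sum_negf)

lemma skew_inner:
  fixes A :: "real^3^3"
  assumes "transpose A = - A" shows "v \<bullet> (A *v w) = - (w \<bullet> (A *v v))"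
proof -
  have "v \<bullet> (A *v w) = (transpose A *v v) \<bullet> w"
    by (metis dot_lmul_matrix transpose_matrix_vector)
  also have "\<dots> = - (w \<bullet> (A *v v))"
    unfolding assms matrix_vector_mult_uminus by (simp add: inner_commute)
  finally show ?thesis .
qed

text \<open>The entry (i, j) of \<open>G\<close> with respect to the columns of \<open>jac E\<close>
  is constant on good faces orthogonal to \<open>j\<close> by assumption and, by antisymmetry, on
  those orthogonal to \<open>i\<close>; diagonal entries vanish. So
  \<open>constant_three_faces\<close> applies to every entry off the diagonal.\<close>

lemma skew_constant:
  fixes G :: "3 set \<Rightarrow> real^3^3"
  assumes E: "is_cuboid E" and skew: "\<And>S. transpose (G S) = - G S"
    and const: "\<And>j b S S'. (j, b) \<noteq> bad \<Longrightarrow> (j \<in> S) = b \<Longrightarrow> (j \<in> S') = b \<Longrightarrow>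
       G S *v column j (jac E) = G S' *v column j (jac E)"
  shows "G S = G S'"
proof (rule matrix_eq_columns[OF E], rule inner_columns_eq[OF E])
  fix j i
  let ?m = "\<lambda>S. column i (jac E) \<bullet> (G S *v column j (jac E))"
  show "?m S = ?m S'"
  proof (cases "i = j")
    case True
    have "?m S = 0" for S using skew_inner[OF skew, of "column j (jac E)" S "column j (jac E)"] True by simp
    then show ?thesis by simp
  next
    case False
    show ?thesis
    proof (rule constant_three_faces[OF False, where bad = bad])
      fix k b S S' assume k: "k = i \<or> k = j" and *: "(k, b) \<noteq> bad" "(k \<in> S) = b" "(k \<in> S') = b"
      have eq: "G S *v column k (jac E) = G S' *v column k (jac E)" by (rule const[OF *])
      show "?m S = ?m S'"
      proof (cases "k = j")
        case True
        then show ?thesis using eq by simp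
      next
        case False
        then have "k = i" using k by blast
        have "?m S = - (column j (jac E) \<bullet> (G S *v column i (jac E)))" for S
          by (rule skew_inner[OF skew])
        then show ?thesis using eq \<open>k = i\<close> by (simp only:)
      qed
    qed
  qed
qed

lemma skew_matrix_axis:
  fixes A :: "real^3^3"
  assumes "transpose A = - A"
  obtains g where "\<And>v. A *v v = cross3 g v"
proof -
  have a: "A $ i $ j = - A $ j $ i" for i j
    using assms by (metis (no_types, lifting) transpose_def vec_lambda_beta vector_uminus_component)
  have d: "A $ i $ i = 0" for i using a[of i i] by simp
  let ?g = "vector [A $ 3 $ 2, A $ 1 $ 3, A $ 2 $ 1] :: real^3"
  have "A *v v = cross3 ?g v" for v
    unfolding vec_eq_iff forall_3
    using a[of 1 2] a[of 1 3] a[of 2 3]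
    by (simp add: cross3_def matrix_vector_mult_def sum_3 d)
  then show ?thesis using that by blast
qed

section \<open>Sums over vertices and unit vertex data\<close>

lemma sum_vertices:
  assumes "is_cuboid E"
  shows "(\<Sum>r\<in>vertices E. f r) = (\<Sum>S\<in>UNIV. f (ref_map E (vert S)))"
  unfolding vertices_eq using assms by (subst sum.reindex) (auto simp: inj_def)

lemma sum_single:
  assumes "finite A" "a \<in> A" "\<And>x. x \<in> A \<Longrightarrow> x \<noteq> a \<Longrightarrow> f x = 0"
  shows "sum f A = f a"
  using assms by (subst sum.remove[of _ a]) (auto intro!: sum.neutral)

definition single :: "cuboid \<Rightarrow> 3 set \<Rightarrow> 3 \<Rightarrow> 3 \<Rightarrow> real \<Rightarrow> cuboid \<Rightarrow> 3 set \<Rightarrow> 3 \<Rightarrow> 3 \<Rightarrow> real" where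
  "single E0 S0 i0 j0 c E S i j = (if E = E0 \<and> S = S0 \<and> i = i0 \<and> j = j0 then c else 0)"

lemma sum_single4:
  assumes "finite T" "E0 \<in> T"
  shows "(\<Sum>E\<in>T. \<Sum>S\<in>UNIV. \<Sum>i\<in>UNIV. \<Sum>j\<in>UNIV. single E0 S0 i0 j0 c E S i j * f E S i j) = c * f E0 S0 i0 j0"
proof -
  have "(\<Sum>E\<in>T. \<Sum>S\<in>UNIV. \<Sum>i\<in>UNIV. \<Sum>j\<in>UNIV. single E0 S0 i0 j0 c E S i j * f E S i j) =
      (\<Sum>S\<in>UNIV. \<Sum>i\<in>UNIV. \<Sum>j\<in>UNIV. single E0 S0 i0 j0 c E0 S i j * f E0 S i j)"
    by (rule sum_single[OF assms]) (simp add: single_def)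
  also have "\<dots> = (\<Sum>i\<in>UNIV. \<Sum>j\<in>UNIV. single E0 S0 i0 j0 c E0 S0 i j * f E0 S0 i j)"
    by (rule sum_single) (simp_all add: single_def)
  also have "\<dots> = (\<Sum>j\<in>UNIV. single E0 S0 i0 j0 c E0 S0 i0 j * f E0 S0 i0 j)"
    by (rule sum_single) (simp_all add: single_def)
  also have "\<dots> = single E0 S0 i0 j0 c E0 S0 i0 j0 * f E0 S0 i0 j0"
    by (rule sum_single) (simp_all add: single_def)
  finally show ?thesis by (simp add: single_def)
qed

lemma sum_single3:
  assumes "finite T" "E0 \<in> T"
  shows "(\<Sum>E\<in>T. \<Sum>S\<in>UNIV. \<Sum>j\<in>UNIV. vsign S j * single E0 S0 i0 j0 c E S i j * f E S j) =
    (if i = i0 then vsign S0 j0 * c * f E0 S0 j0 else 0)"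
proof -
  have "(\<Sum>E\<in>T. \<Sum>S\<in>UNIV. \<Sum>j\<in>UNIV. vsign S j * single E0 S0 i0 j0 c E S i j * f E S j) =
      (\<Sum>S\<in>UNIV. \<Sum>j\<in>UNIV. vsign S j * single E0 S0 i0 j0 c E0 S i j * f E0 S j)"
    by (rule sum_single[OF assms]) (simp add: single_def)
  also have "\<dots> = (\<Sum>j\<in>UNIV. vsign S0 j * single E0 S0 i0 j0 c E0 S0 i j * f E0 S0 j)"
    by (rule sum_single) (simp_all add: single_def)
  also have "\<dots> = vsign S0 j0 * single E0 S0 i0 j0 c E0 S0 i j0 * f E0 S0 j0"
    by (rule sum_single) (simp_all add: single_def)
  finally show ?thesis by (simp add: single_def)
qed

lemma trilinear_iff: "p \<in> trilinear \<longleftrightarrow> (\<exists>c. p = trilin c)"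
  unfolding trilinear_def trilin_def[abs_def] by blast

section \<open>Kernel of the method\<close>

locale msmfe = cuboid_domain \<Omega> T for \<Omega> T +
  fixes \<Gamma>N :: "(real^3) set" and A :: "real^3 \<Rightarrow> (real^3^3) \<Rightarrow>\<^sub>L (real^3^3)"
  assumes N_subset: "\<Gamma>N \<subseteq> frontier \<Omega>" and compliance: "compliance_tensor \<Omega> T A"
    and one_N_face: "\<forall>E\<in>T. card {F \<in> faces E. F \<subseteq> \<Gamma>N} \<le> 1"
begin

abbreviation "vtrace E f S \<equiv> trace_from E f (ref_map E (vert S))"

text \<open>Condition (A1) as a statement on labels: at most one pair of direction and side. If no
  face lies on \<Gamma>N, \<open>bad\<close> is arbitrary.\<close>

lemma bad_face:
  assumes E: "E \<in> T"
  obtains bad where "\<And>j b. face E j (of_bool b) \<subseteq> \<Gamma>N \<Longrightarrow> (j, b) = bad"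
proof -
  let ?N = "{F \<in> faces E. F \<subseteq> \<Gamma>N}"
  have "faces E = (\<lambda>(j, s). face E j s) ` (UNIV \<times> {0, 1})" by (auto simp: faces_def image_iff)
  \<comment> \<open>\<open>card\<close> of an infinite set is 0, so the bound on \<open>card\<close>
    is informative only for a finite set.\<close>
  then have "finite ?N" by simp
  then have eq: "F = F'" if "F \<in> ?N" "F' \<in> ?N" for F F'
    using card_le_Suc0_iff_eq[of ?N] one_N_face E that by auto
  have "face E j (of_bool b) \<in> faces E" for j b by (auto simp: faces_def)
  then have pair: "(j, b) = (j', b')" if "face E j (of_bool b) \<subseteq> \<Gamma>N" "face E j' (of_bool b') \<subseteq> \<Gamma>N" for j b j' b'
    using eq[of "face E j (of_bool b)" "face E j' (of_bool b')"] that face_inj[OF mesh_cuboid[OF E]] by auto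
  show ?thesis
  proof (cases "\<exists>j b. face E j (of_bool b) \<subseteq> \<Gamma>N")
    case True
    then obtain j b where "face E j (of_bool b) \<subseteq> \<Gamma>N" by blast
    then show ?thesis using that[of "(j, b)"] pair by blast
  next
    case False
    then show ?thesis using that by blast
  qed
qed

lemma W1_trace:
  assumes w: "w \<in> W1_space \<Omega> T" and E: "E \<in> T"
  obtains c where "\<forall>x\<in>ref_cube. trace_from E w (ref_map E x) = (\<chi> i j. trilin (c i j) x)"
    "\<forall>x\<in>interior ref_cube. w (ref_map E x) = (\<chi> i j. trilin (c i j) x)"
proof -
  note cE = mesh_cuboid[OF E]
  have "\<forall>i j. \<exists>c. \<forall>x\<in>interior ref_cube. w (ref_map E x) $ i $ j = trilin c x"
  proof (intro allI)
    fix i j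
    have "\<forall>E\<in>T. \<forall>i j. \<exists>p\<in>trilinear. \<forall>x\<in>interior ref_cube. w (ref_map E x) $ i $ j = p x"
      using w unfolding W1_space_def by simp
    from this[rule_format, OF E] obtain p where "p \<in> trilinear" "\<forall>x\<in>interior ref_cube. w (ref_map E x) $ i $ j = p x"
      by blast
    then show "\<exists>c. \<forall>x\<in>interior ref_cube. w (ref_map E x) $ i $ j = trilin c x"
      unfolding trilinear_iff by blast
  qed
  then obtain c where c: "\<And>i j x. x \<in> interior ref_cube \<Longrightarrow> w (ref_map E x) $ i $ j = trilin (c i j) x"
    by metis
  then have 2: "w (ref_map E x) = (\<chi> i j. trilin (c i j) x)" if "x \<in> interior ref_cube" for x
    using that by (simp add: vec_eq_iff)
  have "trace_from E w (ref_map E x) = (\<chi> i j. trilin (c i j) x)" if x: "x \<in> ref_cube" for x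
  proof -
    have "trace_from E w (ref_map E x) = (\<chi> i j. trilin (c i j) (ref_coord E (ref_map E x)))"
    proof (rule trace_from_eq[OF cE])
      have "continuous_on (cell E) (\<lambda>y. trilin k (ref_coord E y))" for k
        by (rule continuous_on_compose2[OF continuous_trilin continuous_ref_coord subset_UNIV])
      then show "continuous_on (cell E) (\<lambda>y. \<chi> i j. trilin (c i j) (ref_coord E y))"
        by (intro continuous_on_vec_lambda)
      show "w y = (\<chi> i j. trilin (c i j) (ref_coord E y))" if "y \<in> interior (cell E)" for y
        using that 2 cE by (auto simp: interior_cell)
    qed (use x cE in simp)
    then show ?thesis using cE by simp
  qed
  then show ?thesis using that 2 by blast
qed

lemma W1_trace_eq:
  assumes w: "w \<in> W1_space \<Omega> T" and E: "E \<in> T" and y: "y \<in> \<Omega>" "y \<in> cell E"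
  shows "trace_from E w y = w y"
proof -
  have "continuous_on \<Omega> w" using w by (simp add: W1_space_def)
  then have "(w \<longlongrightarrow> w y) (at y within \<Omega>)" using y(1) by (simp add: continuous_on_def)
  then have "(w \<longlongrightarrow> w y) (at y within interior (cell E))"
    by (rule tendsto_within_subset) (rule interior_subset_domain[OF E])
  then show ?thesis
    unfolding trace_from_def by (rule tendsto_Lim[OF interior_cell_nontrivial[OF mesh_cuboid[OF E] y(2)]])
qed

text \<open>Skewness is known on \<Omega> only. It passes to the vertices, which may lie on the
  frontier, by continuity of the trilinear polynomials.\<close>

lemma W1_trace_skew:
  assumes w: "w \<in> W1_space \<Omega> T" and E: "E \<in> T"
  shows "transpose (vtrace E w S) = - vtrace E w S"
proof -
  note cE = mesh_cuboid[OF E]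
  obtain c where *: "\<forall>x\<in>ref_cube. trace_from E w (ref_map E x) = (\<chi> i j. trilin (c i j) x)"
    "\<forall>x\<in>interior ref_cube. w (ref_map E x) = (\<chi> i j. trilin (c i j) x)"
    by (rule W1_trace[OF w E])
  note c = *[rule_format]
  have "trilin (c i j) x + trilin (c j i) x = 0" if "x \<in> ref_cube" for i j x
  proof (rule continuous_constant_on_closure[where S = "interior ref_cube"])
    show "continuous_on (closure (interior ref_cube)) (\<lambda>x. trilin (c i j) x + trilin (c j i) x)"
      by (intro continuous_intros continuous_trilin)
    show "trilin (c i j) x + trilin (c j i) x = 0" if "x \<in> interior ref_cube" for x
    proof -
      have "ref_map E x \<in> \<Omega>"
        using that interior_subset_domain[OF E] cE by (auto simp: interior_cell)
      then have "transpose (w (ref_map E x)) = - w (ref_map E x)" using w by (simp add: W1_space_def)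
      then have "transpose (w (ref_map E x)) $ j $ i = (- w (ref_map E x)) $ j $ i" by simp
      then show ?thesis by (simp add: transpose_def c(2)[OF that])
    qed
    show "x \<in> closure (interior ref_cube)"
    proof -
      have "interior ref_cube \<noteq> {}" unfolding interior_ref_cube by (auto intro!: exI[of _ "\<chi> i. 1/2"])
      then show ?thesis
        using convex_closure_interior[OF convex_ref_cube] that closure_subset by auto
    qed
  qed
  then show ?thesis by (simp add: c(1) vec_eq_iff transpose_def eq_neg_iff_add_eq_0)
qed

text \<open>The vertex may lie on the frontier, where continuity of \<open>w\<close> on \<Omega>
  says nothing. It is approached along the segment from the face centre, which otherwise runs inside
  \<Omega>, so that both traces equal \<open>w\<close> there; both are continuous along the segment
  and hence agree at its end.\<close>

lemma W1_trace_shared: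
  assumes w: "w \<in> W1_space \<Omega> T" and E: "E \<in> T" and E': "E' \<in> T"
    and F: "\<not> face E j (of_bool b) \<subseteq> frontier \<Omega>" "face E j (of_bool b) \<subseteq> cell E'" and S: "j \<in> S \<longleftrightarrow> b"
  shows "trace_from E w (ref_map E (vert S)) = trace_from E' w (ref_map E (vert S))"
proof -
  note cE = mesh_cuboid[OF E] and cE' = mesh_cuboid[OF E']
  obtain c where *: "\<forall>x\<in>ref_cube. trace_from E w (ref_map E x) = (\<chi> i j. trilin (c i j) x)"
    "\<forall>x\<in>interior ref_cube. w (ref_map E x) = (\<chi> i j. trilin (c i j) x)"
    by (rule W1_trace[OF w E])
  note c = *[rule_format]
  obtain c' where *: "\<forall>x\<in>ref_cube. trace_from E' w (ref_map E' x) = (\<chi> i j. trilin (c' i j) x)"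
    "\<forall>x\<in>interior ref_cube. w (ref_map E' x) = (\<chi> i j. trilin (c' i j) x)"
    by (rule W1_trace[OF w E'])
  note c' = *[rule_format]
  define m :: "real^3" where "m = (\<chi> i. if i = j then of_bool b else 1 / 2)"
  define p where "p e = (1 - e) *\<^sub>R vert S + e *\<^sub>R m" for e
  have p: "p e $ i = (if i = j then of_bool b else (1 - e) * vert S $ i + e / 2)" for e i
    using S by (simp add: p_def m_def algebra_simps)
  define q where "q e = ref_coord E' (ref_map E (p e))" for e
  have pc: "p e \<in> ref_cube" if "e \<in> {0..1}" for e
    using that unfolding ref_cube_def mem_Collect_eq p by auto
  have pF: "ref_map E (p e) \<in> face E j (of_bool b)" if "e \<in> {0..1}" for e
    unfolding ref_map_in_face[OF cE] using pc[OF that] by (simp add: p)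
  have q: "ref_map E (p e) = ref_map E' (q e)" for e using cE' by (simp add: q_def)
  have qc: "q e \<in> ref_cube" if "e \<in> {0..1}" for e
    using pF[OF that] F(2) cE' unfolding q by auto
  have cp: "continuous_on UNIV p" unfolding p_def by (intro continuous_intros)
  have cq: "continuous_on UNIV q" unfolding q_def
    by (rule continuous_on_compose2[OF continuous_ref_coord[of UNIV]
        continuous_on_compose2[OF continuous_ref_map[of UNIV] cp]]) auto
  have "trilin (c i k) (p 0) - trilin (c' i k) (q 0) = 0" for i k
  proof (rule continuous_constant_on_closure[where S = "{0<..<1::real}" and x = 0
        and f = "\<lambda>e. trilin (c i k) (p e) - trilin (c' i k) (q e)"])
    show "continuous_on (closure {0<..<1}) (\<lambda>e. trilin (c i k) (p e) - trilin (c' i k) (q e))"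
      by (intro continuous_on_diff continuous_on_compose2[OF continuous_trilin[of UNIV] continuous_on_subset[OF cp]]
          continuous_on_compose2[OF continuous_trilin[of UNIV] continuous_on_subset[OF cq]]) auto
    show "trilin (c i k) (p e) - trilin (c' i k) (q e) = 0" if e: "e \<in> {0<..<1}" for e
    proof -
      have e1: "e \<in> {0..1}" using e by auto
      have "ref_map E (p e) \<in> \<Omega>"
      proof (rule interior_face_subset_domain[OF E F(1)])
        show "p e $ i \<in> {0<..<1}" if "i \<noteq> j" for i using e that by (simp add: p)
      qed (auto simp: p)
      then have "trace_from E w (ref_map E (p e)) = trace_from E' w (ref_map E' (q e))"
        using W1_trace_eq[OF w E] W1_trace_eq[OF w E'] pF[OF e1] face_subset_cell F(2) unfolding q[symmetric]
        by (metis subsetD)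
      then have "(\<chi> i j. trilin (c i j) (p e)) $ i $ k = (\<chi> i j. trilin (c' i j) (q e)) $ i $ k"
        unfolding c(1)[OF pc[OF e1]] c'(1)[OF qc[OF e1]] by simp
      then show ?thesis by simp
    qed
  qed simp
  then have eq: "(\<chi> i j. trilin (c i j) (p 0)) = (\<chi> i j. trilin (c' i j) (q 0))" by (simp add: vec_eq_iff)
  have p0: "p 0 = vert S" by (simp add: p_def)
  have "trace_from E w (ref_map E (p 0)) = trace_from E' w (ref_map E' (q 0))"
    using eq by (simp only: c(1)[OF pc] c'(1)[OF qc] atLeastAtMost_iff order_refl zero_le_one)
  then show ?thesis unfolding q[symmetric] p0 .
qed

lemma W1_zero:
  assumes w: "w \<in> W1_space \<Omega> T" and z: "\<And>E S. E \<in> T \<Longrightarrow> vtrace E w S = 0" and y: "y \<in> \<Omega>"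
  shows "w y = 0"
proof -
  obtain E where E: "E \<in> T" "y \<in> cell E" using y mesh_cover closure_subset by blast
  obtain c where *: "\<forall>x\<in>ref_cube. trace_from E w (ref_map E x) = (\<chi> i j. trilin (c i j) x)"
    "\<forall>x\<in>interior ref_cube. w (ref_map E x) = (\<chi> i j. trilin (c i j) x)"
    by (rule W1_trace[OF w E(1)])
  note c = *[rule_format]
  have "trilin (c i j) (vert S) = 0" for i j S
  proof -
    have "(\<chi> i j. trilin (c i j) (vert S)) $ i $ j = (0 :: real^3^3) $ i $ j"
      using z[OF E(1), of S] c(1)[OF vert_in_ref_cube] by simp
    then show ?thesis by simp
  qed
  then have "trilin (c i j) x = 0" for i j x by (subst trilin_interpolation) simp
  then have "trace_from E w (ref_map E x) = 0" if "x \<in> ref_cube" for x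
    using c(1)[OF that] by (simp add: vec_eq_iff)
  moreover obtain x where "x \<in> ref_cube" "y = ref_map E x" using E by (auto simp: cell_def)
  ultimately show ?thesis using W1_trace_eq[OF w E(1) y E(2)] by simp
qed

lemma V_const:
  assumes "u \<in> V_space T"
  obtains c where "\<And>E x. E \<in> T \<Longrightarrow> x \<in> interior (cell E) \<Longrightarrow> u x = c E"
    "\<And>E y. E \<in> T \<Longrightarrow> y \<in> cell E \<Longrightarrow> trace_from E u y = c E"
proof -
  have "\<forall>E\<in>T. \<exists>c. \<forall>x\<in>interior (cell E). u x = c" using assms by (simp add: V_space_def)
  then obtain c where c: "\<And>E x. E \<in> T \<Longrightarrow> x \<in> interior (cell E) \<Longrightarrow> u x = c E" by metis
  have "trace_from E u y = c E" if "E \<in> T" "y \<in> cell E" for E y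
    using that by (intro trace_from_eq[where g = "\<lambda>_. c E"] mesh_cuboid) (auto simp: c)
  then show ?thesis using that c by blast
qed

lemma quad_hat:
  assumes th: "\<And>E. E \<in> T \<Longrightarrow> is_hat E \<tau> (th E)"
  shows "quad T \<gamma> \<tau> = (\<Sum>E\<in>T. \<Sum>S\<in>UNIV. \<Sum>i\<in>UNIV. \<Sum>j\<in>UNIV.
    th E (vert S) $ i $ j * ((vtrace E \<gamma> S *v column j (jac E)) $ i / 8))"
  unfolding quad_def
proof (rule sum.cong[OF refl])
  fix E assume E: "E \<in> T"
  note cE = mesh_cuboid[OF E]
  have "\<bar>det (jac E)\<bar> * (vtrace E \<gamma> S \<bullet> vtrace E \<tau> S) = (\<Sum>i\<in>UNIV. \<Sum>j\<in>UNIV.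
    th E (vert S) $ i $ j * ((vtrace E \<gamma> S *v column j (jac E)) $ i))" for S
  proof -
    have "\<bar>det (jac E)\<bar> * (vtrace E \<gamma> S \<bullet> vtrace E \<tau> S) = (\<Sum>i\<in>UNIV. vtrace E \<gamma> S $ i \<bullet> (jac E *v th E (vert S) $ i))"
      unfolding is_hat_trace[OF cE th[OF E] vert_in_ref_cube] piola_def inner_vec_def[of "vtrace E \<gamma> S"] sum_distrib_left
      using det_jac[OF cE] by (intro sum.cong refl) simp
    also have "\<dots> = (\<Sum>i\<in>UNIV. \<Sum>j\<in>UNIV. th E (vert S) $ i $ j * ((vtrace E \<gamma> S *v column j (jac E)) $ i))"
      unfolding matrix_vector_mul_component
      by (intro sum.cong refl) (simp add: matrix_mult_sum scalar_mult_eq_scaleR inner_sum_right)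
    finally show ?thesis .
  qed
  then have "\<bar>det (jac E)\<bar> / 8 * (vtrace E \<gamma> S \<bullet> vtrace E \<tau> S) = (\<Sum>i\<in>UNIV. \<Sum>j\<in>UNIV.
    th E (vert S) $ i $ j * ((vtrace E \<gamma> S *v column j (jac E)) $ i / 8))" for S
    by (simp add: sum_divide_distrib[symmetric])
  then show "measure lebesgue (cell E) / 8 * (\<Sum>r\<in>vertices E. trace_from E \<gamma> r \<bullet> trace_from E \<tau> r) =
    (\<Sum>S\<in>UNIV. \<Sum>i\<in>UNIV. \<Sum>j\<in>UNIV. th E (vert S) $ i $ j * ((vtrace E \<gamma> S *v column j (jac E)) $ i / 8))"
    unfolding measure_cell[OF cE] sum_vertices[OF cE] sum_distrib_left by simp
qed

end

lemma (in cuboid_domain) test_function_outside: "test_function \<Omega> \<phi> \<Longrightarrow> y \<notin> \<Omega> \<Longrightarrow> \<phi> y = 0"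
proof (rule ccontr)
  assume \<phi>: "test_function \<Omega> \<phi>" and y: "y \<notin> \<Omega>" "\<phi> y \<noteq> 0"
  then have "y \<in> closure {x. \<phi> x \<noteq> 0}" using closure_subset[of "{x. \<phi> x \<noteq> 0}"] by blast
  moreover have "closure {x. \<phi> x \<noteq> 0} \<subseteq> \<Omega>" using \<phi> by (simp only: test_function_def)
  ultimately show False using y(1) by blast
qed

lemma edge_vsign: "edge E S j = - vsign S j *\<^sub>R column j (jac E)"
  by (simp add: edge_def vsign_def)

lemma matrix_mult_edge: "M *v edge E S j = - vsign S j *\<^sub>R (M *v column j (jac E))" for M :: "real^3^3"
  by (simp only: edge_vsign matrix_vector_mult_scaleR)

lemma vsign_square [simp]: "vsign S j * vsign S j = 1"
  by (simp add: vsign_def)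

lemma set_coord_in_ref_cube:
  assumes "x \<in> ref_cube" "s \<in> {0..1}" shows "set_coord j s x \<in> ref_cube"
proof -
  have "set_coord j (x $ j) x = x" by (simp add: vec_eq_iff)
  then show ?thesis using set_coord_ref_cube[of j "x $ j" x s] assms by auto
qed

text \<open>What is left of the homogeneous problem once \<sigma> = 0: \<open>u\<close> holds the
  constants on the elements, and \<open>orth\<close> is the first equation with the divergence
  replaced by its cell integrals.\<close>

locale msmfe_kernel = msmfe \<Omega> T \<Gamma>N A for \<Omega> T \<Gamma>N A +
  fixes u :: "cuboid \<Rightarrow> real^3" and \<gamma> :: "real^3 \<Rightarrow> real^3^3"
  assumes \<gamma>: "\<gamma> \<in> W1_space \<Omega> T"
    and orth: "\<And>\<tau> th. \<tau> \<in> X_space \<Omega> \<Gamma>N T \<Longrightarrow> (\<And>E. E \<in> T \<Longrightarrow> is_hat E \<tau> (th E)) \<Longrightarrow>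
      (\<Sum>E\<in>T. u E \<bullet> hat_div (th E)) + quad T \<gamma> \<tau> = 0"
begin

abbreviation "G E S \<equiv> trace_from E \<gamma> (ref_map E (vert S))"

text \<open>The coefficient of the vertex value \<open>th E (vert S) $ i $ j\<close> in \<open>orth\<close>: the determinant in the weight of the
  quadrature cancels that of the Piola map.\<close>

definition residual :: "cuboid \<Rightarrow> 3 set \<Rightarrow> 3 \<Rightarrow> 3 \<Rightarrow> real" where
  "residual E S i j = vsign S j / 4 * u E $ i + (G E S *v column j (jac E)) $ i / 8"

text \<open>Admissible vertex data \<open>t\<close> are realised by a test field through
  \<open>X_space_construct\<close>, so \<open>orth\<close> becomes an orthogonality relation for the
  residuals.\<close>

lemma residual_sum:
  assumes flux: "\<And>\<phi> i. test_function \<Omega> \<phi> \<Longrightarrow>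
      (\<Sum>E\<in>T. \<Sum>S\<in>UNIV. \<Sum>j\<in>UNIV. vsign S j * t E S i j * face_integral E S j \<phi>) = 0"
    and N: "\<And>E j S i. E \<in> T \<Longrightarrow> face E j (of_bool (j \<in> S)) \<subseteq> \<Gamma>N \<Longrightarrow> t E S i j = 0"
  shows "(\<Sum>E\<in>T. \<Sum>S\<in>UNIV. \<Sum>i\<in>UNIV. \<Sum>j\<in>UNIV. t E S i j * residual E S i j) = 0"
proof -
  obtain \<tau> th where *: "\<tau> \<in> X_space \<Omega> \<Gamma>N T" "\<And>E. E \<in> T \<Longrightarrow> is_hat E \<tau> (th E)"
    "\<And>E S i j. th E (vert S) $ i $ j = t E S i j"
    using X_space_construct[of t \<Gamma>N, OF flux N] by blast
  have "u E \<bullet> hat_div (th E) = (\<Sum>S\<in>UNIV. \<Sum>i\<in>UNIV. \<Sum>j\<in>UNIV. t E S i j * (vsign S j / 4 * u E $ i))" for E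
  proof -
    have "u E \<bullet> hat_div (th E) = (\<Sum>i\<in>UNIV. \<Sum>S\<in>UNIV. \<Sum>j\<in>UNIV. t E S i j * (vsign S j / 4 * u E $ i))"
      unfolding inner_vec_def hat_div_def *(3) by (simp add: sum_distrib_left mult_ac)
    also have "\<dots> = (\<Sum>S\<in>UNIV. \<Sum>i\<in>UNIV. \<Sum>j\<in>UNIV. t E S i j * (vsign S j / 4 * u E $ i))"
      by (rule sum.swap)
    finally show ?thesis .
  qed
  moreover have "quad T \<gamma> \<tau> = (\<Sum>E\<in>T. \<Sum>S\<in>UNIV. \<Sum>i\<in>UNIV. \<Sum>j\<in>UNIV.
    t E S i j * ((G E S *v column j (jac E)) $ i / 8))"
    using quad_hat[of \<tau> th \<gamma>] *(2,3) by simp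
  ultimately show ?thesis
    using orth[OF *(1,2)] by (simp add: residual_def distrib_left sum.distrib)
qed

text \<open>A single normal component at one vertex is admissible because test functions vanish on
  the frontier and the face is not on \<Gamma>N. So the residual itself is 0, and its weights 1/4
  and 1/8 leave the factor 1/2.\<close>

lemma boundary_equation:
  assumes E: "E \<in> T" and F: "face E j (of_bool (j \<in> S)) \<subseteq> frontier \<Omega>" "\<not> face E j (of_bool (j \<in> S)) \<subseteq> \<Gamma>N"
  shows "u E = (1/2) *\<^sub>R (G E S *v edge E S j)"
proof -
  note cE = mesh_cuboid[OF E]
  have zero: "face_integral E S j \<phi> = 0" if \<phi>: "test_function \<Omega> \<phi>" for \<phi>
  proof -
    have "\<phi> (ref_map E (set_coord j (vert S $ j) x)) = 0" if "x \<in> ref_cube" for x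
    proof -
      have "ref_map E (set_coord j (vert S $ j) x) \<in> face E j (of_bool (j \<in> S))"
        unfolding ref_map_in_face[OF cE] using that by (intro conjI set_coord_in_ref_cube) auto
      then have "ref_map E (set_coord j (vert S $ j) x) \<notin> \<Omega>"
        using F(1) open_domain by (auto simp: frontier_def interior_open)
      then show ?thesis by (rule test_function_outside[OF \<phi>])
    qed
    then have "face_integral E S j \<phi> = integral ref_cube (\<lambda>x. 0)"
      unfolding face_integral_def Let_def by (intro integral_cong) simp
    then show ?thesis by simp
  qed
  have r: "residual E S i j = 0" for i
  proof -
    have "(\<Sum>E'\<in>T. \<Sum>S'\<in>UNIV. \<Sum>i'\<in>UNIV. \<Sum>j'\<in>UNIV. single E S i j 1 E' S' i' j' * residual E' S' i' j') = 0"
    proof (rule residual_sum)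
      show "(\<Sum>E'\<in>T. \<Sum>S'\<in>UNIV. \<Sum>j'\<in>UNIV. vsign S' j' * single E S i j 1 E' S' i' j' * face_integral E' S' j' \<phi>) = 0"
        if "test_function \<Omega> \<phi>" for \<phi> i'
        unfolding sum_single3[OF finite_mesh E] using zero[OF that] by simp
      show "single E S i j 1 E' S' i' j' = 0" if "face E' j' (of_bool (j' \<in> S')) \<subseteq> \<Gamma>N" for E' S' i' j'
        using that F(2) by (auto simp: single_def)
    qed
    then show ?thesis unfolding sum_single4[OF finite_mesh E] by simp
  qed
  have "u E $ i = ((1/2) *\<^sub>R (G E S *v edge E S j)) $ i" for i
    using r[of i] unfolding residual_def matrix_mult_edge
    by (cases "j \<in> S") (simp_all add: vsign_def)
  then show ?thesis by (simp add: vec_eq_iff)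
qed

text \<open>Opposite fluxes on the two sides of a shared vertex are admissible by
  \<open>face_integral_eq\<close>, which makes the signed residuals of both sides equal. The edge of
  \<open>E'\<close> across the face is -\<mu> times that of \<open>E\<close>, with \<mu> the ratio
  of their lengths; this gives the factor (1 + \<mu>) / 2, the same for all vertices of the
  face.\<close>

lemma interior_equation:
  assumes E: "E \<in> T" and F: "\<not> face E j (of_bool b) \<subseteq> frontier \<Omega>"
    and E': "E' \<in> T" "E' \<noteq> E" "cell E \<inter> cell E' = face E j (of_bool b)"
  obtains \<mu> where "0 < \<mu>"
    "\<forall>S. (j \<in> S \<longleftrightarrow> b) \<longrightarrow> (\<exists>S'. G E' S' = G E S) \<and> u E - u E' = ((1 + \<mu>) / 2) *\<^sub>R (G E S *v edge E S j)"
proof -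
  note cE = mesh_cuboid[OF E] and cE' = mesh_cuboid[OF E'(1)]
  have s: "of_bool b \<in> {0, 1::real}" by auto
  obtain j' s' where F': "s' \<in> {0, 1}" "face E' j' s' = face E j (of_bool b)"
    by (rule shared_face_is_face[OF E s E'])
  obtain b' where b': "s' = of_bool b'" by (rule that[of "s' = 1"]) (use F'(1) in auto)
  define \<mu> where "\<mu> = norm (column j' (jac E')) / norm (column j (jac E))"
  have mu: "0 < \<mu>" using cuboid_column(1)[OF cE] cuboid_column(1)[OF cE'] by (simp add: \<mu>_def)
  have "(\<exists>S'. G E' S' = G E S) \<and> u E - u E' = ((1 + \<mu>) / 2) *\<^sub>R (G E S *v edge E S j)" if S: "j \<in> S \<longleftrightarrow> b" for S
  proof -
    obtain S' \<rho> where jS': "j' \<in> S' \<longleftrightarrow> b'" and S1: "ref_map E' (vert S') = ref_map E (vert S)" and \<rho>: "bij \<rho>" "\<rho> j' = j"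
      and e: "\<forall>k. k \<noteq> j' \<longrightarrow> edge E' S' k = edge E S (\<rho> k)"
      and S2: "edge E' S' j' = - (norm (column j' (jac E')) / norm (column j (jac E))) *\<^sub>R edge E S j"
      by (rule shared_face_vertex[OF E E' F'(2)[unfolded b'] S])
    have FI: "face_integral E S j \<phi> = face_integral E' S' j' \<phi>" if "test_function \<Omega> \<phi>" for \<phi>
      by (rule face_integral_eq[OF test_function_C1(2)[OF that] S1 \<rho>]) (use e in blast)
    have "face E j (of_bool b) \<subseteq> cell E'" using E'(3) by blast
    from W1_trace_shared[OF \<gamma> E E'(1) F this S] have G: "G E' S' = G E S" unfolding S1 ..
    \<comment> \<open>The signs make the outward flux 1 for \<open>E\<close> and -1 for
      \<open>E'\<close>, so that the two equal face integrals cancel.\<close>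
    let ?t = "\<lambda>i E1 S1 i1 j1. single E S i j (vsign S j) E1 S1 i1 j1 + single E' S' i j' (- vsign S' j') E1 S1 i1 j1"
    have r: "vsign S j * residual E S i j - vsign S' j' * residual E' S' i j' = 0" for i
    proof -
      have "(\<Sum>E1\<in>T. \<Sum>S1\<in>UNIV. \<Sum>i1\<in>UNIV. \<Sum>j1\<in>UNIV. ?t i E1 S1 i1 j1 * residual E1 S1 i1 j1) = 0"
      proof (rule residual_sum)
        show "(\<Sum>E1\<in>T. \<Sum>S1\<in>UNIV. \<Sum>j1\<in>UNIV. vsign S1 j1 * ?t i E1 S1 i1 j1 * face_integral E1 S1 j1 \<phi>) = 0"
          if "test_function \<Omega> \<phi>" for \<phi> i1
          unfolding distrib_left distrib_right sum.distrib sum_single3[OF finite_mesh E] sum_single3[OF finite_mesh E'(1)]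
          using FI[OF that] by simp
        show "?t i E1 S1 i1 j1 = 0" if N: "face E1 j1 (of_bool (j1 \<in> S1)) \<subseteq> \<Gamma>N" for E1 S1 i1 j1
        proof -
          have n: "\<not> face E j (of_bool b) \<subseteq> \<Gamma>N" using F N_subset by blast
          have "\<not> (E1 = E \<and> S1 = S \<and> j1 = j)" using N n S by auto
          moreover have "\<not> (E1 = E' \<and> S1 = S' \<and> j1 = j')" using N n jS' F'(2) b' by auto
          ultimately show ?thesis by (auto simp: single_def)
        qed
      qed
      then show ?thesis
        unfolding distrib_right sum.distrib sum_single4[OF finite_mesh E] sum_single4[OF finite_mesh E'(1)] by simp
    qed
    have v: "vsign S j * residual E S i j = u E $ i / 4 - (G E S *v edge E S j) $ i / 8" for E S i j
      unfolding residual_def matrix_mult_edge by (simp add: vsign_def)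
    have "u E $ i - u E' $ i = (((1 + \<mu>) / 2) *\<^sub>R (G E S *v edge E S j)) $ i" for i
      using r[of i] unfolding v G S2 \<mu>_def[symmetric] matrix_vector_mult_scaleR
      by (simp add: field_simps)
    then have "u E - u E' = ((1 + \<mu>) / 2) *\<^sub>R (G E S *v edge E S j)" by (simp add: vec_eq_iff)
    then show ?thesis using G by blast
  qed
  then show ?thesis using that mu by blast
qed

text \<open>In both equations a nonzero multiple of \<open>G E S *v edge E S j\<close> equals a
  vector that is the same for all vertices of the face: \<open>u E\<close> itself or the jump of
  \<open>u\<close>.\<close>

lemma face_constant:
  assumes E: "E \<in> T" and F: "\<not> face E j (of_bool b) \<subseteq> \<Gamma>N" and S: "(j \<in> S) = b" "(j \<in> S') = b"
  shows "G E S *v column j (jac E) = G E S' *v column j (jac E)"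
proof -
  have "\<exists>c k. c \<noteq> 0 \<and> (\<forall>S. (j \<in> S) = b \<longrightarrow> c *\<^sub>R (G E S *v edge E S j) = k)"
  proof (cases "face E j (of_bool b) \<subseteq> frontier \<Omega>")
    case True
    have "(1/2) *\<^sub>R (G E S *v edge E S j) = u E" if "(j \<in> S) = b" for S
      using boundary_equation[OF E, of j S] True F that by simp
    then show ?thesis by (intro exI[of _ "1/2"] exI[of _ "u E"]) simp
  next
    case False
    have s: "of_bool b \<in> {0, 1::real}" by auto
    obtain E' where E': "E' \<in> T" "E' \<noteq> E" "cell E \<inter> cell E' = face E j (of_bool b)"
      by (rule exists_neighbour[OF E False s])
    obtain \<mu> where "0 < \<mu>"
      "\<forall>S. (j \<in> S \<longleftrightarrow> b) \<longrightarrow> (\<exists>S'. G E' S' = G E S) \<and> u E - u E' = ((1 + \<mu>) / 2) *\<^sub>R (G E S *v edge E S j)"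
      by (rule interior_equation[OF E False E'])
    then show ?thesis by (intro exI[of _ "(1 + \<mu>) / 2"] exI[of _ "u E - u E'"]) auto
  qed
  then obtain c k where c: "c \<noteq> 0" "\<And>S. (j \<in> S) = b \<Longrightarrow> c *\<^sub>R (G E S *v edge E S j) = k" by blast
  have "c *\<^sub>R (G E S *v edge E S j) = c *\<^sub>R (G E S' *v edge E S' j)" using c(2)[OF S(1)] c(2)[OF S(2)] by simp
  then have "G E S *v edge E S j = G E S' *v edge E S' j" using c(1) by simp
  moreover have "vsign S j = vsign S' j" "vsign S j \<noteq> 0" using S by (auto simp: vsign_def)
  ultimately show ?thesis unfolding matrix_mult_edge by simp
qed

lemma G_constant: "E \<in> T \<Longrightarrow> G E S = G E S'"
proof -
  assume E: "E \<in> T"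
  obtain bad where bad: "\<And>j b. face E j (of_bool b) \<subseteq> \<Gamma>N \<Longrightarrow> (j, b) = bad" by (rule bad_face[OF E]) blast
  show ?thesis
  proof (rule skew_constant[where G = "G E", OF mesh_cuboid[OF E], where bad = bad])
    show "transpose (G E S) = - G E S" for S by (rule W1_trace_skew[OF \<gamma> E])
    show "G E S *v column j (jac E) = G E S' *v column j (jac E)"
      if "(j, b) \<noteq> bad" "(j \<in> S) = b" "(j \<in> S') = b" for j b S S'
      using face_constant[OF E _ that(2,3)] bad that(1) by blast
  qed
qed

text \<open>A shared vertex carries the same value of \<gamma> from both sides, and that value is
  the one on the whole of each element. Where it vanishes, so does the jump of
  \<open>u\<close>.\<close>

lemma neighbour_G:
  assumes E: "E \<in> T" and F: "\<not> face E j (of_bool b) \<subseteq> frontier \<Omega>"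
    and E': "E' \<in> T" "E' \<noteq> E" "cell E \<inter> cell E' = face E j (of_bool b)"
  shows "G E' {} = G E {}" and "G E {} = 0 \<Longrightarrow> u E' = u E"
proof -
  obtain \<mu> where mu: "0 < \<mu>"
      "\<forall>S. (j \<in> S \<longleftrightarrow> b) \<longrightarrow> (\<exists>S'. G E' S' = G E S) \<and> u E - u E' = ((1 + \<mu>) / 2) *\<^sub>R (G E S *v edge E S j)"
    by (rule interior_equation[OF E F E'])
  define S where "S = (if b then {j} else {})"
  have "j \<in> S \<longleftrightarrow> b" by (simp add: S_def)
  then obtain S' where S': "G E' S' = G E S" "u E - u E' = ((1 + \<mu>) / 2) *\<^sub>R (G E S *v edge E S j)"
    using mu(2) by blast
  show "G E' {} = G E {}" using S'(1) G_constant[OF E, of S "{}"] G_constant[OF E'(1), of S' "{}"] by simp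
  show "u E' = u E" if "G E {} = 0" using S'(2) G_constant[OF E, of S "{}"] that by simp
qed

lemma two_boundary_faces:
  assumes E: "E \<in> T" and F: "\<And>j. face E j (of_bool (j \<in> S)) \<subseteq> frontier \<Omega>"
  obtains a b where "a \<noteq> b" "u E = (1/2) *\<^sub>R (G E {} *v edge E S a)" "u E = (1/2) *\<^sub>R (G E {} *v edge E S b)"
proof -
  obtain bad where bad: "\<And>j b. face E j (of_bool b) \<subseteq> \<Gamma>N \<Longrightarrow> (j, b) = bad" by (rule bad_face[OF E]) blast
  \<comment> \<open>A face on \<Gamma>N can only be orthogonal to the direction of
    \<open>bad\<close>; the other two directions supply the boundary equation.\<close>
  obtain a b where ab: "a \<noteq> fst bad" "b \<noteq> fst bad" "a \<noteq> b" using other_indices by blast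
  have "u E = (1/2) *\<^sub>R (G E {} *v edge E S k)" if "k \<noteq> fst bad" for k
  proof -
    have "\<not> face E k (of_bool (k \<in> S)) \<subseteq> \<Gamma>N" using bad that by fastforce
    then show ?thesis using boundary_equation[OF E F] G_constant[OF E, of S "{}"] by simp
  qed
  then show ?thesis using that ab by blast
qed

lemma G_zero: assumes E: "E \<in> T" shows "G E S = 0"
proof (rule ccontr)
  assume n: "G E S \<noteq> 0"
  define G0 where "G0 = G E {}"
  have G0: "G0 \<noteq> 0" using n G_constant[OF E, of S "{}"] by (simp add: G0_def)
  \<comment> \<open>All elements with this value of \<gamma>, instead of a connected component:
    being closed under shared faces is what \<open>corner_exists\<close> asks for.\<close>
  let ?C = "{E \<in> T. G E {} = G0}"
  have "transpose G0 = - G0" unfolding G0_def by (rule W1_trace_skew[OF \<gamma> E])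
  then obtain g where g: "\<And>v. G0 *v v = cross3 g v" using skew_matrix_axis by blast
  have "?C \<subseteq> T" "?C \<noteq> {}" using E by (auto simp: G0_def)
  moreover have "E' \<in> ?C" if "E \<in> ?C" "E' \<in> T" "E' \<noteq> E" "\<not> face E j (of_bool b) \<subseteq> frontier \<Omega>"
      "cell E \<inter> cell E' = face E j (of_bool b)" for E E' j b
    using neighbour_G(1)[OF _ that(4) that(2,3,5)] that(1,2) by simp
  ultimately obtain E1 S1 where E1: "E1 \<in> ?C" "\<And>j. face E1 j (of_bool (j \<in> S1)) \<subseteq> frontier \<Omega>" "\<And>j. g \<bullet> edge E1 S1 j \<le> 0"
    using corner_exists[of ?C g] by blast
  have T1: "E1 \<in> T" and G1: "G E1 {} = G0" using E1(1) by auto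
  obtain a b where ab: "a \<noteq> b" "u E1 = (1/2) *\<^sub>R (G E1 {} *v edge E1 S1 a)" "u E1 = (1/2) *\<^sub>R (G E1 {} *v edge E1 S1 b)"
    using two_boundary_faces[OF T1 E1(2)] by blast
  let ?a = "edge E1 S1 a" and ?b = "edge E1 S1 b"
  let ?d = "?a - ?b"
  note c1 = mesh_cuboid[OF T1]
  have "(1/2) *\<^sub>R (G0 *v ?a) = (1/2) *\<^sub>R (G0 *v ?b)" using ab(2,3) G1 by metis
  then have "G0 *v ?a = G0 *v ?b" by (simp only: scaleR_cancel_left) simp
  then have "G0 *v ?d = 0" by (simp add: matrix_vector_mult_diff_distrib)
  \<comment> \<open>Since the cross product of \<open>g\<close> and \<open>?d\<close> vanishes, the
    two are parallel; the double cross product expresses this without a division.\<close>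
  then have "cross3 ?d (cross3 g ?d) = 0" by (simp add: g)
  then have par: "(?d \<bullet> ?d) *\<^sub>R g = (?d \<bullet> g) *\<^sub>R ?d" by (simp add: Lagrange)
  have o: "?a \<bullet> ?b = 0" using edge_orthogonal[OF c1 ab(1)] .
  have da: "?d \<bullet> ?a = ?a \<bullet> ?a" and db: "?d \<bullet> ?b = - (?b \<bullet> ?b)"
    using o by (simp_all add: inner_diff_left inner_commute[of ?b ?a])
  have pa: "0 < ?a \<bullet> ?a" and pb: "0 < ?b \<bullet> ?b" using edge_nonzero[OF c1] by simp_all
  have dd: "0 \<le> ?d \<bullet> ?d" by simp
  have ea: "(?d \<bullet> ?d) * (g \<bullet> ?a) = (?d \<bullet> g) * (?a \<bullet> ?a)"
    using arg_cong[OF par, of "\<lambda>v. v \<bullet> ?a"] da by simp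
  have eb: "(?d \<bullet> ?d) * (g \<bullet> ?b) = - ((?d \<bullet> g) * (?b \<bullet> ?b))"
    using arg_cong[OF par, of "\<lambda>v. v \<bullet> ?b"] db by simp
  \<comment> \<open>\<open>?a\<close> and \<open>?b\<close> are orthogonal, so \<open>?d\<close> has
    a positive product with \<open>?a\<close> and a negative one with \<open>?b\<close>. As
    \<open>g\<close> has nonpositive products with both, \<open>?d \<bullet> g\<close> can only be
    0.\<close>
  have "(?d \<bullet> g) * (?a \<bullet> ?a) \<le> 0" using mult_nonneg_nonpos[OF dd E1(3)[of a]] ea by simp
  moreover have "0 \<le> (?d \<bullet> g) * (?b \<bullet> ?b)" using mult_nonneg_nonpos[OF dd E1(3)[of b]] eb by simp
  ultimately have "?d \<bullet> g = 0"
    using pa pb by (meson antisym mult_le_0_iff zero_le_mult_iff not_le order.asym)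
  then have "(?d \<bullet> ?d) *\<^sub>R g = 0" using par by simp
  moreover have "?d \<bullet> ?d \<noteq> 0"
  proof
    assume "?d \<bullet> ?d = 0"
    then have "?d = 0" by simp
    then show False using da pa by simp
  qed
  ultimately have "g = 0" by simp
  then have "G0 *v v = 0 *v v" for v by (simp add: g)
  then have "G0 = 0" by (metis matrix_eq)
  then show False using G0 by simp
qed

text \<open>With \<gamma> = 0 there are no jumps of \<open>u\<close>, so the elements with the value
  \<open>u E\<close> are closed under shared faces and have a corner. Any corner serves, whence the
  objective 0 in \<open>corner_exists\<close>, and the boundary equation there forces the value
  0.\<close>

lemma u_zero: assumes E: "E \<in> T" shows "u E = 0"
proof (rule ccontr)
  assume n: "u E \<noteq> 0"
  let ?C = "{E' \<in> T. u E' = u E}"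
  have "?C \<subseteq> T" "?C \<noteq> {}" using E by auto
  moreover have "E' \<in> ?C" if "E1 \<in> ?C" "E' \<in> T" "E' \<noteq> E1" "\<not> face E1 j (of_bool b) \<subseteq> frontier \<Omega>"
      "cell E1 \<inter> cell E' = face E1 j (of_bool b)" for E1 E' j b
    using neighbour_G(2)[OF _ that(4) that(2,3,5)] G_zero that(1,2) by simp
  ultimately obtain E1 S1 where E1: "E1 \<in> ?C" "\<And>j. face E1 j (of_bool (j \<in> S1)) \<subseteq> frontier \<Omega>" "\<And>j. 0 \<bullet> edge E1 S1 j \<le> 0"
    using corner_exists[of ?C 0] by blast
  then have T1: "E1 \<in> T" by simp
  obtain a where "u E1 = (1/2) *\<^sub>R (G E1 {} *v edge E1 S1 a)"
    using two_boundary_faces[OF T1 E1(2)] by blast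
  then have "u E1 = 0" using G_zero[OF T1] by simp
  then show False using E1(1) n by simp
qed

end

section \<open>Linear structure of the discrete spaces\<close>

lemma ERT0_lincomb:
  assumes "v \<in> ERT0" "w \<in> ERT0" shows "(\<lambda>x. a *\<^sub>R v x + b *\<^sub>R w x) \<in> ERT0"
proof -
  obtain \<alpha> \<beta> c \<alpha>' \<beta>' c' where v: "v = ert \<alpha> \<beta> c" and w: "w = ert \<alpha>' \<beta>' c'"
    using assms unfolding ERT0_eq by blast
  have "(\<lambda>x. a *\<^sub>R v x + b *\<^sub>R w x) =
      ert (a *\<^sub>R \<alpha> + b *\<^sub>R \<alpha>') (a *\<^sub>R \<beta> + b *\<^sub>R \<beta>') (\<lambda>i S. a * c i S + b * c' i S)"
    unfolding fun_eq_iff vec_eq_iff forall_3 v w vector_add_component vector_scaleR_component ert_component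
    by (simp add: algebra_simps)
  then show ?thesis unfolding ERT0_eq by blast
qed

lemma trilinear_lincomb:
  assumes "p \<in> trilinear" "q \<in> trilinear" shows "(\<lambda>x. a * p x + b * q x) \<in> trilinear"
proof -
  obtain c d where "p = trilin c" "q = trilin d" using assms unfolding trilinear_iff by blast
  then have "(\<lambda>x. a * p x + b * q x) = trilin (\<lambda>S. a * c S + b * d S)"
    by (simp add: fun_eq_iff trilin_def sum.distrib sum_distrib_left algebra_simps)
  then show ?thesis unfolding trilinear_iff by blast
qed

lemma piola_lincomb: "piola E (\<lambda>x. a *\<^sub>R \<sigma> x + b *\<^sub>R \<tau> x) x = a *\<^sub>R piola E \<sigma> x + b *\<^sub>R piola E \<tau> x"
  by (simp add: piola_def vec_eq_iff matrix_vector_right_distrib matrix_vector_mult_scaleR algebra_simps)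

lemma is_hat_lincomb:
  assumes "is_hat E \<sigma> sh" "is_hat E \<tau> th"
  shows "is_hat E (\<lambda>x. a *\<^sub>R \<sigma> x + b *\<^sub>R \<tau> x) (\<lambda>x. a *\<^sub>R sh x + b *\<^sub>R th x)"
  using assms ERT0_lincomb[of "\<lambda>x. sh x $ i" "\<lambda>x. th x $ i" a b for i]
  by (simp add: is_hat_def piola_lincomb)

context cuboid_domain
begin

lemma X_space_hats:
  assumes "\<tau> \<in> X_space \<Omega> \<Gamma>N T"
  obtains th where "\<forall>E\<in>T. is_hat E \<tau> (th E)"
proof -
  have "\<forall>E\<in>T. \<exists>th. is_hat E \<tau> th" using assms unfolding X_space_iff by blast
  then show ?thesis using that by metis
qed

text \<open>\<open>Lim\<close> is additive only where limits exist; the reference fields provide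
  them.\<close>

lemma X_space_trace_lincomb:
  assumes "\<sigma> \<in> X_space \<Omega> \<Gamma>N T" "\<tau> \<in> X_space \<Omega> \<Gamma>N T" "E \<in> T" "y \<in> cell E"
  shows "trace_from E (\<lambda>x. a *\<^sub>R \<sigma> x + b *\<^sub>R \<tau> x) y = a *\<^sub>R trace_from E \<sigma> y + b *\<^sub>R trace_from E \<tau> y"
proof -
  obtain sh where s: "\<forall>E\<in>T. is_hat E \<sigma> (sh E)" by (rule X_space_hats[OF assms(1)])
  obtain th where t: "\<forall>E\<in>T. is_hat E \<tau> (th E)" by (rule X_space_hats[OF assms(2)])
  note cE = mesh_cuboid[OF assms(3)]
  obtain x where x: "y = ref_map E x" "x \<in> ref_cube" using assms(4) by (auto simp: cell_def)
  have h: "is_hat E \<sigma> (sh E)" "is_hat E \<tau> (th E)" using s t assms(3) by auto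
  show ?thesis
    unfolding x(1) is_hat_trace[OF cE h(1) x(2)] is_hat_trace[OF cE h(2) x(2)]
      is_hat_trace[OF cE is_hat_lincomb[OF h] x(2)] by (rule piola_lincomb)
qed

lemma test_function_bounded:
  assumes "test_function \<Omega> \<phi>"
  obtains B where "\<And>x. \<bar>\<phi> x\<bar> \<le> B"
proof -
  let ?K = "closure {x. \<phi> x \<noteq> 0}"
  have "compact ?K" using assms by (simp add: test_function_def)
  then have "compact (\<phi> ` ?K)" by (rule compact_continuous_image[OF test_function_C1(2)[OF assms]])
  then have "bounded (\<phi> ` ?K)" by (rule compact_imp_bounded)
  then obtain B where "\<forall>y\<in>\<phi> ` ?K. norm y \<le> B" unfolding bounded_iff by blast
  then have B: "\<bar>\<phi> x\<bar> \<le> B" if "x \<in> ?K" for x using that by simp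
  have "\<bar>\<phi> x\<bar> \<le> max B 0" for x
  proof (cases "\<phi> x = 0")
    case False
    then have "x \<in> ?K" using closure_subset[of "{x. \<phi> x \<noteq> 0}"] by blast
    then show ?thesis using B[of x] by simp
  qed simp
  then show ?thesis using that by blast
qed

lemma integrable_test_function_mult:
  fixes d :: "real^3 \<Rightarrow> real^3"
  assumes \<phi>: "test_function \<Omega> \<phi>" and d: "L2_on \<Omega> d"
  shows "integrable (lebesgue_on \<Omega>) (\<lambda>x. \<phi> x *\<^sub>R d x)"
proof -
  obtain B where B: "\<And>x. \<bar>\<phi> x\<bar> \<le> B" using test_function_bounded[OF \<phi>] by blast
  note id = L2_on_integrable[OF d]
  show ?thesis
  proof (rule Bochner_Integration.integrable_bound[OF integrable_scaleR_right[OF id, of B]])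
    show "(\<lambda>x. \<phi> x *\<^sub>R d x) \<in> borel_measurable (lebesgue_on \<Omega>)"
      by (rule borel_measurable_scaleR[OF continuous_imp_measurable_on_sets_lebesgue[OF test_function_C1(2)[OF \<phi>] domain_sets]
            borel_measurable_integrable[OF id]])
    have "\<bar>\<phi> x\<bar> \<le> \<bar>B\<bar>" for x using B[of x] by linarith
    then show "AE x in lebesgue_on \<Omega>. norm (\<phi> x *\<^sub>R d x) \<le> norm (B *\<^sub>R d x)"
      by (simp add: mult_right_mono)
  qed
qed

text \<open>Linearity of the weak divergence requires the integrability of all products involved,
  which \<open>integral_grad\<close> and \<open>integrable_test_function_mult\<close>
  supply.\<close>

lemma X_space_lincomb:
  assumes \<sigma>: "\<sigma> \<in> X_space \<Omega> \<Gamma>N T" and \<tau>: "\<tau> \<in> X_space \<Omega> \<Gamma>N T"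
  shows "(\<lambda>x. a *\<^sub>R \<sigma> x + b *\<^sub>R \<tau> x) \<in> X_space \<Omega> \<Gamma>N T" (is "?\<rho> \<in> _")
proof -
  obtain sh where sh: "\<forall>E\<in>T. is_hat E \<sigma> (sh E)" by (rule X_space_hats[OF \<sigma>])
  obtain th where th: "\<forall>E\<in>T. is_hat E \<tau> (th E)" by (rule X_space_hats[OF \<tau>])
  have hats: "is_hat E ?\<rho> (\<lambda>x. a *\<^sub>R sh E x + b *\<^sub>R th E x)" if "E \<in> T" for E
    using sh th that by (intro is_hat_lincomb) auto
  have "L2_on \<Omega> ?\<rho>"
  proof (rule L2_on_piecewise_continuous)
    fix E assume E: "E \<in> T"
    show "continuous_on (cell E) (\<lambda>y. piola E (\<lambda>x. a *\<^sub>R sh E x + b *\<^sub>R th E x) (ref_coord E y))"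
      using hats[OF E] by (intro is_hat_continuous) (simp add: is_hat_def)
    show "?\<rho> x = piola E (\<lambda>x. a *\<^sub>R sh E x + b *\<^sub>R th E x) (ref_coord E x)" if "x \<in> interior (cell E)" for x
      using hats[OF E] that mesh_cuboid[OF E] by (auto simp: interior_cell is_hat_def)
  qed
  moreover have "\<exists>d. has_L2_div \<Omega> ?\<rho> d"
  proof -
    obtain d e where d: "has_L2_div \<Omega> \<sigma> d" and e: "has_L2_div \<Omega> \<tau> e"
      using \<sigma> \<tau> unfolding X_space_iff by blast
    have L2: "L2_on \<Omega> d" "L2_on \<Omega> e" using d e by (simp_all add: has_L2_div_def)
    let ?f = "\<lambda>x. a *\<^sub>R d x + b *\<^sub>R e x"
    have "L2_on \<Omega> ?f"
      unfolding L2_on_def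
    proof
      have m: "d \<in> borel_measurable (lebesgue_on \<Omega>)" "e \<in> borel_measurable (lebesgue_on \<Omega>)"
        using L2 by (simp_all add: L2_on_def)
      then show mf: "?f \<in> borel_measurable (lebesgue_on \<Omega>)" by measurable
      show "integrable (lebesgue_on \<Omega>) (\<lambda>x. (norm (?f x))\<^sup>2)"
      proof (rule Bochner_Integration.integrable_bound)
        show "integrable (lebesgue_on \<Omega>) (\<lambda>x. 2 * a\<^sup>2 * (norm (d x))\<^sup>2 + 2 * b\<^sup>2 * (norm (e x))\<^sup>2)"
          using L2 by (simp add: L2_on_def)
        show "(\<lambda>x. (norm (?f x))\<^sup>2) \<in> borel_measurable (lebesgue_on \<Omega>)" using mf by measurable
        have "(norm (?f x))\<^sup>2 \<le> 2 * a\<^sup>2 * (norm (d x))\<^sup>2 + 2 * b\<^sup>2 * (norm (e x))\<^sup>2" for x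
        proof -
          have "norm (?f x) \<le> \<bar>a\<bar> * norm (d x) + \<bar>b\<bar> * norm (e x)"
            using norm_triangle_ineq[of "a *\<^sub>R d x" "b *\<^sub>R e x"] by simp
          then have "(norm (?f x))\<^sup>2 \<le> (\<bar>a\<bar> * norm (d x) + \<bar>b\<bar> * norm (e x))\<^sup>2"
            by (rule power_mono) simp
          also have "\<dots> \<le> 2 * (\<bar>a\<bar> * norm (d x))\<^sup>2 + 2 * (\<bar>b\<bar> * norm (e x))\<^sup>2"
            using zero_le_power2[of "\<bar>a\<bar> * norm (d x) - \<bar>b\<bar> * norm (e x)"] by (simp add: power2_sum power2_diff)
          finally show ?thesis by (simp add: power_mult_distrib)
        qed
        note bound = this
        show "AE x in lebesgue_on \<Omega>. norm ((norm (?f x))\<^sup>2) \<le> norm (2 * a\<^sup>2 * (norm (d x))\<^sup>2 + 2 * b\<^sup>2 * (norm (e x))\<^sup>2)"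
        proof (intro AE_I2)
          fix x
          have "norm ((norm (?f x))\<^sup>2) = (norm (?f x))\<^sup>2" by simp
          also note bound[of x]
          also note abs_ge_self
          finally show "norm ((norm (?f x))\<^sup>2) \<le> norm (2 * a\<^sup>2 * (norm (d x))\<^sup>2 + 2 * b\<^sup>2 * (norm (e x))\<^sup>2)"
            unfolding real_norm_def .
        qed
      qed
    qed
    moreover have "(LINT x|lebesgue_on \<Omega>. ?\<rho> x *v grad \<phi> x) = - (LINT x|lebesgue_on \<Omega>. \<phi> x *\<^sub>R ?f x)"
      if \<phi>: "test_function \<Omega> \<phi>" for \<phi>
    proof -
      have hs: "is_hat E \<sigma> (sh E)" and ht: "is_hat E \<tau> (th E)" if "E \<in> T" for E using sh th that by auto
      have i1: "integrable (lebesgue_on \<Omega>) (\<lambda>x. \<sigma> x *v grad \<phi> x)"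
        by (rule integrable_vec) (simp add: matrix_vector_mul_component integral_grad(1)[OF hs \<phi>])
      have i2: "integrable (lebesgue_on \<Omega>) (\<lambda>x. \<tau> x *v grad \<phi> x)"
        by (rule integrable_vec) (simp add: matrix_vector_mul_component integral_grad(1)[OF ht \<phi>])
      note j1 = integrable_test_function_mult[OF \<phi> L2(1)] and j2 = integrable_test_function_mult[OF \<phi> L2(2)]
      have "(LINT x|lebesgue_on \<Omega>. ?\<rho> x *v grad \<phi> x) =
         (LINT x|lebesgue_on \<Omega>. a *\<^sub>R (\<sigma> x *v grad \<phi> x) + b *\<^sub>R (\<tau> x *v grad \<phi> x))"
        by (simp add: matrix_vector_mult_add_rdistrib scaleR_matrix_vector_assoc)
      also have "\<dots> = a *\<^sub>R (LINT x|lebesgue_on \<Omega>. \<sigma> x *v grad \<phi> x) + b *\<^sub>R (LINT x|lebesgue_on \<Omega>. \<tau> x *v grad \<phi> x)"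
        using i1 i2 by simp
      also have "\<dots> = - (a *\<^sub>R (LINT x|lebesgue_on \<Omega>. \<phi> x *\<^sub>R d x) + b *\<^sub>R (LINT x|lebesgue_on \<Omega>. \<phi> x *\<^sub>R e x))"
        using d e \<phi> by (simp add: has_L2_div_def)
      also have "\<dots> = - (LINT x|lebesgue_on \<Omega>. a *\<^sub>R (\<phi> x *\<^sub>R d x) + b *\<^sub>R (\<phi> x *\<^sub>R e x))"
        using j1 j2 by (simp del: scaleR_scaleR)
      also have "(\<lambda>x. a *\<^sub>R (\<phi> x *\<^sub>R d x) + b *\<^sub>R (\<phi> x *\<^sub>R e x)) = (\<lambda>x. \<phi> x *\<^sub>R ?f x)"
        by (simp add: scaleR_add_right mult.commute)
      finally show ?thesis .
    qed
    ultimately show ?thesis unfolding has_L2_div_def by blast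
  qed
  moreover have "trace_from E ?\<rho> y *v normal E j s = 0"
    if "E \<in> T" "s \<in> {0, 1}" "face E j s \<subseteq> \<Gamma>N" "y \<in> face E j s" for E j s y
  proof -
    have "trace_from E \<sigma> y *v normal E j s = 0" "trace_from E \<tau> y *v normal E j s = 0"
      using \<sigma> \<tau> that unfolding X_space_iff by blast+
    moreover have "y \<in> cell E" using that(4) face_subset_cell by blast
    ultimately show ?thesis
      unfolding X_space_trace_lincomb[OF \<sigma> \<tau> that(1) \<open>y \<in> cell E\<close>]
      by (simp add: matrix_vector_mult_add_rdistrib scaleR_matrix_vector_assoc[symmetric])
  qed
  ultimately show ?thesis unfolding X_space_iff using hats by blast
qed

lemma V_space_lincomb:
  assumes "u \<in> V_space T" "v \<in> V_space T"
  shows "(\<lambda>x. a *\<^sub>R u x + b *\<^sub>R v x) \<in> V_space T"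
  unfolding V_space_def mem_Collect_eq
proof
  fix E assume "E \<in> T"
  then obtain c d where "\<forall>x\<in>interior (cell E). u x = c" "\<forall>x\<in>interior (cell E). v x = d"
    using assms unfolding V_space_def by blast
  then show "\<exists>c. \<forall>x\<in>interior (cell E). a *\<^sub>R u x + b *\<^sub>R v x = c" by (intro exI[of _ "a *\<^sub>R c + b *\<^sub>R d"]) simp
qed

lemma W1_space_lincomb:
  assumes v: "v \<in> W1_space \<Omega> T" and w: "w \<in> W1_space \<Omega> T"
  shows "(\<lambda>x. a *\<^sub>R v x + b *\<^sub>R w x) \<in> W1_space \<Omega> T"
proof -
  have "continuous_on \<Omega> (\<lambda>x. a *\<^sub>R v x + b *\<^sub>R w x)"
    using v w unfolding W1_space_def by (intro continuous_intros) auto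
  moreover have "transpose (a *\<^sub>R v x + b *\<^sub>R w x) = - (a *\<^sub>R v x + b *\<^sub>R w x)" if "x \<in> \<Omega>" for x
  proof -
    have "transpose (v x) = - v x" "transpose (w x) = - w x" using v w that by (simp_all add: W1_space_def)
    moreover have "transpose (a *\<^sub>R v x + b *\<^sub>R w x) = a *\<^sub>R transpose (v x) + b *\<^sub>R transpose (w x)"
      by (simp add: transpose_def vec_eq_iff)
    ultimately show ?thesis by simp
  qed
  moreover have "\<exists>p\<in>trilinear. \<forall>x\<in>interior ref_cube. (a *\<^sub>R v (ref_map E x) + b *\<^sub>R w (ref_map E x)) $ i $ j = p x"
    if E: "E \<in> T" for E i j
  proof -
    have tv: "\<forall>E\<in>T. \<forall>i j. \<exists>p\<in>trilinear. \<forall>x\<in>interior ref_cube. v (ref_map E x) $ i $ j = p x"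
      and tw: "\<forall>E\<in>T. \<forall>i j. \<exists>p\<in>trilinear. \<forall>x\<in>interior ref_cube. w (ref_map E x) $ i $ j = p x"
      using v w by (simp_all add: W1_space_def)
    obtain p where "p \<in> trilinear" "\<forall>x\<in>interior ref_cube. v (ref_map E x) $ i $ j = p x"
      using tv[rule_format, OF E] by blast
    moreover obtain q where "q \<in> trilinear" "\<forall>x\<in>interior ref_cube. w (ref_map E x) $ i $ j = q x"
      using tw[rule_format, OF E] by blast
    ultimately show ?thesis by (intro bexI[OF _ trilinear_lincomb[of p q a b]]) auto
  qed
  ultimately show ?thesis unfolding W1_space_def by blast
qed

lemma X_space_zero: "(\<lambda>_. 0) \<in> X_space \<Omega> \<Gamma>N T"
proof -
  have "\<exists>\<tau>. \<tau> \<in> X_space \<Omega> \<Gamma>N T"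
    by (rule X_space_construct[of "\<lambda>_ _ _ _. 0" \<Gamma>N]) auto
  then obtain \<tau> where "\<tau> \<in> X_space \<Omega> \<Gamma>N T" ..
  from X_space_lincomb[OF this this, of 0 0] show ?thesis by simp
qed

lemma V_space_zero: "(\<lambda>_. 0) \<in> V_space T"
  by (auto simp: V_space_def)

lemma W1_space_zero: "(\<lambda>_. 0) \<in> W1_space \<Omega> T"
proof -
  have "trilin (\<lambda>_. 0) = (\<lambda>_. 0)" by (auto simp: trilin_def)
  then have "(\<lambda>_. 0) \<in> trilinear" unfolding trilinear_iff by metis
  moreover have "transpose (0::real^3^3) = 0" by (simp add: transpose_def vec_eq_iff)
  ultimately show ?thesis unfolding W1_space_def by (auto intro!: bexI[of _ "\<lambda>_. 0"])
qed

lemma V_space_trace_lincomb: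
  assumes "u \<in> V_space T" "v \<in> V_space T" "E \<in> T" "y \<in> cell E"
  shows "trace_from E (\<lambda>x. a *\<^sub>R u x + b *\<^sub>R v x) y = a *\<^sub>R trace_from E u y + b *\<^sub>R trace_from E v y"
proof -
  obtain c d where cd: "\<forall>x\<in>interior (cell E). u x = c" "\<forall>x\<in>interior (cell E). v x = d"
    using assms unfolding V_space_def by blast
  note t = trace_from_eq[OF mesh_cuboid[OF assms(3)] assms(4)]
  have "trace_from E (\<lambda>x. a *\<^sub>R u x + b *\<^sub>R v x) y = a *\<^sub>R c + b *\<^sub>R d"
    by (rule t[where g = "\<lambda>_. a *\<^sub>R c + b *\<^sub>R d"]) (auto simp: cd)
  moreover have "trace_from E u y = c" by (rule t[where g = "\<lambda>_. c"]) (auto simp: cd)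
  moreover have "trace_from E v y = d" by (rule t[where g = "\<lambda>_. d"]) (auto simp: cd)
  ultimately show ?thesis by simp
qed

lemma W1_space_trace_lincomb:
  assumes v: "v \<in> W1_space \<Omega> T" and w: "w \<in> W1_space \<Omega> T" and E: "E \<in> T" and y: "y \<in> cell E"
  shows "trace_from E (\<lambda>x. a *\<^sub>R v x + b *\<^sub>R w x) y = a *\<^sub>R trace_from E v y + b *\<^sub>R trace_from E w y"
proof -
  have cont: "\<exists>g. continuous_on (cell E) g \<and> (\<forall>x\<in>interior (cell E). w x = g x)"
    if w: "w \<in> W1_space \<Omega> T" for w
  proof -
    have "\<forall>i j. \<exists>p. p \<in> trilinear \<and> (\<forall>x\<in>interior ref_cube. w (ref_map E x) $ i $ j = p x)"
    proof (intro allI)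
      fix i j
      have "\<forall>E\<in>T. \<forall>i j. \<exists>p\<in>trilinear. \<forall>x\<in>interior ref_cube. w (ref_map E x) $ i $ j = p x"
        using w by (simp add: W1_space_def)
      from this[rule_format, OF E] show "\<exists>p. p \<in> trilinear \<and> (\<forall>x\<in>interior ref_cube. w (ref_map E x) $ i $ j = p x)"
        by blast
    qed
    then obtain p where p: "\<And>i j. p i j \<in> trilinear" "\<And>i j x. x \<in> interior ref_cube \<Longrightarrow> w (ref_map E x) $ i $ j = p i j x"
      by metis
    have "continuous_on UNIV (p i j)" for i j
      using p(1)[of i j] continuous_trilin unfolding trilinear_iff by auto
    then have "continuous_on (cell E) (\<lambda>y. p i j (ref_coord E y))" for i j
      by (rule continuous_on_compose2[OF _ continuous_ref_coord subset_UNIV])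
    then have "continuous_on (cell E) (\<lambda>y. \<chi> i j. p i j (ref_coord E y))" by (intro continuous_on_vec_lambda)
    moreover have "w x = (\<chi> i j. p i j (ref_coord E x))" if "x \<in> interior (cell E)" for x
      using that p(2) mesh_cuboid[OF E] by (auto simp: interior_cell vec_eq_iff)
    ultimately show ?thesis by blast
  qed
  obtain g h where g: "continuous_on (cell E) g" "\<forall>x\<in>interior (cell E). v x = g x"
    and h: "continuous_on (cell E) h" "\<forall>x\<in>interior (cell E). w x = h x" using cont v w by metis
  note t = trace_from_eq[OF mesh_cuboid[OF E] y]
  have "trace_from E (\<lambda>x. a *\<^sub>R v x + b *\<^sub>R w x) y = a *\<^sub>R g y + b *\<^sub>R h y"
    by (rule t[where g = "\<lambda>y. a *\<^sub>R g y + b *\<^sub>R h y"]) (auto simp: g h intro!: continuous_intros)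
  moreover have "trace_from E v y = g y" by (rule t) (auto simp: g)
  moreover have "trace_from E w y = h y" by (rule t) (auto simp: h)
  ultimately show ?thesis by simp
qed

lemma trace_from_const: "E \<in> T \<Longrightarrow> y \<in> cell E \<Longrightarrow> trace_from E (\<lambda>_. c) y = c"
  by (rule trace_from_eq[OF mesh_cuboid, where g = "\<lambda>_. c"]) auto

end

section \<open>Existence and uniqueness\<close>

text \<open>The unit data thus form a finite set that spans the functions supported in
  \<open>K\<close>.\<close>

lemma sum_units:
  fixes f :: "'k \<Rightarrow> 'v::euclidean_space"
  assumes "finite K" "\<And>k. k \<notin> K \<Longrightarrow> f k = 0"
  shows "f = (\<Sum>k\<in>K. \<Sum>b\<in>Basis. (\<lambda>l. (f k \<bullet> b) *\<^sub>R (if l = k then b else 0)))"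
proof
  fix l
  have fin: "(\<Sum>k\<in>K. g k) l = (\<Sum>k\<in>K. g k l)" for g :: "'k \<Rightarrow> 'k \<Rightarrow> 'v" and K :: "'k set"
    by (induction K rule: infinite_finite_induct) auto
  have finb: "(\<Sum>b\<in>B. g b) l = (\<Sum>b\<in>B. g b l)" for g :: "'v \<Rightarrow> 'k \<Rightarrow> 'v" and B :: "'v set"
    by (induction B rule: infinite_finite_induct) auto
  have "(\<Sum>k\<in>K. \<Sum>b\<in>Basis. (f k \<bullet> b) *\<^sub>R (if l = k then b else 0)) = (\<Sum>k\<in>K. if l = k then f k else 0)"
  proof (rule sum.cong[OF refl])
    fix k
    show "(\<Sum>b\<in>Basis. (f k \<bullet> b) *\<^sub>R (if l = k then b else 0)) = (if l = k then f k else 0)"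
      by (cases "l = k") (simp_all add: euclidean_representation)
  qed
  also have "\<dots> = f l" using assms by auto
  finally show "f l = (\<Sum>k\<in>K. \<Sum>b\<in>Basis. (\<lambda>l. (f k \<bullet> b) *\<^sub>R (if l = k then b else 0))) l"
    unfolding fin finb ..
qed

lemma vector_space_fun: "vector_space (\<lambda>a (f :: 'k \<Rightarrow> 'v::real_vector) x. a *\<^sub>R f x)"
  by unfold_locales (auto simp: fun_eq_iff scaleR_add_right scaleR_add_left)

type_synonym vertex_data = "(real^3^3) \<times> (real^3) \<times> (real^3^3)"

text \<open>\<open>hat_div\<close> expressed by the traces of the field: orthogonality of the
  columns recovers each reference value by projection. The bilinear form can then be written in
  vertex data alone.\<close>

definition trace_div :: "cuboid \<Rightarrow> (3 set \<Rightarrow> real^3^3) \<Rightarrow> real^3" where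
  "trace_div E t = (\<chi> i. \<Sum>S\<in>UNIV. \<Sum>j\<in>UNIV. vsign S j / 4 *
     (\<bar>det (jac E)\<bar> * ((t S *v column j (jac E)) $ i) / (column j (jac E) \<bullet> column j (jac E))))"

lemma trace_div_lincomb:
  "trace_div E (\<lambda>S. a *\<^sub>R s S + b *\<^sub>R t S) = a *\<^sub>R trace_div E s + b *\<^sub>R trace_div E t"
proof -
  have "((a *\<^sub>R s S + b *\<^sub>R t S) *v v) $ i = a * (s S *v v) $ i + b * (t S *v v) $ i" for S v i
    by (simp add: matrix_vector_mult_add_rdistrib scaleR_matrix_vector_assoc[symmetric])
  then show ?thesis
    by (simp add: trace_div_def vec_eq_iff sum_distrib_left sum.distrib[symmetric] field_simps add_divide_distrib)
qed

lemma hat_div_trace: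
  assumes E: "is_cuboid E" and th: "is_hat E \<tau> th"
  shows "hat_div th = trace_div E (\<lambda>S. trace_from E \<tau> (ref_map E (vert S)))"
proof -
  have "th (vert S) $ i $ j = \<bar>det (jac E)\<bar> * ((trace_from E \<tau> (ref_map E (vert S)) *v column j (jac E)) $ i) /
      (column j (jac E) \<bullet> column j (jac E))" for S i j
  proof -
    let ?a = "\<lambda>k. column k (jac E)"
    have "(\<Sum>k\<in>UNIV. th (vert S) $ i $ k * (?a k \<bullet> ?a j)) = th (vert S) $ i $ j * (?a j \<bullet> ?a j)"
      by (rule sum_single) (simp_all add: cuboid_column(2)[OF E])
    then have "(jac E *v th (vert S) $ i) \<bullet> ?a j = th (vert S) $ i $ j * (?a j \<bullet> ?a j)"
      by (simp add: matrix_mult_sum scalar_mult_eq_scaleR inner_sum_left)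
    then show ?thesis
      using det_jac[OF E] cuboid_column(1)[OF E, of j]
      by (simp add: is_hat_trace[OF E th] piola_def matrix_vector_mul_component)
  qed
  then show ?thesis by (simp add: hat_div_def trace_div_def)
qed

section \<open>The bilinear form on vertex data\<close>

context msmfe
begin

text \<open>The contribution of one element to the sum of the left-hand sides of all three
  equations; nothing is lost by adding them, since the three test functions vary independently. A
  triple holds the vertex values of \<sigma>, u and \<gamma>; the second is constant on the element
  and is read at the vertex \<open>{}\<close>.\<close>

definition vertex_form :: "cuboid \<Rightarrow> (3 set \<Rightarrow> vertex_data) \<Rightarrow> (3 set \<Rightarrow> vertex_data) \<Rightarrow> real" where
  "vertex_form E p q = \<bar>det (jac E)\<bar> / 8 * (\<Sum>S\<in>UNIV. blinfun_apply (vtrace E A S) (fst (p S)) \<bullet> fst (q S) +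
      snd (snd (p S)) \<bullet> fst (q S) + fst (p S) \<bullet> snd (snd (q S))) +
    fst (snd (p {})) \<bullet> trace_div E (\<lambda>S. fst (q S)) + fst (snd (q {})) \<bullet> trace_div E (\<lambda>S. fst (p S))"

definition vertex_bilinear :: "(cuboid \<times> 3 set \<Rightarrow> vertex_data) \<Rightarrow> (cuboid \<times> 3 set \<Rightarrow> vertex_data) \<Rightarrow> real" where
  "vertex_bilinear z w = (\<Sum>E\<in>T. vertex_form E (\<lambda>S. z (E, S)) (\<lambda>S. w (E, S)))"

lemma vertex_form_lincomb:
  "vertex_form E (\<lambda>S. a *\<^sub>R p S + b *\<^sub>R p' S) q = a * vertex_form E p q + b * vertex_form E p' q"
  "vertex_form E q (\<lambda>S. a *\<^sub>R p S + b *\<^sub>R p' S) = a * vertex_form E q p + b * vertex_form E q p'"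
  unfolding vertex_form_def fst_add snd_add fst_scaleR snd_scaleR trace_div_lincomb
    inner_add_left inner_add_right inner_scaleR_left inner_scaleR_right
    blinfun.add_right blinfun.scaleR_right sum.distrib sum_distrib_left[symmetric]
  by (simp_all add: algebra_simps)

lemma vertex_bilinear_lincomb:
  "vertex_bilinear (\<lambda>x. a *\<^sub>R z x + b *\<^sub>R z' x) w = a * vertex_bilinear z w + b * vertex_bilinear z' w"
  "vertex_bilinear w (\<lambda>x. a *\<^sub>R z x + b *\<^sub>R z' x) = a * vertex_bilinear w z + b * vertex_bilinear w z'"
  by (simp_all add: vertex_bilinear_def vertex_form_lincomb sum.distrib sum_distrib_left)

text \<open>The default 0 outside \<open>T\<close> confines the support to the finite set
  \<open>T \<times> UNIV\<close>.\<close>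

definition vertex_coords :: "(real^3 \<Rightarrow> real^3^3) \<Rightarrow> (real^3 \<Rightarrow> real^3) \<Rightarrow> (real^3 \<Rightarrow> real^3^3) \<Rightarrow> cuboid \<times> 3 set \<Rightarrow> vertex_data" where
  "vertex_coords \<sigma> u \<gamma> = (\<lambda>(E, S). if E \<in> T then (vtrace E \<sigma> S, vtrace E u S, vtrace E \<gamma> S) else 0)"

text \<open>Passing to vertex values identifies functions that agree almost everywhere and makes the trial space
  finite-dimensional.\<close>

definition vertex_space :: "(cuboid \<times> 3 set \<Rightarrow> vertex_data) set" where
  "vertex_space = {vertex_coords \<sigma> u \<gamma> | \<sigma> u \<gamma>. \<sigma> \<in> X_space \<Omega> \<Gamma>N T \<and> u \<in> V_space T \<and> \<gamma> \<in> W1_space \<Omega> T}"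

lemma vert_in_cell: "E \<in> T \<Longrightarrow> ref_map E (vert S) \<in> cell E"
  using mesh_cuboid by simp

lemma vertex_coords_lincomb:
  assumes "\<sigma> \<in> X_space \<Omega> \<Gamma>N T" "u \<in> V_space T" "\<gamma> \<in> W1_space \<Omega> T"
    and "\<sigma>' \<in> X_space \<Omega> \<Gamma>N T" "u' \<in> V_space T" "\<gamma>' \<in> W1_space \<Omega> T"
  shows "(\<lambda>k. a *\<^sub>R vertex_coords \<sigma> u \<gamma> k + b *\<^sub>R vertex_coords \<sigma>' u' \<gamma>' k) =
    vertex_coords (\<lambda>x. a *\<^sub>R \<sigma> x + b *\<^sub>R \<sigma>' x) (\<lambda>x. a *\<^sub>R u x + b *\<^sub>R u' x) (\<lambda>x. a *\<^sub>R \<gamma> x + b *\<^sub>R \<gamma>' x)"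
proof
  fix k :: "cuboid \<times> 3 set"
  obtain E S where k: "k = (E, S)" by fastforce
  show "a *\<^sub>R vertex_coords \<sigma> u \<gamma> k + b *\<^sub>R vertex_coords \<sigma>' u' \<gamma>' k =
    vertex_coords (\<lambda>x. a *\<^sub>R \<sigma> x + b *\<^sub>R \<sigma>' x) (\<lambda>x. a *\<^sub>R u x + b *\<^sub>R u' x) (\<lambda>x. a *\<^sub>R \<gamma> x + b *\<^sub>R \<gamma>' x) k"
  proof (cases "E \<in> T")
    case True
    note y = vert_in_cell[OF True, of S]
    show ?thesis
      using True X_space_trace_lincomb[OF assms(1,4) True y] V_space_trace_lincomb[OF assms(2,5) True y]
        W1_space_trace_lincomb[OF assms(3,6) True y]
      by (simp add: k vertex_coords_def)
  qed (simp add: k vertex_coords_def)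
qed

lemma vertex_space_lincomb:
  assumes "z \<in> vertex_space" "w \<in> vertex_space"
  shows "(\<lambda>k. a *\<^sub>R z k + b *\<^sub>R w k) \<in> vertex_space"
proof -
  obtain \<sigma> u \<gamma> \<sigma>' u' \<gamma>' where z: "z = vertex_coords \<sigma> u \<gamma>" "\<sigma> \<in> X_space \<Omega> \<Gamma>N T" "u \<in> V_space T" "\<gamma> \<in> W1_space \<Omega> T"
    and w: "w = vertex_coords \<sigma>' u' \<gamma>'" "\<sigma>' \<in> X_space \<Omega> \<Gamma>N T" "u' \<in> V_space T" "\<gamma>' \<in> W1_space \<Omega> T"
    using assms unfolding vertex_space_def by blast
  show ?thesis
    unfolding z(1) w(1) vertex_coords_lincomb[OF z(2-4) w(2-4)] unfolding vertex_space_def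
    using X_space_lincomb[OF z(2) w(2)] V_space_lincomb[OF z(3) w(3)] W1_space_lincomb[OF z(4) w(4)] by blast
qed

lemma quad_vertices:
  "quad T \<tau> w = (\<Sum>E\<in>T. \<bar>det (jac E)\<bar> / 8 * (\<Sum>S\<in>UNIV. vtrace E \<tau> S \<bullet> vtrace E w S))"
  unfolding quad_def using mesh_cuboid by (intro sum.cong refl) (simp add: measure_cell sum_vertices)

lemma quad_A_vertices:
  "quad_A T A \<sigma> \<tau> = (\<Sum>E\<in>T. \<bar>det (jac E)\<bar> / 8 * (\<Sum>S\<in>UNIV. blinfun_apply (vtrace E A S) (vtrace E \<sigma> S) \<bullet> vtrace E \<tau> S))"
  unfolding quad_A_def using mesh_cuboid by (intro sum.cong refl) (simp add: measure_cell sum_vertices)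

lemma L2_inner_weak_div_vertices:
  assumes \<tau>: "\<tau> \<in> X_space \<Omega> \<Gamma>N T" and u: "u \<in> V_space T"
  shows "L2_inner \<Omega> u (weak_div \<Omega> \<tau>) = (\<Sum>E\<in>T. vtrace E u {} \<bullet> trace_div E (vtrace E \<tau>))"
    and "L2_inner \<Omega> (weak_div \<Omega> \<tau>) u = (\<Sum>E\<in>T. vtrace E u {} \<bullet> trace_div E (vtrace E \<tau>))"
proof -
  obtain th where "\<forall>E\<in>T. is_hat E \<tau> (th E)" by (rule X_space_hats[OF \<tau>])
  then have th: "is_hat E \<tau> (th E)" if "E \<in> T" for E using that by blast
  have "\<exists>c. (\<forall>E\<in>T. \<forall>x\<in>interior (cell E). u x = c E) \<and> (\<forall>E\<in>T. \<forall>y\<in>cell E. trace_from E u y = c E)"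
    by (rule V_const[OF u]) blast
  then obtain c where c: "\<And>E x. E \<in> T \<Longrightarrow> x \<in> interior (cell E) \<Longrightarrow> u x = c E"
    "\<And>E y. E \<in> T \<Longrightarrow> y \<in> cell E \<Longrightarrow> trace_from E u y = c E" by blast
  have e: "(\<Sum>E\<in>T. c E \<bullet> hat_div (th E)) = (\<Sum>E\<in>T. vtrace E u {} \<bullet> trace_div E (vtrace E \<tau>))"
    by (intro sum.cong refl) (simp add: c(2) vert_in_cell hat_div_trace[OF mesh_cuboid th])
  show "L2_inner \<Omega> u (weak_div \<Omega> \<tau>) = (\<Sum>E\<in>T. vtrace E u {} \<bullet> trace_div E (vtrace E \<tau>))"
    by (rule trans[OF L2_inner_weak_div(1)[OF \<tau> th c(1)] e])
  show "L2_inner \<Omega> (weak_div \<Omega> \<tau>) u = (\<Sum>E\<in>T. vtrace E u {} \<bullet> trace_div E (vtrace E \<tau>))"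
    by (rule trans[OF L2_inner_weak_div(2)[OF \<tau> th c(1)] e])
qed

lemma vertex_bilinear_coords:
  assumes "\<sigma> \<in> X_space \<Omega> \<Gamma>N T" "u \<in> V_space T" "\<tau> \<in> X_space \<Omega> \<Gamma>N T" "v \<in> V_space T"
  shows "vertex_bilinear (vertex_coords \<sigma> u \<gamma>) (vertex_coords \<tau> v w) =
    quad_A T A \<sigma> \<tau> + L2_inner \<Omega> u (weak_div \<Omega> \<tau>) + quad T \<gamma> \<tau> + L2_inner \<Omega> (weak_div \<Omega> \<sigma>) v + quad T \<sigma> w"
  unfolding quad_vertices quad_A_vertices L2_inner_weak_div_vertices(1)[OF assms(3,2)] L2_inner_weak_div_vertices(2)[OF assms(1,4)]
    vertex_bilinear_def sum.distrib[symmetric]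
  by (intro sum.cong refl) (simp add: vertex_form_def vertex_coords_def sum.distrib algebra_simps)

text \<open>Positivity is assumed on \<Omega>; the continuous extension of \<open>A\<close> from the
  interior of an element carries it with the same constant to the vertices, including those on the
  frontier or on an interface.\<close>

lemma compliance_coercive:
  obtains \<alpha> where "0 < \<alpha>" "\<And>E S \<tau>. E \<in> T \<Longrightarrow> \<alpha> * (\<tau> \<bullet> \<tau>) \<le> blinfun_apply (vtrace E A S) \<tau> \<bullet> \<tau>"
proof -
  obtain \<alpha> where a: "0 < \<alpha>" "\<And>x \<tau>. x \<in> \<Omega> \<Longrightarrow> \<alpha> * (\<tau> \<bullet> \<tau>) \<le> blinfun_apply (A x) \<tau> \<bullet> \<tau>"
    using compliance unfolding compliance_tensor_def by blast
  have "\<alpha> * (\<tau> \<bullet> \<tau>) \<le> blinfun_apply (vtrace E A S) \<tau> \<bullet> \<tau>" if E: "E \<in> T" for E S \<tau>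
  proof -
    note cE = mesh_cuboid[OF E]
    obtain B where B: "continuous_on (cell E) B" "\<And>x. x \<in> interior (cell E) \<Longrightarrow> B x = A x"
      using compliance E unfolding compliance_tensor_def by blast
    have "vtrace E A S = B (ref_map E (vert S))"
      by (rule trace_from_eq[OF cE vert_in_cell[OF E] B(1)]) (simp add: B(2))
    moreover have "\<alpha> * (\<tau> \<bullet> \<tau>) \<le> blinfun_apply (B (ref_map E (vert S))) \<tau> \<bullet> \<tau>"
    proof (rule continuous_ge_on_closure[where S = "interior (cell E)" and f = "\<lambda>x. blinfun_apply (B x) \<tau> \<bullet> \<tau>"])
      show "continuous_on (closure (interior (cell E))) (\<lambda>x. blinfun_apply (B x) \<tau> \<bullet> \<tau>)"
        unfolding closure_interior_cell[OF cE] by (intro continuous_intros B(1))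
      show "ref_map E (vert S) \<in> closure (interior (cell E))"
        unfolding closure_interior_cell[OF cE] by (rule vert_in_cell[OF E])
      show "\<alpha> * (\<tau> \<bullet> \<tau>) \<le> blinfun_apply (B x) \<tau> \<bullet> \<tau>" if "x \<in> interior (cell E)" for x
        using a(2)[of x \<tau>] interior_subset_domain[OF E] that B(2)[OF that] by auto
    qed
    ultimately show ?thesis by simp
  qed
  then show ?thesis using that a(1) by blast
qed

lemma quad_A_definite:
  assumes "quad_A T A \<sigma> \<sigma> = 0" "E \<in> T" shows "vtrace E \<sigma> S = 0"
proof -
  obtain \<alpha> where a: "0 < \<alpha>" "\<And>E S \<tau>. E \<in> T \<Longrightarrow> \<alpha> * (\<tau> \<bullet> \<tau>) \<le> blinfun_apply (vtrace E A S) \<tau> \<bullet> \<tau>"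
    using compliance_coercive by blast
  let ?q = "\<lambda>E S. blinfun_apply (vtrace E A S) (vtrace E \<sigma> S) \<bullet> vtrace E \<sigma> S"
  have nn: "0 \<le> ?q E S" if "E \<in> T" for E S
    using a(2)[OF that, of "vtrace E \<sigma> S" S] a(1) by (meson inner_ge_zero less_imp_le mult_nonneg_nonneg order_trans)
  have nn2: "0 \<le> \<bar>det (jac E)\<bar> / 8 * (\<Sum>S\<in>UNIV. ?q E S)" if "E \<in> T" for E
    using nn[OF that] by (intro mult_nonneg_nonneg sum_nonneg) auto
  have "(\<Sum>E\<in>T. \<bar>det (jac E)\<bar> / 8 * (\<Sum>S\<in>UNIV. ?q E S)) = 0"
    using assms(1) unfolding quad_A_vertices .
  then have "\<forall>E\<in>T. \<bar>det (jac E)\<bar> / 8 * (\<Sum>S\<in>UNIV. ?q E S) = 0"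
    by (subst (asm) sum_nonneg_eq_0_iff) (simp_all only: finite_mesh nn2)
  then have "\<bar>det (jac E)\<bar> / 8 * (\<Sum>S\<in>UNIV. ?q E S) = 0" using assms(2) by (rule bspec)
  then have "(\<Sum>S\<in>UNIV. ?q E S) = 0" using det_jac[OF mesh_cuboid[OF assms(2)]] by simp
  then have "?q E S = 0" using nn[OF assms(2)] by (simp add: sum_nonneg_eq_0_iff)
  then have "\<alpha> * (vtrace E \<sigma> S \<bullet> vtrace E \<sigma> S) \<le> 0" using a(2)[OF assms(2), of "vtrace E \<sigma> S" S] by simp
  then have "vtrace E \<sigma> S \<bullet> vtrace E \<sigma> S \<le> 0" using a(1) by (simp only: mult_le_0_iff) linarith
  then have "vtrace E \<sigma> S \<bullet> vtrace E \<sigma> S = 0" by (rule antisym) simp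
  then show ?thesis by (simp only: inner_eq_zero_iff)
qed

lemma vertex_bilinear_kernel:
  assumes z: "z \<in> vertex_space" and 0: "\<And>w. w \<in> vertex_space \<Longrightarrow> vertex_bilinear z w = 0"
  shows "z = (\<lambda>_. 0)"
proof -
  obtain \<sigma> u \<gamma> where zc: "z = vertex_coords \<sigma> u \<gamma>" and \<sigma>: "\<sigma> \<in> X_space \<Omega> \<Gamma>N T" and u: "u \<in> V_space T" and \<gamma>: "\<gamma> \<in> W1_space \<Omega> T"
    using z unfolding vertex_space_def by blast
  have eq: "quad_A T A \<sigma> \<tau> + L2_inner \<Omega> u (weak_div \<Omega> \<tau>) + quad T \<gamma> \<tau> + L2_inner \<Omega> (weak_div \<Omega> \<sigma>) v + quad T \<sigma> w = 0"
    if "\<tau> \<in> X_space \<Omega> \<Gamma>N T" "v \<in> V_space T" "w \<in> W1_space \<Omega> T" for \<tau> v w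
    using 0[of "vertex_coords \<tau> v w"] vertex_bilinear_coords[OF \<sigma> u that(1,2)] that unfolding zc vertex_space_def by auto
  have "(\<lambda>x. (-1) *\<^sub>R u x + 0 *\<^sub>R u x) \<in> V_space T" "(\<lambda>x. (-1) *\<^sub>R \<gamma> x + 0 *\<^sub>R \<gamma> x) \<in> W1_space \<Omega> T"
    by (rule V_space_lincomb[OF u u], rule W1_space_lincomb[OF \<gamma> \<gamma>])
  \<comment> \<open>The test triple (\<sigma>, -u, -\<gamma>) cancels the mixed terms and leaves
    \<open>quad_A T A \<sigma> \<sigma>\<close>.\<close>
  note m = eq[OF \<sigma> this]
  have "L2_inner \<Omega> (weak_div \<Omega> \<sigma>) (\<lambda>x. (-1) *\<^sub>R u x + 0 *\<^sub>R u x) = - L2_inner \<Omega> u (weak_div \<Omega> \<sigma>)"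
    by (simp add: L2_inner_def inner_commute)
  moreover have "quad T \<sigma> (\<lambda>x. (-1) *\<^sub>R \<gamma> x + 0 *\<^sub>R \<gamma> x) = - quad T \<gamma> \<sigma>"
    unfolding quad_vertices sum_negf[symmetric]
  proof (rule sum.cong[OF refl])
    fix E assume E: "E \<in> T"
    show "\<bar>det (jac E)\<bar> / 8 * (\<Sum>S\<in>UNIV. vtrace E \<sigma> S \<bullet> vtrace E (\<lambda>x. (-1) *\<^sub>R \<gamma> x + 0 *\<^sub>R \<gamma> x) S) =
      - (\<bar>det (jac E)\<bar> / 8 * (\<Sum>S\<in>UNIV. vtrace E \<gamma> S \<bullet> vtrace E \<sigma> S))"
      unfolding W1_space_trace_lincomb[OF \<gamma> \<gamma> E vert_in_cell[OF E]]
      by (simp add: sum_negf inner_commute)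
  qed
  ultimately have "quad_A T A \<sigma> \<sigma> = 0" using m by simp
  then have \<sigma>0: "vtrace E \<sigma> S = 0" if "E \<in> T" for E S using quad_A_definite that by blast
  have "\<exists>c. (\<forall>E\<in>T. \<forall>x\<in>interior (cell E). u x = c E) \<and> (\<forall>E\<in>T. \<forall>y\<in>cell E. trace_from E u y = c E)"
    by (rule V_const[OF u]) blast
  then obtain c where c: "\<And>E x. E \<in> T \<Longrightarrow> x \<in> interior (cell E) \<Longrightarrow> u x = c E"
    "\<And>E y. E \<in> T \<Longrightarrow> y \<in> cell E \<Longrightarrow> trace_from E u y = c E" by blast
  \<comment> \<open>All terms with \<sigma> vanish, so testing with (\<tau>, 0, 0) gives the
    equation assumed in the locale.\<close>
  interpret msmfe_kernel \<Omega> T \<Gamma>N A c \<gamma>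
  proof (unfold_locales, rule \<gamma>)
    fix \<tau> th assume \<tau>: "\<tau> \<in> X_space \<Omega> \<Gamma>N T" and th: "\<And>E. E \<in> T \<Longrightarrow> is_hat E \<tau> (th E)"
    have "quad_A T A \<sigma> \<tau> = 0" unfolding quad_A_vertices by (simp add: \<sigma>0)
    moreover have "quad T \<sigma> (\<lambda>_. 0) = 0" unfolding quad_vertices by (simp add: \<sigma>0)
    moreover have "L2_inner \<Omega> (weak_div \<Omega> \<sigma>) (\<lambda>_. 0) = 0" by (simp add: L2_inner_def)
    ultimately have "L2_inner \<Omega> u (weak_div \<Omega> \<tau>) + quad T \<gamma> \<tau> = 0"
      using eq[OF \<tau> V_space_zero W1_space_zero] by simp
    moreover have "L2_inner \<Omega> u (weak_div \<Omega> \<tau>) = (\<Sum>E\<in>T. c E \<bullet> hat_div (th E))"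
      by (rule L2_inner_weak_div(1)[OF \<tau> th c(1)])
    ultimately show "(\<Sum>E\<in>T. c E \<bullet> hat_div (th E)) + quad T \<gamma> \<tau> = 0" by simp
  qed
  show ?thesis
    unfolding zc vertex_coords_def using \<sigma>0 G_zero u_zero c(2) vert_in_cell
    by (auto simp: fun_eq_iff zero_prod_def)
qed

text \<open>For \<sigma> and \<open>u\<close> the values on the cell boundaries are free, hence the
  claim almost everywhere, whereas \<gamma> is continuous. For \<sigma> the reference fields vanish
  by \<open>ERT0_unisolvent\<close>.\<close>

lemma vertex_coords_zeroD:
  assumes \<sigma>: "\<sigma> \<in> X_space \<Omega> \<Gamma>N T" and u: "u \<in> V_space T" and \<gamma>: "\<gamma> \<in> W1_space \<Omega> T"
    and 0: "vertex_coords \<sigma> u \<gamma> = (\<lambda>_. 0)"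
  shows "AE x in lebesgue_on \<Omega>. \<sigma> x = 0" "AE x in lebesgue_on \<Omega>. u x = 0" "\<forall>x\<in>\<Omega>. \<gamma> x = 0"
proof -
  have z: "vtrace E \<sigma> S = 0 \<and> vtrace E u S = 0 \<and> vtrace E \<gamma> S = 0" if "E \<in> T" for E S
    using fun_cong[OF 0, of "(E, S)"] that by (simp add: vertex_coords_def zero_prod_def)
  show "\<forall>x\<in>\<Omega>. \<gamma> x = 0" using W1_zero[OF \<gamma>] z by blast
  have null: "\<Omega> - (\<Union>E\<in>T. interior (cell E)) \<in> null_sets (lebesgue_on \<Omega>)"
    using negligible_skeleton domain_sets by (simp add: null_sets_restrict_space negligible_iff_null_sets)
  have AE: "AE x in lebesgue_on \<Omega>. P x" if "\<And>E x. E \<in> T \<Longrightarrow> x \<in> interior (cell E) \<Longrightarrow> P x" for P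
    by (rule AE_I'[OF null]) (use that in auto)
  have "\<exists>c. (\<forall>E\<in>T. \<forall>x\<in>interior (cell E). u x = c E) \<and> (\<forall>E\<in>T. \<forall>y\<in>cell E. trace_from E u y = c E)"
    by (rule V_const[OF u]) blast
  then show "AE x in lebesgue_on \<Omega>. u x = 0"
    using z vert_in_cell by (intro AE) metis
  obtain th where th: "\<forall>E\<in>T. is_hat E \<sigma> (th E)" by (rule X_space_hats[OF \<sigma>])
  show "AE x in lebesgue_on \<Omega>. \<sigma> x = 0"
  proof (rule AE)
    fix E x assume E: "E \<in> T" and x: "x \<in> interior (cell E)"
    note cE = mesh_cuboid[OF E]
    have h: "is_hat E \<sigma> (th E)" using th E by blast
    have inj: "v = 0" if "jac E *v v = 0" for v
    proof -
      have "ref_map E v = ref_map E 0" using that by (simp add: ref_map_def)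
      then show ?thesis using cE by simp
    qed
    have "th E (vert S) $ i = 0" for S i
    proof -
      have "piola E (th E) (vert S) $ i = 0" using z[OF E, of S] is_hat_trace[OF cE h vert_in_ref_cube] by simp
      then have "jac E *v th E (vert S) $ i = 0" using det_jac[OF cE] by (simp add: piola_def)
      then show ?thesis by (rule inj)
    qed
    then have "(\<lambda>x. th E x $ i) = (\<lambda>_. 0)" for i
      using h by (intro ERT0_unisolvent) (auto simp: is_hat_def)
    then have 0: "th E y $ i = 0" for y i by (rule fun_cong)
    have "piola E (th E) y = 0" for y unfolding piola_def 0 by (simp add: vec_eq_iff)
    moreover obtain y where "x = ref_map E y" "y \<in> interior ref_cube" using x cE by (auto simp: interior_cell)
    ultimately show "\<sigma> x = 0" using h by (simp add: is_hat_def)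
  qed
qed

text \<open>The finite-dimensional solvability result for functions with pointwise operations; unit
  data at the vertices of \<open>T\<close> provide the finite spanning set.\<close>

lemma vertex_problem_solvable:
  assumes l: "\<And>z w a b. l (\<lambda>k. a *\<^sub>R z k + b *\<^sub>R w k) = a * l z + b * l w"
  shows "\<exists>z\<in>vertex_space. \<forall>w\<in>vertex_space. vertex_bilinear z w = l w"
proof -
  interpret fs: vector_space "\<lambda>a (f :: cuboid \<times> 3 set \<Rightarrow> vertex_data) x. a *\<^sub>R f x"
    by (rule vector_space_fun)
  let ?K = "T \<times> (UNIV :: 3 set set)"
  let ?U = "(\<lambda>(k, b) l. if l = k then b else 0) ` (?K \<times> (Basis :: vertex_data set))"
  have plus: "x + y = (\<lambda>k. 1 *\<^sub>R x k + 1 *\<^sub>R y k)" for x y :: "cuboid \<times> 3 set \<Rightarrow> vertex_data"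
    by (simp add: fun_eq_iff)
  have zero: "0 \<in> vertex_space"
  proof -
    have "vertex_coords (\<lambda>_. 0) (\<lambda>_. 0) (\<lambda>_. 0) \<in> vertex_space"
      unfolding vertex_space_def using X_space_zero V_space_zero W1_space_zero by blast
    from vertex_space_lincomb[OF this this, of 0 0] show ?thesis by (simp add: zero_fun_def)
  qed
  show ?thesis
  proof (rule fs.bilinear_form_solvable)
    show "fs.subspace vertex_space"
    proof (rule fs.subspaceI)
      show "x + y \<in> vertex_space" if "x \<in> vertex_space" "y \<in> vertex_space" for x y
        unfolding plus by (rule vertex_space_lincomb[OF that])
      show "(\<lambda>k. c *\<^sub>R x k) \<in> vertex_space" if "x \<in> vertex_space" for c x
        using vertex_space_lincomb[OF that that, of c 0] by simp
    qed (rule zero)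
    show "finite ?U" using finite_mesh by simp
    show "vertex_space \<subseteq> fs.span ?U"
    proof
      fix z assume "z \<in> vertex_space"
      then have "z k = 0" if "k \<notin> ?K" for k
        using that by (cases k) (auto simp: vertex_space_def vertex_coords_def)
      then have "z = (\<Sum>k\<in>?K. \<Sum>b\<in>Basis. (\<lambda>l. (z k \<bullet> b) *\<^sub>R (if l = k then b else 0)))"
        by (intro sum_units) (use finite_mesh in auto)
      also have "\<dots> \<in> fs.span ?U"
      proof (intro fs.span_sum fs.span_scale fs.span_base)
        fix k and b :: vertex_data assume "k \<in> ?K" "b \<in> Basis"
        then have "(k, b) \<in> ?K \<times> Basis" by blast
        then show "(\<lambda>l. if l = k then b else 0) \<in> ?U" by (rule rev_image_eqI) simp
      qed
      finally show "z \<in> fs.span ?U" .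
    qed
    show "vertex_bilinear (x + y) w = vertex_bilinear x w + vertex_bilinear y w"
      "vertex_bilinear w (x + y) = vertex_bilinear w x + vertex_bilinear w y" for x y w
      unfolding plus vertex_bilinear_lincomb by simp_all
    show "vertex_bilinear (\<lambda>k. c *\<^sub>R x k) w = c * vertex_bilinear x w"
      "vertex_bilinear w (\<lambda>k. c *\<^sub>R x k) = c * vertex_bilinear w x" for c x w
      using vertex_bilinear_lincomb(1)[of c x 0 x w] vertex_bilinear_lincomb(2)[of w c x 0 x] by simp_all
    show "l (x + y) = l x + l y" for x y unfolding plus l by simp
    show "l (\<lambda>k. c *\<^sub>R x k) = c * l x" for c x using l[of c x 0 x] by simp
    show "z = 0" if "z \<in> vertex_space" "\<And>w. w \<in> vertex_space \<Longrightarrow> vertex_bilinear z w = 0" for z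
      using vertex_bilinear_kernel[OF that] by (simp add: zero_fun_def)
  qed
qed

lemma msmfe1_solution_exists:
  assumes f: "L2_on \<Omega> f"
  shows "\<exists>\<sigma> u \<gamma>. msmfe1_solution \<Omega> \<Gamma>N T A f \<sigma> u \<gamma>"
proof -
  let ?F = "\<lambda>E. \<chi> i. integral (interior (cell E)) (\<lambda>x. f x $ i)"
  \<comment> \<open>The right-hand side as a functional of vertex data: against piecewise constants
    \<open>f\<close> acts through its cell integrals.\<close>
  define l where "l w = (\<Sum>E\<in>T. fst (snd (w (E, {}))) \<bullet> ?F E)" for w :: "cuboid \<times> 3 set \<Rightarrow> vertex_data"
  have "l (\<lambda>k. a *\<^sub>R z k + b *\<^sub>R w k) = a * l z + b * l w" for z w a b
    by (simp add: l_def inner_add_left sum.distrib sum_distrib_left)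
  then obtain z where z: "z \<in> vertex_space" "\<forall>w\<in>vertex_space. vertex_bilinear z w = l w"
    using vertex_problem_solvable by blast
  obtain \<sigma> u \<gamma> where zc: "z = vertex_coords \<sigma> u \<gamma>" and \<sigma>: "\<sigma> \<in> X_space \<Omega> \<Gamma>N T" and u: "u \<in> V_space T" and \<gamma>: "\<gamma> \<in> W1_space \<Omega> T"
    using z(1) unfolding vertex_space_def by blast
  have lf: "l (vertex_coords \<tau> v w) = L2_inner \<Omega> f v" if v: "v \<in> V_space T" for \<tau> v w
  proof -
    have "\<exists>c. (\<forall>E\<in>T. \<forall>x\<in>interior (cell E). v x = c E) \<and> (\<forall>E\<in>T. \<forall>y\<in>cell E. trace_from E v y = c E)"
      by (rule V_const[OF v]) blast
    then obtain c where c: "\<And>E x. E \<in> T \<Longrightarrow> x \<in> interior (cell E) \<Longrightarrow> v x = c E"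
      "\<And>E y. E \<in> T \<Longrightarrow> y \<in> cell E \<Longrightarrow> trace_from E v y = c E" by blast
    have "l (vertex_coords \<tau> v w) = (\<Sum>E\<in>T. c E \<bullet> ?F E)"
      unfolding l_def by (intro sum.cong refl) (simp add: vertex_coords_def c(2) vert_in_cell)
    also have "\<dots> = L2_inner \<Omega> f v"
      by (rule L2_inner_piecewise_constant(2)[OF f c(1), symmetric])
    finally show ?thesis .
  qed
  have eq: "quad_A T A \<sigma> \<tau> + L2_inner \<Omega> u (weak_div \<Omega> \<tau>) + quad T \<gamma> \<tau> + L2_inner \<Omega> (weak_div \<Omega> \<sigma>) v + quad T \<sigma> w = L2_inner \<Omega> f v"
    if "\<tau> \<in> X_space \<Omega> \<Gamma>N T" "v \<in> V_space T" "w \<in> W1_space \<Omega> T" for \<tau> v w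
  proof -
    have "vertex_coords \<tau> v w \<in> vertex_space" unfolding vertex_space_def using that by blast
    then show ?thesis
      using z(2) lf[OF that(2)] vertex_bilinear_coords[OF \<sigma> u that(1,2), of \<gamma> w] unfolding zc by simp
  qed
  have z1: "L2_inner \<Omega> g (\<lambda>_. 0) = 0" for g :: "real^3 \<Rightarrow> real^3" by (simp add: L2_inner_def)
  have z2: "quad T g (\<lambda>_. 0) = 0" for g
    unfolding quad_vertices by (intro sum.neutral) (simp add: trace_from_const vert_in_cell)
  have z3: "quad_A T A \<sigma> (\<lambda>_. 0) = 0"
    unfolding quad_A_vertices by (intro sum.neutral) (simp add: trace_from_const vert_in_cell)
  \<comment> \<open>\<open>weak_div\<close> of the zero field is a chosen representative, so its
    product with \<open>u\<close> is evaluated through vertex traces.\<close>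
  have z4: "L2_inner \<Omega> u (weak_div \<Omega> (\<lambda>_. 0)) = 0"
    using L2_inner_weak_div_vertices(1)[OF X_space_zero u] trace_div_lincomb[of _ 0 "\<lambda>_. 0" 0 "\<lambda>_. 0"]
    by (simp add: trace_from_const vert_in_cell)
  \<comment> \<open>Setting two of the three test functions to 0 recovers the individual equations
    from their sum.\<close>
  show ?thesis
    unfolding msmfe1_solution_def
  proof (intro exI conjI ballI)
    show "\<sigma> \<in> X_space \<Omega> \<Gamma>N T" "u \<in> V_space T" "\<gamma> \<in> W1_space \<Omega> T" by fact+
    show "quad_A T A \<sigma> \<tau> + L2_inner \<Omega> u (weak_div \<Omega> \<tau>) + quad T \<gamma> \<tau> = 0" if "\<tau> \<in> X_space \<Omega> \<Gamma>N T" for \<tau>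
      using eq[OF that V_space_zero W1_space_zero] by (simp add: z1 z2)
    show "L2_inner \<Omega> (weak_div \<Omega> \<sigma>) v = L2_inner \<Omega> f v" if "v \<in> V_space T" for v
      using eq[OF X_space_zero that W1_space_zero] by (simp add: z2 z3 z4)
    show "quad T \<sigma> w = 0" if "w \<in> W1_space \<Omega> T" for w
      using eq[OF X_space_zero V_space_zero that] by (simp add: z1 z2 z3 z4)
  qed
qed

text \<open>Two solutions give the same functional on \<open>vertex_space\<close>, so the difference
  of their vertex data lies in the kernel of the form.\<close>

lemma msmfe1_solution_unique:
  assumes f: "L2_on \<Omega> f" and s: "msmfe1_solution \<Omega> \<Gamma>N T A f \<sigma> u \<gamma>" and s': "msmfe1_solution \<Omega> \<Gamma>N T A f \<sigma>' u' \<gamma>'"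
  shows "(AE x in lebesgue_on \<Omega>. \<sigma> x = \<sigma>' x) \<and> (AE x in lebesgue_on \<Omega>. u x = u' x) \<and> (\<forall>x\<in>\<Omega>. \<gamma> x = \<gamma>' x)"
proof -
  let ?z = "vertex_coords \<sigma> u \<gamma>" and ?z' = "vertex_coords \<sigma>' u' \<gamma>'"
  have m: "\<sigma> \<in> X_space \<Omega> \<Gamma>N T" "u \<in> V_space T" "\<gamma> \<in> W1_space \<Omega> T"
    and m': "\<sigma>' \<in> X_space \<Omega> \<Gamma>N T" "u' \<in> V_space T" "\<gamma>' \<in> W1_space \<Omega> T"
    using s s' by (simp_all add: msmfe1_solution_def)
  let ?d = "\<lambda>g h x. 1 *\<^sub>R g x + (-1) *\<^sub>R h x"
  have z: "?z \<in> vertex_space" "?z' \<in> vertex_space" unfolding vertex_space_def using m m' by blast+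
  have eq: "vertex_bilinear ?z w = vertex_bilinear ?z' w" if "w \<in> vertex_space" for w
  proof -
    obtain \<tau> v \<eta> where w: "w = vertex_coords \<tau> v \<eta>" "\<tau> \<in> X_space \<Omega> \<Gamma>N T" "v \<in> V_space T" "\<eta> \<in> W1_space \<Omega> T"
      using \<open>w \<in> vertex_space\<close> unfolding vertex_space_def by blast
    show ?thesis
      unfolding w(1) vertex_bilinear_coords[OF m(1,2) w(2,3)] vertex_bilinear_coords[OF m'(1,2) w(2,3)]
      using s s' w(2-4) by (simp add: msmfe1_solution_def)
  qed
  have "(\<lambda>k. 1 *\<^sub>R ?z k + (-1) *\<^sub>R ?z' k) = (\<lambda>_. 0)"
  proof (rule vertex_bilinear_kernel[OF vertex_space_lincomb[OF z]])
    show "vertex_bilinear (\<lambda>k. 1 *\<^sub>R ?z k + (-1) *\<^sub>R ?z' k) w = 0" if "w \<in> vertex_space" for w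
      unfolding vertex_bilinear_lincomb eq[OF that] by simp
  qed
  then have "vertex_coords (?d \<sigma> \<sigma>') (?d u u') (?d \<gamma> \<gamma>') = (\<lambda>_. 0)"
    unfolding vertex_coords_lincomb[OF m m'] .
  from vertex_coords_zeroD[OF X_space_lincomb[OF m(1) m'(1)] V_space_lincomb[OF m(2) m'(2)] W1_space_lincomb[OF m(3) m'(3)] this]
  show ?thesis by simp
qed

end

theorem theorem4p3:
  fixes \<Omega> \<Gamma>D \<Gamma>N :: "(real^3) set" and T :: "cuboid set" and \<kappa> :: real
    and A :: "real^3 \<Rightarrow> (real^3^3) \<Rightarrow>\<^sub>L (real^3^3)"
  assumes domain: "open \<Omega>" "connected \<Omega>" "\<Omega> \<noteq> {}" "bounded \<Omega>" "simply_connected \<Omega>"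
    and mesh: "cuboid_mesh \<Omega> T" "shape_regular \<kappa> T"
    and boundary: "frontier \<Omega> = \<Gamma>D \<union> \<Gamma>N" "\<Gamma>D \<noteq> {}"
      "union_of_faces T \<Gamma>D" "union_of_faces T \<Gamma>N"
    and compliance: "compliance_tensor \<Omega> T A"
    and A1: "\<forall>E\<in>T. card {F \<in> faces E. F \<subseteq> \<Gamma>N} \<le> 1"
    and A2: "agglomerates \<Omega> T"
  shows "\<forall>f. L2_on \<Omega> f \<longrightarrow>
    (\<exists>\<sigma> u \<gamma>. msmfe1_solution \<Omega> \<Gamma>N T A f \<sigma> u \<gamma>) \<and>
    (\<forall>\<sigma> u \<gamma> \<sigma>' u' \<gamma>'.
       msmfe1_solution \<Omega> \<Gamma>N T A f \<sigma> u \<gamma> \<and> msmfe1_solution \<Omega> \<Gamma>N T A f \<sigma>' u' \<gamma>' \<longrightarrow>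
       (AE x in lebesgue_on \<Omega>. \<sigma> x = \<sigma>' x) \<and> (AE x in lebesgue_on \<Omega>. u x = u' x) \<and>
       (\<forall>x\<in>\<Omega>. \<gamma> x = \<gamma>' x))"
proof -
  have "union_of_faces T (frontier \<Omega>)"
  proof -
    obtain \<F> \<G> where "\<F> \<subseteq> (\<Union>E\<in>T. faces E)" "\<Gamma>D = \<Union>\<F>" "\<G> \<subseteq> (\<Union>E\<in>T. faces E)" "\<Gamma>N = \<Union>\<G>"
      using boundary(3,4) unfolding union_of_faces_def by auto
    then show ?thesis unfolding union_of_faces_def boundary(1)
      by (intro exI[of _ "\<F> \<union> \<G>"]) (simp add: Union_Un_distrib)
  qed
  then interpret msmfe \<Omega> T \<Gamma>N A
    using domain mesh boundary(1) compliance A1 by unfold_locales auto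
  show ?thesis using msmfe1_solution_exists msmfe1_solution_unique by blast
qed

end
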